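(* Let $d<D$ be positive integers, $\alpha>0$, and let $m,n$ be positive integers such that $n=\lfloor m^{\alpha}\rfloor$ and $m,n$ are sufficiently large with respect to $D$ and $\alpha$. Then there exist a prime $p$, a set of $m$ points $\mathcal{P}\subseteq\mathbb{F}_p^D$ and a set $\mathcal{V}$ of $n$ varieties in $\mathbb{F}_p^D$ of dimension $d$ and degree at most $\Delta=\lceil(1+\alpha)(d+1)\rceil^2$ such that $G(\mathcal{P},\mathcal{V})$ does not contain $K_{s,s}$ with $s=\Delta^{1/2}$, and $$I(\mathcal{P},\mathcal{V})\geq\Omega_{d,\alpha}\big(m^{\frac{d}{d+1}}n\big).$$
   Context: For a field $\mathbb{F}$ with algebraic closure $\overline{\mathbb{F}}$, an (affine) algebraic set is the set of common zeros in $\overline{\mathbb{F}}^D$ of finitely many polynomials in $\overline{\mathbb{F}}[x_1,\dots,x_D]$; a variety is an irreducible algebraic set. The dimension and degree of an affine variety are those of the associated projective variety $V$ (its projective closure): $\dim V$ is the degree of the Hilbert polynomial of $I(V)$ and $\deg V$ is $(\dim V)!$ times its leading coefficient. The incidence graph $G(\mathcal{P},\mathcal{V})$ is the bipartite graph on $\mathcal{P}\cup\mathcal{V}$ in which $x\in\mathcal{P}$ and $V\in\mathcal{V}$ are adjacent iff $x\in V$; $I(\mathcal{P},\mathcal{V})$ is its number of edges. $K_{s,s}$ is the complete bipartite graph with classes of size $s$. $\Omega_{d,\alpha}$ hides a positive constant depending only on $d$ and $\alpha$. *)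

theory Defs
  imports
    Complex_Main
    "HOL-Library.Multiset"
    "HOL-Library.FuncSet"
    "HOL-Computational_Algebra.Primes"
    "HOL-Computational_Algebra.Polynomial"
    "HOL-Algebra.QuotRing"
    "HOL-Algebra.Embedded_Algebras"
    "HOL-Algebra.Indexed_Polynomials"
    "HOL-Algebra.Algebraic_Closure"
    "HOL-Number_Theory.Residues"
begin

section \<open>Multivariate polynomials over a ring\<close>

text \<open>
  The polynomial ring in the variables with indices below \<open>n\<close>. Elements are indexed polynomials
  of \<^theory>\<open>HOL-Algebra.Indexed_Polynomials\<close>: functions from monomials (multisets of variable
  indices) to coefficients. That theory provides the underlying set and the addition, but no
  ring record, since it only multiplies by single variables.
\<close>

definition mpoly_ring :: "('a, 'r) ring_scheme \<Rightarrow> nat \<Rightarrow> (nat multiset \<Rightarrow> 'a) ring" where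
  "mpoly_ring R n =
     \<lparr> carrier = ring.indexed_pset R {..<n} (carrier R),
       monoid.mult = (\<lambda>f g m. \<Oplus>\<^bsub>R\<^esub>k\<in>{k. k \<subseteq># m}. f k \<otimes>\<^bsub>R\<^esub> g (m - k)),
       one = ring.indexed_const R \<one>\<^bsub>R\<^esub>,
       zero = ring.indexed_const R \<zero>\<^bsub>R\<^esub>,
       add = ring.indexed_padd R \<rparr>"

definition mpoly_eval :: "('a, 'r) ring_scheme \<Rightarrow> (nat multiset \<Rightarrow> 'a) \<Rightarrow> (nat \<Rightarrow> 'a) \<Rightarrow> 'a" where
  "mpoly_eval R f x =
     (\<Oplus>\<^bsub>R\<^esub>m\<in>{m. f m \<noteq> \<zero>\<^bsub>R\<^esub>}. f m \<otimes>\<^bsub>R\<^esub> (\<Otimes>\<^bsub>R\<^esub>i\<in>set_mset m. x i [^]\<^bsub>R\<^esub> count m i))"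

text \<open>The degree-\<open>t\<close> part of the polynomial ring; it contains the zero polynomial.\<close>

definition homogeneous_part :: "('a, 'r) ring_scheme \<Rightarrow> nat \<Rightarrow> nat \<Rightarrow> (nat multiset \<Rightarrow> 'a) set" where
  "homogeneous_part R n t =
     {f \<in> carrier (mpoly_ring R n). \<forall>m. f m \<noteq> \<zero>\<^bsub>R\<^esub> \<longrightarrow> size m = t}"


section \<open>Affine varieties\<close>

text \<open>In this and the next section \<open>R\<close> is meant to be an algebraically closed field.\<close>

abbreviation affine_space :: "'a set \<Rightarrow> nat \<Rightarrow> (nat \<Rightarrow> 'a) set" where
  "affine_space F n \<equiv> {..<n} \<rightarrow>\<^sub>E F"

definition algebraic_set :: "('a, 'r) ring_scheme \<Rightarrow> nat \<Rightarrow> (nat \<Rightarrow> 'a) set \<Rightarrow> bool" where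
  "algebraic_set R n V \<longleftrightarrow>
     (\<exists>A. finite A \<and> A \<subseteq> carrier (mpoly_ring R n) \<and>
          V = {x \<in> affine_space (carrier R) n. \<forall>f\<in>A. mpoly_eval R f x = \<zero>\<^bsub>R\<^esub>})"

definition variety :: "('a, 'r) ring_scheme \<Rightarrow> nat \<Rightarrow> (nat \<Rightarrow> 'a) set \<Rightarrow> bool" where
  "variety R n V \<longleftrightarrow>
     algebraic_set R n V \<and> V \<noteq> {} \<and>
     (\<forall>V1 V2. algebraic_set R n V1 \<longrightarrow> algebraic_set R n V2 \<longrightarrow> V = V1 \<union> V2 \<longrightarrow> V = V1 \<or> V = V2)"


section \<open>Projective closure, dimension and degree\<close>

text \<open>
  A subset of projective \<open>n\<close>-space is represented by the set of all homogeneous coordinate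
  vectors of its points, a set of nonzero vectors with \<open>n + 1\<close> coordinates that is closed
  under nonzero scalar multiplication.
\<close>

definition proj_algebraic_set :: "('a, 'r) ring_scheme \<Rightarrow> nat \<Rightarrow> (nat \<Rightarrow> 'a) set \<Rightarrow> bool" where
  "proj_algebraic_set R n W \<longleftrightarrow>
     (\<exists>A. finite A \<and> A \<subseteq> (\<Union>t. homogeneous_part R (Suc n) t) \<and>
          W = {x \<in> affine_space (carrier R) (Suc n).
                 (\<exists>i<Suc n. x i \<noteq> \<zero>\<^bsub>R\<^esub>) \<and> (\<forall>f\<in>A. mpoly_eval R f x = \<zero>\<^bsub>R\<^esub>)})"

text \<open>The embedding \<open>(x\<^sub>1, \<dots>, x\<^sub>n) \<mapsto> (1 : x\<^sub>1 : \<dots> : x\<^sub>n)\<close>; affine coordinates are indexed from 0.\<close>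

definition homogenize_point :: "('a, 'r) ring_scheme \<Rightarrow> nat \<Rightarrow> (nat \<Rightarrow> 'a) \<Rightarrow> (nat \<Rightarrow> 'a)" where
  "homogenize_point R n x = (\<lambda>i\<in>{..<Suc n}. case i of 0 \<Rightarrow> \<one>\<^bsub>R\<^esub> | Suc j \<Rightarrow> x j)"

definition proj_closure :: "('a, 'r) ring_scheme \<Rightarrow> nat \<Rightarrow> (nat \<Rightarrow> 'a) set \<Rightarrow> (nat \<Rightarrow> 'a) set" where
  "proj_closure R n V = \<Inter>{W. proj_algebraic_set R n W \<and> homogenize_point R n ` V \<subseteq> W}"

definition proj_vanishing_ideal ::
  "('a, 'r) ring_scheme \<Rightarrow> nat \<Rightarrow> (nat \<Rightarrow> 'a) set \<Rightarrow> (nat multiset \<Rightarrow> 'a) set" where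
  "proj_vanishing_ideal R n W =
     {f \<in> carrier (mpoly_ring R (Suc n)). \<forall>x\<in>W. mpoly_eval R f x = \<zero>\<^bsub>R\<^esub>}"

text \<open>
  The dimension, over the field \<open>R\<close> of constants, of the degree-\<open>t\<close> part of \<open>S / I\<close>, where
  \<open>S\<close> is the polynomial ring in \<open>n\<close> variables and \<open>I\<close> is an ideal of \<open>S\<close>.
\<close>

definition hilbert_function ::
  "('a, 'r) ring_scheme \<Rightarrow> nat \<Rightarrow> (nat multiset \<Rightarrow> 'a) set \<Rightarrow> nat \<Rightarrow> nat" where
  "hilbert_function R n I t =
     (let S = mpoly_ring R n; proj = (\<lambda>f. I +>\<^bsub>S\<^esub> f)
      in ring.dim (S Quot I) (proj ` ring.indexed_const R ` carrier R)
           (proj ` homogeneous_part R n t))"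

definition hilbert_polynomial ::
  "('a, 'r) ring_scheme \<Rightarrow> nat \<Rightarrow> (nat multiset \<Rightarrow> 'a) set \<Rightarrow> rat poly" where
  "hilbert_polynomial R n I =
     (THE h. \<forall>\<^sub>F t in sequentially. poly h (of_nat t) = of_nat (hilbert_function R n I t))"

definition variety_hilbert_polynomial ::
  "('a, 'r) ring_scheme \<Rightarrow> nat \<Rightarrow> (nat \<Rightarrow> 'a) set \<Rightarrow> rat poly" where
  "variety_hilbert_polynomial R n V =
     hilbert_polynomial R (Suc n) (proj_vanishing_ideal R n (proj_closure R n V))"

definition variety_dim :: "('a, 'r) ring_scheme \<Rightarrow> nat \<Rightarrow> (nat \<Rightarrow> 'a) set \<Rightarrow> nat" where
  "variety_dim R n V = Polynomial.degree (variety_hilbert_polynomial R n V)"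

definition variety_degree :: "('a, 'r) ring_scheme \<Rightarrow> nat \<Rightarrow> (nat \<Rightarrow> 'a) set \<Rightarrow> rat" where
  "variety_degree R n V =
     fact (variety_dim R n V) * Polynomial.lead_coeff (variety_hilbert_polynomial R n V)"


section \<open>Prime fields and their algebraic closures\<close>

definition Fp_closure :: "nat \<Rightarrow> ((int list \<times> nat) multiset \<Rightarrow> int) ring" where
  "Fp_closure p = field.alg_closure (residue_ring (int p))"

text \<open>The prime field, as a subset of its algebraic closure.\<close>

definition Fp :: "nat \<Rightarrow> ((int list \<times> nat) multiset \<Rightarrow> int) set" where
  "Fp p = ring.indexed_const (residue_ring (int p)) ` carrier (residue_ring (int p))"


section \<open>Incidence graphs\<close>

text \<open>A simple graph is a pair of its vertex set and its set of (two-element) edges.\<close>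

definition incidence_graph ::
  "'x set \<Rightarrow> 'x set set \<Rightarrow> ('x + 'x set) set \<times> ('x + 'x set) set set" where
  "incidence_graph P \<V> = (P <+> \<V>, {{Inl x, Inr V} |x V. x \<in> P \<and> V \<in> \<V> \<and> x \<in> V})"

definition incidences :: "'x set \<Rightarrow> 'x set set \<Rightarrow> nat" where
  "incidences P \<V> = card (snd (incidence_graph P \<V>))"

text \<open>The graph has a (not necessarily induced) subgraph isomorphic to \<open>K\<^sub>s\<^sub>,\<^sub>t\<close>.\<close>

definition contains_complete_bipartite :: "'v set \<times> 'v set set \<Rightarrow> nat \<Rightarrow> nat \<Rightarrow> bool" where
  "contains_complete_bipartite G s t \<longleftrightarrow>
     (\<exists>A B. finite A \<and> finite B \<and> A \<subseteq> fst G \<and> B \<subseteq> fst G \<and> A \<inter> B = {} \<and>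
            card A = s \<and> card B = t \<and> (\<forall>a\<in>A. \<forall>b\<in>B. {a, b} \<in> snd G))"

end

theory Submission
  imports Defs
begin

text \<open>
  Choose a prime \<open>p\<close> with \<open>p^(d+1)\<close> between \<open>m\<close> and a constant multiple of \<open>m\<close>; a weak form of
  Chebyshev's theorem, read off from the prime factorization of a central binomial coefficient,
  suffices for this. The varieties are graphs \<open>y = x\<^sub>0^s + g(x\<^sub>0, x\<^sub>1, \<dots>)\<close> over \<open>d\<close>-space inside a
  coordinate subspace, where \<open>g\<close> ranges over the polynomials over the prime field of degree less
  than \<open>s\<close>. As \<open>g\<close> can be interpolated at \<open>s\<close> points, a random graph passes through \<open>s\<close> given points
  with probability at most \<open>1 / p^s\<close>, so the first moment method yields \<open>n\<close> graphs without \<open>K\<^sub>s\<^sub>,\<^sub>s\<close>,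
  even on the set of all \<open>p^(d+1)\<close> points of the subspace. Each graph contains \<open>p^d\<close> of these
  points, and the \<open>m\<close> points of largest degree carry at least \<open>m n / p\<close> incidences.

  The fixed leading term \<open>x\<^sub>0^s\<close> makes the projective closure explicit: modulo its ideal, the
  monomials of degree less than \<open>s\<close> in \<open>x\<^sub>0\<close> that involve only \<open>x\<^sub>0, x\<^sub>1, \<dots>\<close>, \<open>y\<close> and the homogenizing
  variable form a basis. They span because \<open>x\<^sub>0^s\<close> can be eliminated, and they are independent
  because a Kronecker substitution turns them into univariate polynomials of distinct degrees.
  Hence the Hilbert function at \<open>t \<ge> s\<close> is the sum of \<open>(t - j + d) choose d\<close> over \<open>j < s\<close>, and the
  graphs have dimension \<open>d\<close> and degree \<open>s\<close>.
\<close>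

subsection \<open>The ring of multivariate polynomials\<close>

lemma finite_submultisets: "finite {k. k \<subseteq># m}"
proof -
  have "{k. k \<subseteq># m} \<subseteq> (\<Union>j\<in>{..size m}. {k. set_mset k \<subseteq> set_mset m \<and> size k = j})"
    using size_mset_mono set_mset_mono by (fastforce simp: subset_iff)
  moreover have "finite \<dots>"
    using finite_multisets_of_size[of "set_mset m"] by (auto simp: multisets_of_size_def)
  ultimately show ?thesis using finite_subset by blast
qed

definition (in cring) monom_val :: "('c \<Rightarrow> 'a) \<Rightarrow> 'c multiset \<Rightarrow> 'a" where
  "monom_val x m = (\<Otimes>i\<in>set_mset m. x i [^] count m i)"

context cring
begin

lemma monom_val_empty [simp]: "monom_val x {#} = \<one>"
  by (simp add: monom_val_def)

lemma monom_val_closed [intro, simp]: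
  assumes "x \<in> I \<rightarrow> carrier R" "set_mset m \<subseteq> I"
  shows "monom_val x m \<in> carrier R"
  unfolding monom_val_def by (rule finprod_closed) (use assms in auto)

lemma monom_val_add_mset:
  assumes x: "x \<in> I \<rightarrow> carrier R" and m: "set_mset m \<subseteq> I" and i: "i \<in> I"
  shows "monom_val x (add_mset i m) = x i \<otimes> monom_val x m"
proof -
  let ?A = "set_mset m - {i}"
  let ?g = "\<lambda>n j. x j [^] count n j"
  have fin: "finite ?A" and ni: "i \<notin> ?A" and xi: "x i \<in> carrier R" using x i by auto
  have c: "?g n \<in> ?A \<rightarrow> carrier R" for n :: "'c multiset" using x m by auto
  have eq: "(\<Otimes>j\<in>?A. ?g (add_mset i m) j) = (\<Otimes>j\<in>?A. ?g m j)"
    by (rule finprod_cong') (use c x m in auto)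
  have 1: "monom_val x (add_mset i m) = x i [^] Suc (count m i) \<otimes> (\<Otimes>j\<in>?A. ?g m j)"
  proof -
    have "set_mset (add_mset i m) = insert i ?A" by auto
    then show ?thesis unfolding monom_val_def
      using finprod_insert[OF fin ni c, of "add_mset i m"] xi eq by simp
  qed
  have 2: "monom_val x m = x i [^] count m i \<otimes> (\<Otimes>j\<in>?A. ?g m j)"
  proof (cases "i \<in># m")
    case True
    then have "set_mset m = insert i ?A" by auto
    then show ?thesis unfolding monom_val_def
      using finprod_insert[OF fin ni c, of m] xi by simp
  next
    case False
    then have "?A = set_mset m" "count m i = 0" by (auto simp: count_eq_zero_iff)
    then show ?thesis unfolding monom_val_def using finprod_closed[OF c, of m] xi by simp
  qed
  show ?thesis unfolding 1 2 using xi finprod_closed[OF c, of m] by (simp add: m_assoc m_comm)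
qed

lemma monom_val_add:
  assumes x: "x \<in> I \<rightarrow> carrier R" and m: "set_mset m \<subseteq> I" and n: "set_mset n \<subseteq> I"
  shows "monom_val x (m + n) = monom_val x m \<otimes> monom_val x n"
  using m
proof (induction m)
  case empty
  then show ?case using x n by simp
next
  case (add i m)
  then show ?case using monom_val_add_mset[OF x] monom_val_closed[OF x] x n
    by (simp add: m_assoc Pi_iff)
qed

subsubsection \<open>Evaluation\<close>

abbreviation "peval \<equiv> mpoly_eval R"

abbreviation mpolys :: "'c set \<Rightarrow> ('c multiset \<Rightarrow> 'a) set" where
  "mpolys I \<equiv> indexed_pset I (carrier R)"

lemma zero_mpolys: "indexed_const \<zero> \<in> mpolys I"
  by (rule indexed_pset.indexed_const) simp

lemma mpolys_coeff: "f \<in> mpolys I \<Longrightarrow> f m \<in> carrier R"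
  using indexed_pset_in_carrier carrier_coeffE by blast

lemma mpolys_support: "f \<in> mpolys I \<Longrightarrow> f m \<noteq> \<zero> \<Longrightarrow> set_mset m \<subseteq> I"
proof (induction arbitrary: m rule: indexed_pset.induct)
  case (indexed_padd P Q)
  then have "P m \<noteq> \<zero> \<or> Q m \<noteq> \<zero>" by (auto simp: indexed_padd_def)
  then show ?case using indexed_padd by blast
next
  case (indexed_pmult P i)
  then have "i \<in># m" "P (m - {#i#}) \<noteq> \<zero>" by (auto simp: indexed_pmult_def split: if_splits)
  then show ?case using indexed_pmult.IH[of "m - {#i#}"] indexed_pmult.hyps
    by (metis insert_DiffM insert_subset set_mset_add_mset_insert)
qed (auto simp: indexed_const_def split: if_splits)

lemma mpolys_finite_support: "f \<in> mpolys I \<Longrightarrow> finite {m. f m \<noteq> \<zero>}"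
proof (induction rule: indexed_pset.induct)
  case (indexed_const k)
  have "{m. indexed_const k m \<noteq> \<zero>} \<subseteq> {{#}}" by (auto simp: indexed_const_def)
  then show ?case using finite_subset by blast
next
  case (indexed_padd P Q)
  have "{m. indexed_padd P Q m \<noteq> \<zero>} \<subseteq> {m. P m \<noteq> \<zero>} \<union> {m. Q m \<noteq> \<zero>}"
    by (auto simp: indexed_padd_def)
  then show ?case using indexed_padd finite_subset by blast
next
  case (indexed_pmult P i)
  have "{m. indexed_pmult P i m \<noteq> \<zero>} \<subseteq> add_mset i ` {m. P m \<noteq> \<zero>}"
    by (auto simp: indexed_pmult_def image_iff split: if_splits intro!: exI[of _ "_ - {#i#}"])
  then show ?case using indexed_pmult finite_surj by blast
qed

lemma mpoly_eval_superset:
  assumes x: "x \<in> I \<rightarrow> carrier R" and f: "\<And>m. f m \<in> carrier R"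
    and M: "finite M" "{m. f m \<noteq> \<zero>} \<subseteq> M" "\<And>m. m \<in> M \<Longrightarrow> set_mset m \<subseteq> I"
  shows "peval f x = (\<Oplus>m\<in>M. f m \<otimes> monom_val x m)"
proof -
  have "(\<Oplus>m\<in>{m. f m \<noteq> \<zero>}. f m \<otimes> monom_val x m) = (\<Oplus>m\<in>M. f m \<otimes> monom_val x m)"
    by (rule add.finprod_mono_neutral_cong_left) (use assms monom_val_closed[OF x] in auto)
  then show ?thesis by (simp add: mpoly_eval_def monom_val_def)
qed

lemma mpoly_eval_closed:
  assumes "x \<in> I \<rightarrow> carrier R" "f \<in> mpolys I"
  shows "peval f x \<in> carrier R"
  unfolding mpoly_eval_def monom_val_def[symmetric]
  by (intro finsum_closed Pi_I m_closed mpolys_coeff[OF assms(2)] monom_val_closed[OF assms(1)])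
    (simp add: mpolys_support[OF assms(2)])

lemma mpoly_eval_const:
  assumes "k \<in> carrier R"
  shows "peval (indexed_const k) x = k"
proof -
  have "peval (indexed_const k) x = (\<Oplus>m\<in>{{#}}. indexed_const k m \<otimes> monom_val x m)"
    unfolding mpoly_eval_def monom_val_def[symmetric]
    by (rule add.finprod_mono_neutral_cong_left)
      (use assms in \<open>auto simp: indexed_const_def split: if_splits\<close>)
  then show ?thesis using assms by (simp add: indexed_const_def)
qed

lemma mpoly_eval_padd:
  assumes x: "x \<in> I \<rightarrow> carrier R" and f: "f \<in> mpolys I" and g: "g \<in> mpolys I"
  shows "peval (indexed_padd f g) x = peval f x \<oplus> peval g x"
proof -
  let ?M = "{m. f m \<noteq> \<zero>} \<union> {m. g m \<noteq> \<zero>}"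
  have M: "finite ?M" "\<And>m. m \<in> ?M \<Longrightarrow> set_mset m \<subseteq> I"
    using mpolys_finite_support mpolys_support f g by blast+
  have c: "f m \<in> carrier R" "g m \<in> carrier R" for m using mpolys_coeff f g by auto
  have mv: "m \<in> ?M \<Longrightarrow> monom_val x m \<in> carrier R" for m
    by (rule monom_val_closed[OF x M(2)])
  have "peval (indexed_padd f g) x = (\<Oplus>m\<in>?M. indexed_padd f g m \<otimes> monom_val x m)"
    by (rule mpoly_eval_superset[OF x, OF _ M(1) _ M(2)]) (use c in \<open>auto simp: indexed_padd_def\<close>)
  also have "\<dots> = (\<Oplus>m\<in>?M. f m \<otimes> monom_val x m \<oplus> g m \<otimes> monom_val x m)"
  proof (rule finsum_cong'[OF refl])
    fix m assume "m \<in> ?M"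
    then show "indexed_padd f g m \<otimes> monom_val x m = f m \<otimes> monom_val x m \<oplus> g m \<otimes> monom_val x m"
      using c[of m] mv[of m] by (simp add: indexed_padd_def l_distr)
  qed (use c mv in \<open>simp_all add: indexed_padd_def Pi_iff\<close>)
  also have "\<dots> = (\<Oplus>m\<in>?M. f m \<otimes> monom_val x m) \<oplus> (\<Oplus>m\<in>?M. g m \<otimes> monom_val x m)"
    by (rule finsum_addf) (use c mv in \<open>simp_all add: Pi_iff\<close>)
  also have "(\<Oplus>m\<in>?M. f m \<otimes> monom_val x m) = peval f x"
    by (rule mpoly_eval_superset[OF x c(1) M(1) _ M(2), symmetric]) auto
  also have "(\<Oplus>m\<in>?M. g m \<otimes> monom_val x m) = peval g x"
    by (rule mpoly_eval_superset[OF x c(2) M(1) _ M(2), symmetric]) auto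
  finally show ?thesis .
qed

lemma mpoly_eval_pmult:
  assumes x: "x \<in> I \<rightarrow> carrier R" and f: "f \<in> mpolys I" and i: "i \<in> I"
  shows "peval (indexed_pmult f i) x = x i \<otimes> peval f x"
proof -
  let ?M = "{m. f m \<noteq> \<zero>}"
  have M: "finite ?M" "\<And>m. m \<in> ?M \<Longrightarrow> set_mset m \<subseteq> I"
    using mpolys_finite_support mpolys_support f by blast+
  have c: "f m \<in> carrier R" for m using mpolys_coeff f by auto
  have mv: "m \<in> ?M \<Longrightarrow> monom_val x m \<in> carrier R" for m
    by (rule monom_val_closed[OF x M(2)])
  have xi: "x i \<in> carrier R" using x i by auto
  have e: "indexed_pmult f i (add_mset i m) \<otimes> monom_val x (add_mset i m) = x i \<otimes> (f m \<otimes> monom_val x m)"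
    if "m \<in> ?M" for m
    using c[of m] mv[OF that] xi monom_val_add_mset[OF x M(2)[OF that] i]
    by (simp add: indexed_pmult_def m_lcomm)
  have cl: "x i \<otimes> (f m \<otimes> monom_val x m) \<in> carrier R" if "m \<in> ?M" for m
    using c[of m] mv[OF that] xi by simp
  have "peval (indexed_pmult f i) x
      = (\<Oplus>m\<in>add_mset i ` ?M. indexed_pmult f i m \<otimes> monom_val x m)"
  proof (rule mpoly_eval_superset[OF x])
    show "{m. indexed_pmult f i m \<noteq> \<zero>} \<subseteq> add_mset i ` ?M"
      by (auto simp: indexed_pmult_def image_iff split: if_splits intro!: exI[of _ "_ - {#i#}"])
    show "set_mset m \<subseteq> I" if "m \<in> add_mset i ` ?M" for m
      using that mpolys_support[OF f] i by fastforce
  qed (use M(1) c in \<open>auto simp: indexed_pmult_def\<close>)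
  also have "\<dots> = (\<Oplus>m\<in>?M. indexed_pmult f i (add_mset i m) \<otimes> monom_val x (add_mset i m))"
  proof (rule add.finprod_reindex)
    show "(\<lambda>m. indexed_pmult f i m \<otimes> monom_val x m) \<in> add_mset i ` ?M \<rightarrow> carrier R"
      using e cl by fastforce
  qed (simp add: inj_on_def)
  also have "\<dots> = (\<Oplus>m\<in>?M. x i \<otimes> (f m \<otimes> monom_val x m))"
    by (rule finsum_cong'[OF refl Pi_I e]) (rule cl | assumption)+
  also have "\<dots> = x i \<otimes> (\<Oplus>m\<in>?M. f m \<otimes> monom_val x m)"
    by (rule finsum_rdistr[OF M(1) xi, symmetric]) (intro Pi_I m_closed c mv, assumption)
  finally show ?thesis by (simp add: mpoly_eval_def monom_val_def)
qed

end

context cring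
begin

subsubsection \<open>Multiplication\<close>

definition mpoly_mult :: "('c multiset \<Rightarrow> 'a) \<Rightarrow> ('c multiset \<Rightarrow> 'a) \<Rightarrow> 'c multiset \<Rightarrow> 'a" where
  "mpoly_mult f g m = (\<Oplus>k\<in>{k. k \<subseteq># m}. f k \<otimes> g (m - k))"

lemma mpoly_mult_coeff:
  assumes "\<And>m. f m \<in> carrier R" "\<And>m. g m \<in> carrier R"
  shows "mpoly_mult f g m \<in> carrier R"
  unfolding mpoly_mult_def using assms by (intro finsum_closed) auto

lemma mpoly_mult_const:
  assumes k: "k \<in> carrier R" and g: "\<And>m. g m \<in> carrier R"
  shows "mpoly_mult (indexed_const k) g = (\<lambda>m. k \<otimes> g m)"
proof
  fix m
  have "(\<Oplus>j\<in>{{#}}. indexed_const k j \<otimes> g (m - j))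
      = (\<Oplus>j\<in>{j. j \<subseteq># m}. indexed_const k j \<otimes> g (m - j))"
    by (rule add.finprod_mono_neutral_cong_left[OF finite_submultisets])
      (use k g in \<open>auto simp: indexed_const_def\<close>)
  then show "mpoly_mult (indexed_const k) g m = k \<otimes> g m"
    using k g by (simp add: mpoly_mult_def indexed_const_def)
qed

lemma mpoly_mult_padd:
  assumes "\<And>m. f m \<in> carrier R" "\<And>m. g m \<in> carrier R" "\<And>m. h m \<in> carrier R"
  shows "mpoly_mult (indexed_padd f g) h = indexed_padd (mpoly_mult f h) (mpoly_mult g h)"
proof
  fix m
  have "mpoly_mult (indexed_padd f g) h m
      = (\<Oplus>k\<in>{k. k \<subseteq># m}. f k \<otimes> h (m - k) \<oplus> g k \<otimes> h (m - k))"
    unfolding mpoly_mult_def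
    by (rule finsum_cong'[OF refl]) (use assms in \<open>simp_all add: indexed_padd_def l_distr\<close>)
  also have "\<dots> = mpoly_mult f h m \<oplus> mpoly_mult g h m"
    unfolding mpoly_mult_def by (rule finsum_addf) (use assms in simp_all)
  finally show "mpoly_mult (indexed_padd f g) h m = indexed_padd (mpoly_mult f h) (mpoly_mult g h) m"
    by (simp add: indexed_padd_def)
qed

lemma mpoly_mult_pmult:
  assumes f: "\<And>m. f m \<in> carrier R" and g: "\<And>m. g m \<in> carrier R"
  shows "mpoly_mult (indexed_pmult f i) g = indexed_pmult (mpoly_mult f g) i"
proof
  fix m
  show "mpoly_mult (indexed_pmult f i) g m = indexed_pmult (mpoly_mult f g) i m"
  proof (cases "i \<in># m")
    case False
    have "indexed_pmult f i k = \<zero>" if "k \<subseteq># m" for k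
      using that False mset_subset_eqD by (fastforce simp: indexed_pmult_def)
    then have "mpoly_mult (indexed_pmult f i) g m = \<zero>"
      unfolding mpoly_mult_def using g by (intro add.finprod_one_eqI) auto
    then show ?thesis using False by (simp add: indexed_pmult_def)
  next
    case True
    let ?K = "{k. k \<subseteq># m - {#i#}}"
    let ?h = "\<lambda>k. indexed_pmult f i k \<otimes> g (m - k)"
    have sub: "add_mset i ` ?K \<subseteq> {k. k \<subseteq># m}"
      using True by (auto simp: insert_subset_eq_iff)
    have zero: "?h k = \<zero>" if "k \<in> {k. k \<subseteq># m} - add_mset i ` ?K" for k
    proof -
      have "i \<notin># k"
      proof
        assume "i \<in># k"
        then have "k = add_mset i (k - {#i#})" by simp
        moreover have "k - {#i#} \<in> ?K" using that
          by (auto simp: subseteq_mset_def intro: diff_le_mono)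
        ultimately show False using that by blast
      qed
      then show ?thesis using g by (simp add: indexed_pmult_def)
    qed
    have cl: "?h \<in> A \<rightarrow> carrier R" for A
      using f g by (auto simp: indexed_pmult_def)
    have "mpoly_mult (indexed_pmult f i) g m = (\<Oplus>k\<in>add_mset i ` ?K. ?h k)"
      unfolding mpoly_mult_def
      by (rule add.finprod_mono_neutral_cong_right[OF finite_submultisets sub zero refl cl]) 
    also have "\<dots> = (\<Oplus>k\<in>?K. ?h (add_mset i k))"
      by (rule add.finprod_reindex[OF cl]) (simp add: inj_on_def)
    also have "\<dots> = (\<Oplus>k\<in>?K. f k \<otimes> g (m - {#i#} - k))"
      by (rule finsum_cong'[OF refl]) (use f g in \<open>simp_all add: indexed_pmult_def\<close>)
    finally show ?thesis using True by (simp add: indexed_pmult_def mpoly_mult_def)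
  qed
qed

lemma smult_mpolys:
  fixes I :: "'c set"
  assumes k: "k \<in> carrier R" and g: "g \<in> mpolys I"
  shows "(\<lambda>m. k \<otimes> g m) \<in> mpolys I"
  using g
proof (induction rule: indexed_pset.induct)
  case (indexed_const c)
  then have "(\<lambda>m :: 'c multiset. k \<otimes> indexed_const c m) = indexed_const (k \<otimes> c)"
    using k by (auto simp: indexed_const_def)
  moreover have "indexed_const (k \<otimes> c) \<in> mpolys I"
    by (rule indexed_pset.indexed_const) (use indexed_const k in simp)
  ultimately show ?case by simp
next
  case (indexed_padd P Q)
  then have "(\<lambda>m. k \<otimes> indexed_padd P Q m) = indexed_padd (\<lambda>m. k \<otimes> P m) (\<lambda>m. k \<otimes> Q m)"
    using k mpolys_coeff[of P I] mpolys_coeff[of Q I] by (simp add: indexed_padd_def r_distr)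
  then show ?case using indexed_pset.indexed_padd[OF indexed_padd.IH] by simp
next
  case (indexed_pmult P i)
  then have "(\<lambda>m. k \<otimes> indexed_pmult P i m) = indexed_pmult (\<lambda>m. k \<otimes> P m) i"
    using k by (auto simp add: indexed_pmult_def)
  then show ?case using indexed_pset.indexed_pmult[OF indexed_pmult.IH indexed_pmult.hyps(2)] by simp
qed

lemma mpoly_mult_closed:
  assumes f: "f \<in> mpolys I" and g: "g \<in> mpolys I"
  shows "mpoly_mult f g \<in> mpolys I"
  using f
proof (induction rule: indexed_pset.induct)
  case (indexed_const k)
  then have "mpoly_mult (indexed_const k) g = (\<lambda>m. k \<otimes> g m)"
    by (rule mpoly_mult_const) (rule mpolys_coeff[OF g])
  then show ?case using smult_mpolys[OF indexed_const g] by simp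
next
  case (indexed_padd P Q)
  have "mpoly_mult (indexed_padd P Q) g = indexed_padd (mpoly_mult P g) (mpoly_mult Q g)"
    by (rule mpoly_mult_padd; rule mpolys_coeff; fact)
  then show ?case using indexed_pset.indexed_padd[OF indexed_padd.IH] by simp
next
  case (indexed_pmult P i)
  have "mpoly_mult (indexed_pmult P i) g = indexed_pmult (mpoly_mult P g) i"
    by (rule mpoly_mult_pmult; rule mpolys_coeff; fact)
  then show ?case using indexed_pset.indexed_pmult[OF indexed_pmult.IH indexed_pmult.hyps(2)] by simp
qed

lemma mpoly_mult_comm:
  assumes f: "\<And>m. f m \<in> carrier R" and g: "\<And>m. g m \<in> carrier R"
  shows "mpoly_mult f g = mpoly_mult g f"
proof
  fix m :: "'c multiset"
  let ?K = "{k. k \<subseteq># m}"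
  have inv: "m - (m - k) = k" if "k \<subseteq># m" for k using that
    by (simp add: multiset_eq_iff subseteq_mset_def)
  have "(-) m ` ?K = ?K"
    using inv by (auto simp: image_iff) (metis diff_subset_eq_self)
  then have "mpoly_mult f g m = (\<Oplus>k\<in>(-) m ` ?K. f k \<otimes> g (m - k))"
    by (simp add: mpoly_mult_def)
  also have "\<dots> = (\<Oplus>k\<in>?K. f (m - k) \<otimes> g (m - (m - k)))"
    by (rule add.finprod_reindex) (use f g inv in \<open>auto intro!: inj_onI, metis\<close>)
  also have "\<dots> = mpoly_mult g f m"
    unfolding mpoly_mult_def
    by (rule finsum_cong'[OF refl]) (use f g inv in \<open>auto simp: m_comm\<close>)
  finally show "mpoly_mult f g m = mpoly_mult g f m" .
qed

lemma mpoly_mult_assoc: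
  assumes f: "f \<in> mpolys I" and g: "g \<in> mpolys I" and h: "h \<in> mpolys I"
  shows "mpoly_mult (mpoly_mult f g) h = mpoly_mult f (mpoly_mult g h)"
  using f
proof (induction rule: indexed_pset.induct)
  case (indexed_const k)
  note gh = mpolys_coeff[OF g] mpolys_coeff[OF h]
  have "mpoly_mult (\<lambda>m. k \<otimes> g m) h m = k \<otimes> mpoly_mult g h m" for m
  proof -
    have "mpoly_mult (\<lambda>m. k \<otimes> g m) h m = (\<Oplus>j\<in>{j. j \<subseteq># m}. k \<otimes> (g j \<otimes> h (m - j)))"
      unfolding mpoly_mult_def
      by (rule finsum_cong'[OF refl]) (use gh indexed_const in \<open>simp_all add: m_assoc\<close>)
    also have "\<dots> = k \<otimes> mpoly_mult g h m"
      unfolding mpoly_mult_def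
      by (rule finsum_rdistr[symmetric]) (use gh indexed_const finite_submultisets in \<open>simp_all\<close>)
    finally show ?thesis .
  qed
  then show ?case
    using mpoly_mult_const[of k g] mpoly_mult_const[of k "mpoly_mult g h"] gh indexed_const
    by (simp add: mpoly_mult_coeff)
next
  case (indexed_padd P Q)
  have *: "mpoly_mult P g \<in> mpolys I" "mpoly_mult Q g \<in> mpolys I" "mpoly_mult g h \<in> mpolys I"
    using indexed_padd g h mpoly_mult_closed by auto
  have "mpoly_mult (indexed_padd P Q) g = indexed_padd (mpoly_mult P g) (mpoly_mult Q g)"
    "mpoly_mult (indexed_padd P Q) (mpoly_mult g h)
      = indexed_padd (mpoly_mult P (mpoly_mult g h)) (mpoly_mult Q (mpoly_mult g h))"
    "mpoly_mult (indexed_padd (mpoly_mult P g) (mpoly_mult Q g)) h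
      = indexed_padd (mpoly_mult (mpoly_mult P g) h) (mpoly_mult (mpoly_mult Q g) h)"
    by (rule mpoly_mult_padd; rule mpolys_coeff; fact)+
  then show ?case using indexed_padd.IH by simp
next
  case (indexed_pmult P i)
  have *: "mpoly_mult P g \<in> mpolys I" "mpoly_mult g h \<in> mpolys I"
    using indexed_pmult g h mpoly_mult_closed by auto
  have "mpoly_mult (indexed_pmult P i) g = indexed_pmult (mpoly_mult P g) i"
    "mpoly_mult (indexed_pmult P i) (mpoly_mult g h) = indexed_pmult (mpoly_mult P (mpoly_mult g h)) i"
    "mpoly_mult (indexed_pmult (mpoly_mult P g) i) h = indexed_pmult (mpoly_mult (mpoly_mult P g) h) i"
    by (rule mpoly_mult_pmult; rule mpolys_coeff; fact)+
  then show ?case using indexed_pmult.IH by simp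
qed

lemma mpoly_eval_smult:
  assumes x: "x \<in> I \<rightarrow> carrier R" and k: "k \<in> carrier R" and g: "g \<in> mpolys I"
  shows "peval (\<lambda>m. k \<otimes> g m) x = k \<otimes> peval g x"
proof -
  let ?M = "{m. g m \<noteq> \<zero>}"
  have mv: "monom_val x m \<in> carrier R" if "m \<in> ?M" for m
    using that mpolys_support[OF g] monom_val_closed[OF x] by simp
  note c = mpolys_coeff[OF g]
  have "peval (\<lambda>m. k \<otimes> g m) x = (\<Oplus>m\<in>?M. k \<otimes> g m \<otimes> monom_val x m)"
    by (rule mpoly_eval_superset[OF x])
      (use k c mpolys_finite_support[OF g] mpolys_support[OF g] in auto)
  also have "\<dots> = (\<Oplus>m\<in>?M. k \<otimes> (g m \<otimes> monom_val x m))"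
    by (rule finsum_cong'[OF refl Pi_I m_assoc]) (intro m_closed k c mv; assumption)+
  also have "\<dots> = k \<otimes> (\<Oplus>m\<in>?M. g m \<otimes> monom_val x m)"
    by (rule finsum_rdistr[OF mpolys_finite_support[OF g] k, symmetric]) (intro Pi_I m_closed c mv)
  finally show ?thesis by (simp add: mpoly_eval_def monom_val_def)
qed

lemma mpoly_eval_mult:
  assumes x: "x \<in> I \<rightarrow> carrier R" and f: "f \<in> mpolys I" and g: "g \<in> mpolys I"
  shows "peval (mpoly_mult f g) x = peval f x \<otimes> peval g x"
  using f
proof (induction rule: indexed_pset.induct)
  case (indexed_const k)
  have "mpoly_mult (indexed_const k) g = (\<lambda>m. k \<otimes> g m)"
    by (rule mpoly_mult_const[OF indexed_const]) (rule mpolys_coeff[OF g])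
  then show ?case
    using mpoly_eval_smult[OF x indexed_const g] mpoly_eval_const[OF indexed_const] by simp
next
  case (indexed_padd P Q)
  have "mpoly_mult (indexed_padd P Q) g = indexed_padd (mpoly_mult P g) (mpoly_mult Q g)"
    by (rule mpoly_mult_padd; rule mpolys_coeff; fact)
  moreover have "mpoly_mult P g \<in> mpolys I" "mpoly_mult Q g \<in> mpolys I"
    using mpoly_mult_closed indexed_padd g by blast+
  ultimately show ?case
    using indexed_padd g mpoly_eval_padd[OF x] l_distr mpoly_eval_closed[OF x] by simp
next
  case (indexed_pmult P i)
  then have xi: "x i \<in> carrier R" using x by auto
  have "mpoly_mult P g \<in> mpolys I" by (rule mpoly_mult_closed[OF indexed_pmult.hyps(1) g])
  moreover have "mpoly_mult (indexed_pmult P i) g = indexed_pmult (mpoly_mult P g) i"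
    by (rule mpoly_mult_pmult; rule mpolys_coeff; fact)
  ultimately show ?case
    using indexed_pmult mpoly_eval_pmult[OF x] m_assoc[OF xi] mpoly_eval_closed[OF x] g by simp
qed

lemma mpoly_ring_simps:
  "carrier (mpoly_ring R n) = mpolys {..<n}"
  "f \<otimes>\<^bsub>mpoly_ring R n\<^esub> g = mpoly_mult f g"
  "f \<oplus>\<^bsub>mpoly_ring R n\<^esub> g = indexed_padd f g"
  "\<zero>\<^bsub>mpoly_ring R n\<^esub> = indexed_const \<zero>"
  "\<one>\<^bsub>mpoly_ring R n\<^esub> = indexed_const \<one>"
  by (simp_all add: mpoly_ring_def mpoly_mult_def fun_eq_iff)

lemma mpoly_ring_cring: "cring (mpoly_ring R n)"
proof (rule cringI)
  note c = mpolys_coeff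
  show "abelian_group (mpoly_ring R n)"
  proof (rule abelian_groupI; unfold mpoly_ring_simps)
    fix f assume f: "f \<in> mpolys {..<n}"
    have "indexed_padd (\<lambda>m. \<ominus> \<one> \<otimes> f m) f = indexed_const \<zero>"
      using c[OF f] by (auto simp: indexed_padd_def indexed_const_def l_minus l_neg)
    then show "\<exists>g\<in>mpolys {..<n}. indexed_padd g f = indexed_const \<zero>"
      using smult_mpolys[OF _ f, of "\<ominus> \<one>"] by auto
  next
    fix f g h assume f: "f \<in> mpolys {..<n}" and g: "g \<in> mpolys {..<n}" and h: "h \<in> mpolys {..<n}"
    show "indexed_padd f g \<in> mpolys {..<n}" using indexed_pset.indexed_padd[OF f g] .
    show "indexed_padd f g = indexed_padd g f"
      using c[OF f] c[OF g] by (simp add: indexed_padd_def a_comm)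
    show "indexed_padd (indexed_padd f g) h = indexed_padd f (indexed_padd g h)"
      using c[OF f] c[OF g] c[OF h] by (simp add: indexed_padd_def a_assoc)
    show "indexed_padd (indexed_const \<zero>) f = f"
      using c[OF f] by (simp add: indexed_padd_def indexed_const_def)
  qed (rule indexed_pset.indexed_const, simp)
  show "comm_monoid (mpoly_ring R n)"
  proof (rule comm_monoidI; unfold mpoly_ring_simps)
    fix f g h assume f: "f \<in> mpolys {..<n}" and g: "g \<in> mpolys {..<n}" and h: "h \<in> mpolys {..<n}"
    show "mpoly_mult f g \<in> mpolys {..<n}" using mpoly_mult_closed f g .
    show "mpoly_mult f g = mpoly_mult g f" by (rule mpoly_mult_comm[OF c[OF f] c[OF g]])
    show "mpoly_mult (mpoly_mult f g) h = mpoly_mult f (mpoly_mult g h)"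
      by (rule mpoly_mult_assoc[OF f g h])
    show "mpoly_mult (indexed_const \<one>) f = f"
      using mpoly_mult_const[OF _ c[OF f], of \<one>] c[OF f] by simp
  qed (simp add: indexed_pset.indexed_const)
qed (auto simp: mpoly_ring_simps intro!: mpoly_mult_padd mpolys_coeff)

definition mpoly_monom :: "'a \<Rightarrow> 'c multiset \<Rightarrow> 'c multiset \<Rightarrow> 'a" where
  "mpoly_monom k m = (\<lambda>n. if n = m then k else \<zero>)"

lemma mpoly_monom_closed:
  fixes I :: "'c set"
  assumes "k \<in> carrier R" "set_mset m \<subseteq> I"
  shows "mpoly_monom k m \<in> mpolys I"
  using assms(2)
proof (induction m)
  case empty
  have "(mpoly_monom k {#} :: 'c multiset \<Rightarrow> 'a) = indexed_const k" by (auto simp: mpoly_monom_def indexed_const_def)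
  then show ?case using indexed_pset.indexed_const[OF assms(1)] by simp
next
  case (add i m)
  have "mpoly_monom k (add_mset i m) = indexed_pmult (mpoly_monom k m) i"
    by (auto simp: mpoly_monom_def indexed_pmult_def fun_eq_iff)
  then show ?case using add indexed_pset.indexed_pmult[of "mpoly_monom k m"] by simp
qed

lemma mpoly_eval_monom:
  assumes "x \<in> I \<rightarrow> carrier R" "k \<in> carrier R" "set_mset m \<subseteq> I"
  shows "peval (mpoly_monom k m) x = k \<otimes> monom_val x m"
proof -
  have "peval (mpoly_monom k m) x = (\<Oplus>n\<in>{m}. mpoly_monom k m n \<otimes> monom_val x n)"
    by (rule mpoly_eval_superset) (use assms in \<open>auto simp: mpoly_monom_def\<close>)
  then show ?thesis using assms by (simp add: mpoly_monom_def monom_val_closed)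
qed

lemma mpolys_monom_induct [consumes 1, case_names zero add]:
  assumes f: "f \<in> mpolys I"
    and zero: "P (indexed_const \<zero>)"
    and add: "\<And>g m. g \<in> mpolys I \<Longrightarrow> f m \<noteq> \<zero> \<Longrightarrow> P g \<Longrightarrow> P (indexed_padd (mpoly_monom (f m) m) g)"
  shows "P f"
proof -
  have "P (\<lambda>m. if m \<in> M then f m else \<zero>) \<and> (\<lambda>m. if m \<in> M then f m else \<zero>) \<in> mpolys I"
    if "finite M" "M \<subseteq> {m. f m \<noteq> \<zero>}" for M
    using that
  proof (induction M)
    case empty
    show ?case using zero zero_mpolys[of I] by (simp add: indexed_const_def)
  next
    case (insert m M)
    have "(\<lambda>n. if n \<in> insert m M then f n else \<zero>)
        = indexed_padd (mpoly_monom (f m) m) (\<lambda>m. if m \<in> M then f m else \<zero>)"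
      using insert mpolys_coeff[OF f] by (auto simp: indexed_padd_def mpoly_monom_def)
    moreover have "mpoly_monom (f m) m \<in> mpolys I"
      using insert mpolys_support[OF f] mpolys_coeff[OF f] by (intro mpoly_monom_closed) auto
    ultimately show ?case using insert add indexed_pset.indexed_padd by auto
  qed
  from this[OF mpolys_finite_support[OF f] subset_refl] have "P (\<lambda>m. if f m \<noteq> \<zero> then f m else \<zero>)" by simp
  also have "(\<lambda>m. if f m \<noteq> \<zero> then f m else \<zero>) = f" by auto
  finally show ?thesis .
qed

end

subsection \<open>Univariate polynomial functions\<close>

context domain
begin

definition poly_fun_below :: "('a \<Rightarrow> 'a) \<Rightarrow> nat \<Rightarrow> bool" where
  "poly_fun_below h n \<longleftrightarrow>
     (\<exists>p\<in>carrier (poly_ring R). length p \<le> n \<and> (\<forall>z\<in>carrier R. h z = eval p z))"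

definition poly_fun_degree :: "('a \<Rightarrow> 'a) \<Rightarrow> nat \<Rightarrow> bool" where
  "poly_fun_degree h n \<longleftrightarrow>
     (\<exists>p\<in>carrier (poly_ring R). length p = Suc n \<and> (\<forall>z\<in>carrier R. h z = eval p z))"

definition poly_fun :: "('a \<Rightarrow> 'a) \<Rightarrow> bool" where
  "poly_fun h \<longleftrightarrow> (\<exists>n. poly_fun_below h n)"

lemma poly_ring_list_closed: "p \<in> carrier (poly_ring R) \<Longrightarrow> set p \<subseteq> carrier R"
  using polynomial_incl unfolding univ_poly_carrier[symmetric] by blast

lemma poly_fun_below_mono: "poly_fun_below h n \<Longrightarrow> n \<le> m \<Longrightarrow> poly_fun_below h m"
  unfolding poly_fun_below_def using order_trans[of _ n m] by blast

lemma poly_fun_degree_imp_below: "poly_fun_degree h n \<Longrightarrow> poly_fun_below h (Suc n)"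
  unfolding poly_fun_below_def poly_fun_degree_def using eq_imp_le by blast

lemma poly_fun_below_imp: "poly_fun_below h n \<Longrightarrow> poly_fun h"
  unfolding poly_fun_def by blast

lemma poly_fun_degree_imp: "poly_fun_degree h n \<Longrightarrow> poly_fun h"
  using poly_fun_degree_imp_below poly_fun_below_imp by blast

lemma poly_fun_below_cong:
  "poly_fun_below h n \<Longrightarrow> (\<And>z. z \<in> carrier R \<Longrightarrow> h' z = h z) \<Longrightarrow> poly_fun_below h' n"
  unfolding poly_fun_below_def by simp

lemma poly_fun_degree_cong:
  "poly_fun_degree h n \<Longrightarrow> (\<And>z. z \<in> carrier R \<Longrightarrow> h' z = h z) \<Longrightarrow> poly_fun_degree h' n"
  unfolding poly_fun_degree_def by simp

lemma poly_fun_cong: "poly_fun h \<Longrightarrow> (\<And>z. z \<in> carrier R \<Longrightarrow> h' z = h z) \<Longrightarrow> poly_fun h'"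
  unfolding poly_fun_def using poly_fun_below_cong by metis

lemma poly_fun_below_zero:
  assumes "\<And>z. z \<in> carrier R \<Longrightarrow> h z = \<zero>"
  shows "poly_fun_below h n"
  unfolding poly_fun_below_def
  by (rule bexI[OF _ univ_poly_zero_closed]) (simp add: assms)

lemma poly_fun_degree_monom:
  assumes "k \<in> carrier R" "k \<noteq> \<zero>"
  shows "poly_fun_degree (\<lambda>z. k \<otimes> z [^] n) n"
proof -
  have "monom k n \<in> carrier (poly_ring R)"
    using monom_is_polynomial[OF carrier_is_subring, of k n] assms
    unfolding univ_poly_carrier by blast
  moreover have "length (monom k n) = Suc n" by (simp add: monom_def)
  ultimately show ?thesis
    unfolding poly_fun_degree_def using eval_monom[OF assms(1)] by (intro bexI[of _ "monom k n"]) auto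
qed

lemma poly_fun_below_monom:
  assumes "k \<in> carrier R" "n < m"
  shows "poly_fun_below (\<lambda>z. k \<otimes> z [^] n) m"
proof (cases "k = \<zero>")
  case True
  then show ?thesis by (intro poly_fun_below_zero) simp
next
  case False
  show ?thesis
    using poly_fun_below_mono[OF poly_fun_degree_imp_below[OF poly_fun_degree_monom[OF assms(1) False]]]
      assms(2) by simp
qed

lemma poly_add_poly_ring:
  assumes p: "p \<in> carrier (poly_ring R)" and q: "q \<in> carrier (poly_ring R)"
  shows "poly_add p q \<in> carrier (poly_ring R)"
    "z \<in> carrier R \<Longrightarrow> eval (poly_add p q) z = eval p z \<oplus> eval q z"
    "length p \<noteq> length q \<Longrightarrow> length (poly_add p q) = max (length p) (length q)"
proof -
  have pq: "polynomial (carrier R) p" "polynomial (carrier R) q"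
    using p q by (simp_all add: univ_poly_carrier)
  show "poly_add p q \<in> carrier (poly_ring R)"
    using poly_add_closed[OF carrier_is_subring pq] by (simp add: univ_poly_carrier)
  show "z \<in> carrier R \<Longrightarrow> eval (poly_add p q) z = eval p z \<oplus> eval q z"
    by (rule eval_poly_add[OF poly_ring_list_closed[OF p] poly_ring_list_closed[OF q]])
  show "length p \<noteq> length q \<Longrightarrow> length (poly_add p q) = max (length p) (length q)"
    by (rule poly_add_length_eq[OF carrier_is_subring pq])
qed

lemma poly_fun_below_add:
  assumes "poly_fun_below g n" "poly_fun_below h n"
  shows "poly_fun_below (\<lambda>z. g z \<oplus> h z) n"
proof -
  obtain p q where p: "p \<in> carrier (poly_ring R)" "length p \<le> n" "\<forall>z\<in>carrier R. g z = eval p z"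
    and q: "q \<in> carrier (poly_ring R)" "length q \<le> n" "\<forall>z\<in>carrier R. h z = eval q z"
    using assms unfolding poly_fun_below_def by blast
  have "length (poly_add p q) \<le> n" using poly_add_length_le[of p q] p(2) q(2) by linarith
  then show ?thesis unfolding poly_fun_below_def
    using p(3) q(3) poly_add_poly_ring[OF p(1) q(1)] by (intro bexI[of _ "poly_add p q"]) simp_all
qed

lemma poly_fun_degree_add_below:
  assumes "poly_fun_degree g n" "poly_fun_below h n"
  shows "poly_fun_degree (\<lambda>z. g z \<oplus> h z) n"
proof -
  obtain p q where p: "p \<in> carrier (poly_ring R)" "length p = Suc n" "\<forall>z\<in>carrier R. g z = eval p z"
    and q: "q \<in> carrier (poly_ring R)" "length q \<le> n" "\<forall>z\<in>carrier R. h z = eval q z"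
    using assms unfolding poly_fun_below_def poly_fun_degree_def by blast
  then show ?thesis unfolding poly_fun_degree_def
    using poly_add_poly_ring[OF p(1) q(1)] by (intro bexI[of _ "poly_add p q"]) simp_all
qed

lemma poly_fun_degree_mult:
  assumes "poly_fun_degree g n" "poly_fun_degree h m"
  shows "poly_fun_degree (\<lambda>z. g z \<otimes> h z) (n + m)"
proof -
  obtain p q where p: "p \<in> carrier (poly_ring R)" "length p = Suc n" "\<forall>z\<in>carrier R. g z = eval p z"
    and q: "q \<in> carrier (poly_ring R)" "length q = Suc m" "\<forall>z\<in>carrier R. h z = eval q z"
    using assms unfolding poly_fun_degree_def by blast
  have pq: "polynomial (carrier R) p" "polynomial (carrier R) q"
    using p(1) q(1) by (simp_all add: univ_poly_carrier)
  have ne: "p \<noteq> []" "q \<noteq> []" using p(2) q(2) by auto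
  have "poly_mult p q \<in> carrier (poly_ring R)"
    using poly_mult_closed[OF carrier_is_subring pq] by (simp add: univ_poly_carrier)
  moreover have "length (poly_mult p q) = Suc (n + m)"
  proof -
    have "poly_mult p q \<noteq> []" using poly_mult_integral[OF carrier_is_subring pq] ne by blast
    then show ?thesis
      using poly_mult_degree_eq[OF carrier_is_subring pq] ne p(2) q(2)
      by (cases "poly_mult p q") (simp_all del: poly_mult.simps)
  qed
  ultimately show ?thesis unfolding poly_fun_degree_def
    using p(3) q(3) eval_poly_mult[OF poly_ring_list_closed[OF p(1)] poly_ring_list_closed[OF q(1)]]
    by (intro bexI[of _ "poly_mult p q"]) (simp_all del: poly_mult.simps)
qed

lemma poly_fun_const:
  assumes "k \<in> carrier R"
  shows "poly_fun (\<lambda>_. k)"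
proof -
  have "poly_fun_below (\<lambda>z. k \<otimes> z [^] (0::nat)) 1" by (rule poly_fun_below_monom[OF assms]) simp
  then show ?thesis using assms by (simp add: poly_fun_below_imp)
qed

lemma poly_fun_id: "poly_fun (\<lambda>z. z)"
proof -
  have "poly_fun (\<lambda>z. \<one> \<otimes> z [^] (1::nat))"
    by (rule poly_fun_degree_imp[OF poly_fun_degree_monom]) auto
  then show ?thesis by (rule poly_fun_cong) simp
qed

lemma poly_fun_add:
  assumes "poly_fun g" "poly_fun h"
  shows "poly_fun (\<lambda>z. g z \<oplus> h z)"
proof -
  obtain n m where "poly_fun_below g n" "poly_fun_below h m"
    using assms unfolding poly_fun_def by blast
  then have "poly_fun_below g (max n m)" "poly_fun_below h (max n m)"
    by (auto intro: poly_fun_below_mono)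
  then show ?thesis using poly_fun_below_add poly_fun_below_imp by blast
qed

lemma poly_fun_cases:
  assumes "poly_fun h"
  obtains "\<And>z. z \<in> carrier R \<Longrightarrow> h z = \<zero>" | n where "poly_fun_degree h n"
proof -
  obtain p where p: "p \<in> carrier (poly_ring R)" "\<forall>z\<in>carrier R. h z = eval p z"
    using assms unfolding poly_fun_def poly_fun_below_def by blast
  show ?thesis
  proof (cases p)
    case Nil
    then show ?thesis using p(2) that(1) by simp
  next
    case (Cons a q)
    then have "poly_fun_degree h (length q)"
      unfolding poly_fun_degree_def using p by (intro bexI[of _ p]) auto
    then show ?thesis using that(2) by blast
  qed
qed

lemma poly_fun_degree_finite_zeros:
  assumes "poly_fun_degree h n"
  shows "finite {z \<in> carrier R. h z = \<zero>}"
proof -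
  obtain p where p: "p \<in> carrier (poly_ring R)" "length p = Suc n" "\<forall>z\<in>carrier R. h z = eval p z"
    using assms unfolding poly_fun_degree_def by blast
  have "{z \<in> carrier R. h z = \<zero>} \<subseteq> {z. is_root p z}" using p(2,3) by (auto simp: is_root_def)
  then show ?thesis using finite_number_of_roots[OF p(1)] finite_subset by blast
qed

lemma poly_fun_mult:
  assumes g: "poly_fun g" and h: "poly_fun h"
    and cl: "g \<in> carrier R \<rightarrow> carrier R" "h \<in> carrier R \<rightarrow> carrier R"
  shows "poly_fun (\<lambda>z. g z \<otimes> h z)"
proof -
  from g show ?thesis
  proof (cases rule: poly_fun_cases)
    case 1
    then show ?thesis
      using cl by (intro poly_fun_below_imp[OF poly_fun_below_zero]) (simp add: Pi_iff)
  next
    case (2 n)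
    note gn = this
    from h show ?thesis
    proof (cases rule: poly_fun_cases)
      case 1
      then show ?thesis
        using cl by (intro poly_fun_below_imp[OF poly_fun_below_zero]) (simp add: Pi_iff)
    next
      case (2 m)
      then show ?thesis by (rule poly_fun_degree_imp[OF poly_fun_degree_mult[OF gn]])
    qed
  qed
qed

lemma poly_fun_mpoly_eval:
  assumes x: "\<And>i. i \<in> I \<Longrightarrow> poly_fun (x i)" "\<And>i. i \<in> I \<Longrightarrow> x i \<in> carrier R \<rightarrow> carrier R"
    and f: "f \<in> mpolys I"
  shows "poly_fun (\<lambda>z. peval f (\<lambda>i. x i z))"
  using f
proof (induction rule: indexed_pset.induct)
  case (indexed_const k)
  then show ?case using mpoly_eval_const[OF indexed_const] poly_fun_const by simp
next
  case (indexed_padd P Q)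
  have eq: "peval (indexed_padd P Q) (\<lambda>i. x i z)
      = peval P (\<lambda>i. x i z) \<oplus> peval Q (\<lambda>i. x i z)" if "z \<in> carrier R" for z
    by (rule mpoly_eval_padd[of _ I]) (use x(2) that indexed_padd in auto)
  show ?case by (rule poly_fun_cong[OF poly_fun_add[OF indexed_padd.IH] eq])
next
  case (indexed_pmult P i)
  have eq: "peval (indexed_pmult P i) (\<lambda>i. x i z) = x i z \<otimes> peval P (\<lambda>i. x i z)"
    if "z \<in> carrier R" for z
    by (rule mpoly_eval_pmult[of _ I]) (use x(2) that indexed_pmult in auto)
  have "poly_fun (\<lambda>z. x i z \<otimes> peval P (\<lambda>i. x i z))"
  proof (rule poly_fun_mult[OF x(1) indexed_pmult.IH x(2)])
    show "(\<lambda>z. peval P (\<lambda>i. x i z)) \<in> carrier R \<rightarrow> carrier R"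
      by (rule Pi_I, rule mpoly_eval_closed[of _ I]) (use x(2) indexed_pmult.hyps(1) in auto)
  qed (rule indexed_pmult.hyps(2))+
  then show ?case by (rule poly_fun_cong) (rule eq)
qed

lemma poly_fun_common_nonzero:
  assumes inf: "infinite (carrier R)"
    and g: "poly_fun g" "a \<in> carrier R" "g a \<noteq> \<zero>" and h: "poly_fun h" "b \<in> carrier R" "h b \<noteq> \<zero>"
  obtains z where "z \<in> carrier R" "g z \<noteq> \<zero>" "h z \<noteq> \<zero>"
proof -
  obtain n m where "poly_fun_degree g n" "poly_fun_degree h m"
    using poly_fun_cases[OF g(1)] poly_fun_cases[OF h(1)] g h by metis
  then have "finite ({z \<in> carrier R. g z = \<zero>} \<union> {z \<in> carrier R. h z = \<zero>})"
    using poly_fun_degree_finite_zeros by blast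
  then have "\<not> carrier R \<subseteq> {z \<in> carrier R. g z = \<zero>} \<union> {z \<in> carrier R. h z = \<zero>}"
    using inf finite_subset[of "carrier R"] by metis
  then show ?thesis using that by auto
qed

text \<open>In a nontrivial combination the term of maximal degree with nonzero coefficient survives.\<close>

lemma poly_fun_degrees_independent:
  assumes inf: "infinite (carrier R)" and M: "finite M" and inj: "inj_on \<delta> M"
    and e: "\<And>m. m \<in> M \<Longrightarrow> poly_fun_degree (e m) (\<delta> m)"
      "\<And>m z. m \<in> M \<Longrightarrow> z \<in> carrier R \<Longrightarrow> e m z \<in> carrier R"
    and k: "k \<in> M \<rightarrow> carrier R"
    and zero: "\<And>z. z \<in> carrier R \<Longrightarrow> (\<Oplus>m\<in>M. k m \<otimes> e m z) = \<zero>"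
  shows "\<forall>m\<in>M. k m = \<zero>"
proof (rule ccontr)
  let ?S = "\<lambda>A z. \<Oplus>m\<in>A. k m \<otimes> e m z"
  assume nz: "\<not> ?thesis"
  have sdeg: "poly_fun_degree (\<lambda>z. k m \<otimes> e m z) (\<delta> m)" if "m \<in> M" "k m \<noteq> \<zero>" for m
  proof -
    have "poly_fun_degree (\<lambda>z. k m \<otimes> z [^] (0::nat)) 0"
      using that k by (intro poly_fun_degree_monom) auto
    from poly_fun_degree_mult[OF this e(1)[OF that(1)]]
    have "poly_fun_degree (\<lambda>z. k m \<otimes> z [^] (0::nat) \<otimes> e m z) (\<delta> m)" by simp
    then show ?thesis
      by (rule poly_fun_degree_cong) (use that k in \<open>simp add: Pi_iff\<close>)
  qed
  have cl: "k m \<otimes> e m z \<in> carrier R" if "m \<in> M" "z \<in> carrier R" for m z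
    using that k e(2) by auto
  have main: "\<exists>n. poly_fun_degree (?S A) n \<and> (\<exists>m\<in>A. k m \<noteq> \<zero> \<and> n = \<delta> m)"
    if "finite A" "A \<subseteq> M" "\<exists>m\<in>A. k m \<noteq> \<zero>" for A
    using that
  proof (induction A rule: finite_ranking_induct[where f = \<delta>])
    case empty
    then show ?case by simp
  next
    case (insert m A)
    have ?case if "m \<in> A" using insert that by (simp add: insert_absorb)
    moreover have ?case if nin: "m \<notin> A"
    proof -
      have ins: "?S (insert m A) z = k m \<otimes> e m z \<oplus> ?S A z"
        if "z \<in> carrier R" for z
        by (rule finsum_insert) (use insert nin that cl in auto)
      show ?case
      proof (cases "k m = \<zero>")
        case True
        have eq: "?S (insert m A) z = ?S A z" if "z \<in> carrier R" for z
        proof -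
          have "?S A z \<in> carrier R"
            using insert cl that by (intro finsum_closed) auto
          then show ?thesis using ins[OF that] True e(2)[OF _ that, of m] insert by simp
        qed
        obtain n where "poly_fun_degree (?S A) n" "\<exists>m\<in>A. k m \<noteq> \<zero> \<and> n = \<delta> m"
          using insert True by auto
        moreover from this have "poly_fun_degree (?S (insert m A)) n"
          by (intro poly_fun_degree_cong[OF _ eq])
        ultimately show ?thesis by blast
      next
        case False
        have mM: "m \<in> M" using insert by simp
        have below: "poly_fun_below (?S A) (\<delta> m)"
        proof (cases "\<exists>m\<in>A. k m \<noteq> \<zero>")
          case True
          then obtain n a where n: "poly_fun_degree (?S A) n" "a \<in> A" "n = \<delta> a"
            using insert by auto
          have "\<delta> a \<le> \<delta> m" using insert n by blast
          moreover have "\<delta> a \<noteq> \<delta> m" using inj insert nin n(2) by (auto dest: inj_onD)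
          ultimately show ?thesis using poly_fun_below_mono[OF poly_fun_degree_imp_below[OF n(1)]] n by simp
        next
          case False
          then have "?S A z = \<zero>" if "z \<in> carrier R" for z
            using insert that e(2) by (intro add.finprod_one_eqI) auto
          then show ?thesis by (rule poly_fun_below_zero)
        qed
        have "poly_fun_degree (\<lambda>z. k m \<otimes> e m z \<oplus> ?S A z) (\<delta> m)"
          by (rule poly_fun_degree_add_below[OF sdeg[OF mM False] below])
        then have "poly_fun_degree (?S (insert m A)) (\<delta> m)"
          by (rule poly_fun_degree_cong[OF _ ins])
        then show ?thesis using False by blast
      qed
    qed
    ultimately show ?case by blast
  qed
  obtain n where "poly_fun_degree (?S M) n" using main[OF M] nz by blast
  then have "finite {z \<in> carrier R. ?S M z = \<zero>}" by (rule poly_fun_degree_finite_zeros)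
  also have "{z \<in> carrier R. ?S M z = \<zero>} = carrier R" using zero by auto
  finally show False using inf by simp
qed

end

lemma (in algebraically_closed) infinite_carrier: "infinite (carrier L)"
proof
  let ?P = "\<lambda>A z. \<Otimes>a\<in>A. z \<oplus> a"
  assume fin: "finite (carrier L)"
  have "poly_fun_degree (?P A) (card A)" if "finite A" "A \<subseteq> carrier L" for A
    using that
  proof (induction A)
    case empty
    have "poly_fun_degree (\<lambda>z. \<one> \<otimes> z [^] (0::nat)) 0" by (rule poly_fun_degree_monom) auto
    then show ?case by simp
  next
    case (insert a A)
    have a: "a \<in> carrier L" using insert by simp
    have "poly_fun_degree (\<lambda>z. \<one> \<otimes> z [^] (1::nat)) 1" by (rule poly_fun_degree_monom) auto
    then have "poly_fun_degree (\<lambda>z. \<one> \<otimes> z [^] (1::nat) \<oplus> a \<otimes> z [^] (0::nat)) 1"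
      by (rule poly_fun_degree_add_below) (rule poly_fun_below_monom[OF a], simp)
    then have "poly_fun_degree (\<lambda>z. z \<oplus> a) 1"
      by (rule poly_fun_degree_cong) (use a in simp)
    then have "poly_fun_degree (\<lambda>z. (z \<oplus> a) \<otimes> ?P A z) (1 + card A)"
      by (rule poly_fun_degree_mult) (use insert in auto)
    then have "poly_fun_degree (\<lambda>z. (z \<oplus> a) \<otimes> ?P A z) (card (insert a A))"
      using insert by simp
    moreover have "?P (insert a A) z = (z \<oplus> a) \<otimes> ?P A z" if "z \<in> carrier L" for z
      by (rule finprod_insert) (use insert that in auto)
    ultimately show ?case by (rule poly_fun_degree_cong)
  qed
  from this[OF fin subset_refl]
  have deg: "poly_fun_degree (?P (carrier L)) (card (carrier L))" .
  have pos: "0 < card (carrier L)" using fin by (auto simp: card_gt_0_iff)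
  have zero: "?P (carrier L) z = \<zero>" if z: "z \<in> carrier L" for z
  proof -
    have mz: "\<ominus> z \<in> carrier L" using z by simp
    then have "?P (carrier L) z = ?P (insert (\<ominus> z) (carrier L - {\<ominus> z})) z"
      by (simp add: insert_absorb)
    also have "\<dots> = (z \<oplus> \<ominus> z) \<otimes> ?P (carrier L - {\<ominus> z}) z"
      by (rule finprod_insert) (use fin z in auto)
    also have "\<dots> = \<zero>" using z by (simp add: r_neg Pi_iff)
    finally show ?thesis .
  qed
  have "poly_fun_degree (\<lambda>z. ?P (carrier L) z \<oplus> \<one> \<otimes> z [^] (0::nat)) (card (carrier L))"
    by (rule poly_fun_degree_add_below[OF deg poly_fun_below_monom]) (use pos in auto)
  then obtain p where p: "p \<in> carrier (poly_ring L)" "length p = Suc (card (carrier L))"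
    "\<forall>z\<in>carrier L. ?P (carrier L) z \<oplus> \<one> \<otimes> z [^] (0::nat) = eval p z"
    unfolding poly_fun_degree_def by blast
  have one: "eval p z = \<one>" if "z \<in> carrier L" for z using p(3) zero that by force
  have "size (roots p) = card (carrier L)"
    using roots_over_carrier[OF p(1)] p(2) by (simp add: splitted_def)
  then obtain z where "z \<in># roots p" using pos by (metis multiset_nonemptyE size_empty less_irrefl)
  then have "is_root p z" using roots_mem_iff_is_root[OF p(1)] by simp
  then show False using one by (auto simp: is_root_def)
qed

subsection \<open>Graphs of polynomial functions are varieties\<close>

context cring
begin

lemma monom_val_cong:
  assumes "x \<in> I \<rightarrow> carrier R" "\<And>i. i \<in> I \<Longrightarrow> x i = y i" "set_mset m \<subseteq> I"
  shows "monom_val x m = monom_val y m"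
  unfolding monom_val_def by (rule finprod_cong'[symmetric]) (use assms in auto)

lemma mpoly_eval_cong:
  assumes x: "x \<in> I \<rightarrow> carrier R" and xy: "\<And>i. i \<in> I \<Longrightarrow> x i = y i" and f: "f \<in> mpolys I"
  shows "peval f x = peval f y"
proof -
  have cl: "f m \<otimes> monom_val y m \<in> carrier R" if "f m \<noteq> \<zero>" for m
    using monom_val_closed[OF x mpolys_support[OF f that]] mpolys_coeff[OF f]
      monom_val_cong[OF x xy mpolys_support[OF f that]] by simp
  show ?thesis
    unfolding mpoly_eval_def monom_val_def[symmetric]
    by (rule finsum_cong')
      (use cl monom_val_cong[OF x xy mpolys_support[OF f]] in auto)
qed

lemma mpolys_mono:
  assumes "f \<in> mpolys I" "I \<subseteq> J"
  shows "f \<in> mpolys J"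
  using assms(1)
proof (induction rule: indexed_pset.induct)
  case (indexed_pmult P i)
  then show ?case using assms(2) indexed_pset.indexed_pmult[OF indexed_pmult.IH] by blast
qed (rule indexed_pset.intros, assumption+)+

definition graph_variety :: "nat \<Rightarrow> nat \<Rightarrow> (nat multiset \<Rightarrow> 'a) \<Rightarrow> (nat \<Rightarrow> 'a) set" where
  "graph_variety d D F =
     {x \<in> affine_space (carrier R) D. x d = peval F x \<and> (\<forall>j\<in>{d<..<D}. x j = \<zero>)}"

lemma algebraic_set_graph_variety:
  assumes F: "F \<in> mpolys {..<d}" and d: "d < D"
  shows "algebraic_set R D (graph_variety d D F)"
proof -
  let ?X = "\<lambda>j. mpoly_monom \<one> {#j#} :: nat multiset \<Rightarrow> 'a"
  let ?G = "indexed_padd (?X d) (\<lambda>m. \<ominus> \<one> \<otimes> F m)"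
  have FD: "F \<in> mpolys {..<D}" using mpolys_mono[OF F] d by auto
  have X: "?X j \<in> mpolys {..<D}" if "j < D" for j using that by (intro mpoly_monom_closed) auto
  have nF: "(\<lambda>m. \<ominus> \<one> \<otimes> F m) \<in> mpolys {..<D}" by (rule smult_mpolys[OF _ FD]) simp
  have evX: "peval (?X j) x = x j" if "j < D" "x \<in> {..<D} \<rightarrow> carrier R" for x j
  proof -
    have xj: "x j \<in> carrier R" using that by auto
    have "peval (?X j) x = \<one> \<otimes> monom_val x (add_mset j {#})"
      by (rule mpoly_eval_monom[OF that(2)]) (use that in auto)
    also have "\<dots> = x j" using monom_val_add_mset[OF that(2), of "{#}" j] that xj by simp
    finally show ?thesis .
  qed
  have evG: "peval ?G x = \<zero> \<longleftrightarrow> x d = peval F x" if x: "x \<in> {..<D} \<rightarrow> carrier R" for x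
  proof -
    have c: "x d \<in> carrier R" "peval F x \<in> carrier R"
      using x d mpoly_eval_closed[OF x FD] by auto
    have "peval ?G x = x d \<oplus> \<ominus> \<one> \<otimes> peval F x"
      using mpoly_eval_padd[OF x X[OF d] nF] mpoly_eval_smult[OF x _ FD, of "\<ominus> \<one>"] evX[OF d x] by simp
    also have "\<dots> = x d \<ominus> peval F x" using c by (simp add: l_minus a_minus_def)
    finally show ?thesis using c by simp
  qed
  have "graph_variety d D F = {x \<in> affine_space (carrier R) D.
      \<forall>f\<in>insert ?G (?X ` {d<..<D}). peval f x = \<zero>}"
  proof -
    have "x d = peval F x \<and> (\<forall>j\<in>{d<..<D}. x j = \<zero>)
        \<longleftrightarrow> (\<forall>f\<in>insert ?G (?X ` {d<..<D}). peval f x = \<zero>)"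
      if "x \<in> affine_space (carrier R) D" for x
    proof -
      have x: "x \<in> {..<D} \<rightarrow> carrier R" using that by (auto simp: PiE_def)
      have "(\<forall>f\<in>?X ` {d<..<D}. peval f x = \<zero>) \<longleftrightarrow> (\<forall>j\<in>{d<..<D}. x j = \<zero>)"
        using evX[OF _ x] by auto
      then show ?thesis using evG[OF x] by simp
    qed
    then show ?thesis unfolding graph_variety_def by blast
  qed
  moreover have "insert ?G (?X ` {d<..<D}) \<subseteq> carrier (mpoly_ring R D)"
    unfolding mpoly_ring_simps using X indexed_pset.indexed_padd[OF X[OF d] nF] by auto
  ultimately show ?thesis
    unfolding algebraic_set_def by (intro exI[of _ "insert ?G (?X ` {d<..<D})"]) simp
qed

definition graph_point :: "nat \<Rightarrow> nat \<Rightarrow> (nat multiset \<Rightarrow> 'a) \<Rightarrow> (nat \<Rightarrow> 'a) \<Rightarrow> nat \<Rightarrow> 'a" where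
  "graph_point d D F u =
     (\<lambda>i\<in>{..<D}. if i < d then u i else if i = d then peval F u else \<zero>)"

lemma graph_point_in:
  assumes F: "F \<in> mpolys {..<d}" and d: "d < D" and u: "u \<in> {..<d} \<rightarrow> carrier R"
  shows "graph_point d D F u \<in> graph_variety d D F"
proof -
  have "peval F u = peval F (graph_point d D F u)"
    by (rule mpoly_eval_cong[OF u _ F]) (use d in \<open>auto simp: graph_point_def\<close>)
  then show ?thesis
    using d u mpoly_eval_closed[OF u F] unfolding graph_variety_def
    by (auto simp: graph_point_def)
qed

lemma graph_variety_eq_graph_point:
  assumes "F \<in> mpolys {..<d}" "d < D" "x \<in> graph_variety d D F"
  shows "x = graph_point d D F x"
proof
  fix i
  have x: "x \<in> affine_space (carrier R) D" using assms(3) by (simp add: graph_variety_def)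
  show "x i = graph_point d D F x i"
  proof (cases "i < D")
    case True
    then show ?thesis using assms(3) by (auto simp: graph_point_def graph_variety_def)
  next
    case False
    then show ?thesis using PiE_arb[OF x, of i] by (simp add: graph_point_def)
  qed
qed

end

text \<open>If \<open>V\<close> is the union of two proper algebraic subsets, each omits a point of \<open>V\<close>. The product of
  two polynomials witnessing this vanishes on the polynomial curve in \<open>V\<close> through these points,
  although neither factor does.\<close>

lemma (in domain) variety_graph_variety:
  assumes inf: "infinite (carrier R)" and F: "F \<in> mpolys {..<d}" and d: "d < D"
  shows "variety R D (graph_variety d D F)"
  unfolding variety_def
proof (intro conjI allI impI)
  let ?V = "graph_variety d D F"
  show "algebraic_set R D ?V" by (rule algebraic_set_graph_variety[OF F d])
  show "?V \<noteq> {}" using graph_point_in[OF F d, of "\<lambda>_. \<zero>"] by auto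
  fix V1 V2 assume V1: "algebraic_set R D V1" and V2: "algebraic_set R D V2" and un: "?V = V1 \<union> V2"
  show "?V = V1 \<or> ?V = V2"
  proof (rule ccontr)
    assume "\<not> ?thesis"
    then obtain v w where v: "v \<in> ?V" "v \<notin> V1" and w: "w \<in> ?V" "w \<notin> V2" using un by blast
    have VD: "?V \<subseteq> affine_space (carrier R) D" by (auto simp: graph_variety_def)
    obtain A1 A2 where A: "A1 \<subseteq> mpolys {..<D}" "A2 \<subseteq> mpolys {..<D}"
      and V1_eq: "V1 = {x \<in> affine_space (carrier R) D. \<forall>f\<in>A1. peval f x = \<zero>}"
      and V2_eq: "V2 = {x \<in> affine_space (carrier R) D. \<forall>f\<in>A2. peval f x = \<zero>}"
      using V1 V2 unfolding algebraic_set_def mpoly_ring_simps by blast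
    obtain f g where f: "f \<in> A1" "peval f v \<noteq> \<zero>" and g: "g \<in> A2" "peval g w \<noteq> \<zero>"
      using v w VD V1_eq V2_eq by blast
    have cl: "v i \<in> carrier R" "w i \<in> carrier R" if "i < D" for i
      using that v(1) w(1) VD by (auto simp: PiE_def)
    define u where "u i z = v i \<oplus> z \<otimes> (w i \<ominus> v i)" for i z
    define \<gamma> where "\<gamma> i z = (if i < d then u i z else if i = d then peval F (\<lambda>i. u i z) else \<zero>)"
      for i z
    have u_cl: "u i z \<in> carrier R" if "i < D" "z \<in> carrier R" for i z
      using cl[OF that(1)] that(2) by (simp add: u_def)
    have u_poly: "poly_fun (u i)" if "i < D" for i
      unfolding u_def using cl[OF that]
      by (intro poly_fun_add poly_fun_const poly_fun_mult poly_fun_id) auto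
    have \<gamma>_cl: "\<gamma> i z \<in> carrier R" if i: "i < D" and z: "z \<in> carrier R" for i z
    proof -
      have "peval F (\<lambda>i. u i z) \<in> carrier R"
        by (rule mpoly_eval_closed[OF _ F]) (use u_cl z d in auto)
      then show ?thesis using u_cl[OF i z] by (simp add: \<gamma>_def)
    qed
    have \<gamma>_poly: "poly_fun (\<gamma> i)" if "i < D" for i
    proof -
      have "poly_fun (\<lambda>z. peval F (\<lambda>i. u i z))"
        by (rule poly_fun_mpoly_eval[OF _ _ F]) (use u_poly u_cl d in auto)
      then have "poly_fun (\<lambda>z. if i < d then u i z else if i = d then peval F (\<lambda>i. u i z) else \<zero>)"
        using u_poly[OF that] poly_fun_const[of \<zero>] by (cases "i < d"; cases "i = d") simp_all
      then show ?thesis by (simp add: \<gamma>_def[abs_def])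
    qed
    have \<gamma>_in: "(\<lambda>i\<in>{..<D}. \<gamma> i z) \<in> ?V" if z: "z \<in> carrier R" for z
    proof -
      have "(\<lambda>i\<in>{..<D}. \<gamma> i z) = graph_point d D F (\<lambda>i. u i z)"
        by (auto simp: graph_point_def \<gamma>_def)
      also have "\<dots> \<in> ?V" by (rule graph_point_in[OF F d]) (use u_cl z d in auto)
      finally show ?thesis .
    qed
    have ends: "x i = \<gamma> i z" if x: "x \<in> ?V" and xu: "\<And>i. i < D \<Longrightarrow> u i z = x i" and i: "i < D" for x z i
    proof -
      have "x \<in> {..<d} \<rightarrow> carrier R" using x VD d by (force simp: PiE_def)
      then have "peval F x = peval F (\<lambda>i. u i z)"
        by (rule mpoly_eval_cong[OF _ _ F]) (use xu d in auto)
      moreover have "x i = graph_point d D F x i"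
        using graph_variety_eq_graph_point[OF F d x] by simp
      ultimately show ?thesis using i xu by (auto simp: graph_point_def \<gamma>_def)
    qed
    have ends_eval: "peval h x = peval h (\<lambda>i. \<gamma> i z)"
      if x: "x \<in> ?V" and h: "h \<in> mpolys {..<D}" and xu: "\<And>i. i < D \<Longrightarrow> u i z = x i" for x z h
    proof (rule mpoly_eval_cong[OF _ _ h])
      show "x \<in> {..<D} \<rightarrow> carrier R" using x VD by (force simp: PiE_def)
    qed (use ends[OF x xu] in auto)
    have fm: "f \<in> mpolys {..<D}" "g \<in> mpolys {..<D}" using f g A by auto
    have poly: "poly_fun (\<lambda>z. peval h (\<lambda>i. \<gamma> i z))" if "h \<in> mpolys {..<D}" for h
      by (rule poly_fun_mpoly_eval[OF _ _ that]) (use \<gamma>_poly \<gamma>_cl in auto)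
    have "peval f (\<lambda>i. \<gamma> i \<zero>) \<noteq> \<zero>"
      using ends_eval[OF v(1) fm(1), of \<zero>] f(2) cl by (simp add: u_def)
    moreover have "peval g (\<lambda>i. \<gamma> i \<one>) \<noteq> \<zero>"
    proof -
      have "u i \<one> = w i" if "i < D" for i
        unfolding u_def using cl[OF that] a_lcomm[of "v i" "w i" "\<ominus> v i"]
        by (simp add: a_minus_def r_neg)
      then show ?thesis using ends_eval[OF w(1) fm(2), of \<one>] g(2) by simp
    qed
    ultimately obtain z where z: "z \<in> carrier R" "peval f (\<lambda>i. \<gamma> i z) \<noteq> \<zero>"
      "peval g (\<lambda>i. \<gamma> i z) \<noteq> \<zero>"
      using poly_fun_common_nonzero[OF inf poly[OF fm(1)] zero_closed _ poly[OF fm(2)] one_closed]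
      by blast
    let ?y = "\<lambda>i\<in>{..<D}. \<gamma> i z"
    have "peval h (\<lambda>i. \<gamma> i z) = peval h ?y" if "h \<in> mpolys {..<D}" for h
      by (rule mpoly_eval_cong[OF _ _ that]) (use \<gamma>_cl z(1) in auto)
    then have "?y \<notin> V1" "?y \<notin> V2" using z fm f(1) g(1) V1_eq V2_eq by auto
    then show False using \<gamma>_in[OF z(1)] un by blast
  qed
qed

subsection \<open>Base expansions\<close>

lemma digit_sum_less:
  fixes f :: "nat \<Rightarrow> nat"
  assumes "\<And>i. i < n \<Longrightarrow> f i < b"
  shows "(\<Sum>i<n. f i * b ^ i) < b ^ n"
  using assms
proof (induction n)
  case (Suc n)
  have "(\<Sum>i<Suc n. f i * b ^ i) < b ^ n + f n * b ^ n" using Suc by simp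
  also have "\<dots> = (1 + f n) * b ^ n" by (simp add: algebra_simps)
  also have "\<dots> \<le> b * b ^ n" using Suc.prems[of n] by (intro mult_right_mono) auto
  finally show ?case by simp
qed simp

lemma mult_add_eq_iff:
  fixes q r q' r' b :: nat
  assumes "r < b" "r' < b"
  shows "b * q + r = b * q' + r' \<longleftrightarrow> q = q' \<and> r = r'"
proof
  assume eq: "b * q + r = b * q' + r'"
  have "(b * q + r) div b = q" "(b * q' + r') div b = q'" using assms by auto
  then have "q = q'" using eq by simp
  then show "q = q' \<and> r = r'" using eq by simp
qed simp

lemma digit_sum_inj:
  fixes f g :: "nat \<Rightarrow> nat"
  assumes "\<And>i. i < n \<Longrightarrow> f i < b" "\<And>i. i < n \<Longrightarrow> g i < b"
    and "(\<Sum>i<n. f i * b ^ i) = (\<Sum>i<n. g i * b ^ i)" and "j < n"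
  shows "f j = g j"
  using assms
proof (induction n)
  case (Suc n)
  have "f n = g n \<and> (\<Sum>i<n. f i * b ^ i) = (\<Sum>i<n. g i * b ^ i)"
    using mult_add_eq_iff[OF digit_sum_less[of n f b] digit_sum_less[of n g b], of "f n" "g n"]
      Suc.prems(1-3) by (simp add: mult.commute add.commute)
  then show ?case using Suc by (cases "j = n") auto
qed simp

subsection \<open>The Hilbert function of the projective closure of a graph\<close>

context cring
begin

definition add_top_power :: "nat \<Rightarrow> (nat multiset \<Rightarrow> 'a) \<Rightarrow> nat multiset \<Rightarrow> 'a" where
  "add_top_power s g = indexed_padd (mpoly_monom \<one> (replicate_mset s 0)) g"

lemma monom_val_replicate:
  assumes "x i \<in> carrier R"
  shows "monom_val x (replicate_mset n i) = x i [^] n"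
proof (induction n)
  case (Suc n)
  have "monom_val x (replicate_mset (Suc n) i) = x i \<otimes> monom_val x (replicate_mset n i)"
    unfolding replicate_mset_Suc by (rule monom_val_add_mset[of _ "{i}"]) (use assms in auto)
  also have "\<dots> = x i [^] Suc n" using Suc assms by (simp add: m_comm)
  finally show ?case .
qed simp

lemma add_top_power_closed:
  assumes "0 < d" "g \<in> mpolys {..<d}"
  shows "add_top_power s g \<in> mpolys {..<d}"
  unfolding add_top_power_def
  by (intro indexed_pset.indexed_padd mpoly_monom_closed assms(2)) (use assms(1) in auto)

lemma mpoly_eval_add_top_power:
  assumes d: "0 < d" and u: "u \<in> {..<d} \<rightarrow> carrier R" and g: "g \<in> mpolys {..<d}"
  shows "peval (add_top_power s g) u = u 0 [^] s \<oplus> peval g u"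
proof -
  have u0: "u 0 \<in> carrier R" using u d by auto
  have m: "set_mset (replicate_mset s 0) \<subseteq> {..<d}" using d by auto
  show ?thesis unfolding add_top_power_def
    using mpoly_eval_padd[OF u mpoly_monom_closed[OF one_closed m] g]
      mpoly_eval_monom[OF u one_closed m] monom_val_replicate[of u 0 s] u0 by simp
qed

end

context domain
begin

lemma poly_fun_degree_monom_val:
  assumes x: "\<And>i. i \<in> I \<Longrightarrow> poly_fun_degree (x i) (e i)"
      "\<And>i z. i \<in> I \<Longrightarrow> z \<in> carrier R \<Longrightarrow> x i z \<in> carrier R"
    and m: "set_mset m \<subseteq> I"
  shows "poly_fun_degree (\<lambda>z. monom_val (\<lambda>i. x i z) m) (\<Sum>i\<in>#m. e i)"
  using m
proof (induction m)
  case empty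
  have "poly_fun_degree (\<lambda>z. \<one> \<otimes> z [^] (0::nat)) 0" by (rule poly_fun_degree_monom) auto
  then show ?case by simp
next
  case (add i m)
  have "poly_fun_degree (\<lambda>z. x i z \<otimes> monom_val (\<lambda>i. x i z) m) (e i + (\<Sum>i\<in>#m. e i))"
    using add by (intro poly_fun_degree_mult x(1)) auto
  moreover have "monom_val (\<lambda>i. x i z) (add_mset i m) = x i z \<otimes> monom_val (\<lambda>i. x i z) m"
    if "z \<in> carrier R" for z
    by (rule monom_val_add_mset[of _ I]) (use add x(2) that in auto)
  ultimately show ?case using poly_fun_degree_cong by simp
qed

lemma poly_fun_below_mpoly_eval:
  assumes x: "\<And>i. i \<in> I \<Longrightarrow> poly_fun_degree (x i) (e i)"
      "\<And>i z. i \<in> I \<Longrightarrow> z \<in> carrier R \<Longrightarrow> x i z \<in> carrier R"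
    and f: "f \<in> mpolys I" and n: "\<And>m. f m \<noteq> \<zero> \<Longrightarrow> (\<Sum>i\<in>#m. e i) < n"
  shows "poly_fun_below (\<lambda>z. peval f (\<lambda>i. x i z)) n"
  using f
proof (induction rule: mpolys_monom_induct)
  case zero
  show ?case by (rule poly_fun_below_zero) (simp add: mpoly_eval_const)
next
  case (add g m)
  have m: "set_mset m \<subseteq> I" and k: "f m \<in> carrier R"
    using mpolys_support[OF f add(2)] mpolys_coeff[OF f] by auto
  have "poly_fun_degree (\<lambda>z. f m \<otimes> z [^] (0::nat) \<otimes> monom_val (\<lambda>i. x i z) m) (0 + (\<Sum>i\<in>#m. e i))"
    by (rule poly_fun_degree_mult[OF poly_fun_degree_monom[OF k add(2)]
        poly_fun_degree_monom_val[OF x m]])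
  from poly_fun_below_mono[OF poly_fun_degree_imp_below[OF this], of n]
  have "poly_fun_below (\<lambda>z. f m \<otimes> z [^] (0::nat) \<otimes> monom_val (\<lambda>i. x i z) m) n"
    using n[OF add(2)] by simp
  from poly_fun_below_add[OF this add(3)] show ?case
  proof (rule poly_fun_below_cong)
    fix z assume z: "z \<in> carrier R"
    then have xz: "(\<lambda>i. x i z) \<in> I \<rightarrow> carrier R" using x(2) by auto
    show "peval (indexed_padd (mpoly_monom (f m) m) g) (\<lambda>i. x i z) =
        f m \<otimes> z [^] (0::nat) \<otimes> monom_val (\<lambda>i. x i z) m \<oplus> peval g (\<lambda>i. x i z)"
      using mpoly_eval_padd[OF xz mpoly_monom_closed[OF k m] add(1)] mpoly_eval_monom[OF xz k m] k
      by simp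
  qed
qed

end

locale graph_of_monic = field R for R (structure) +
  fixes d D s :: nat and g :: "nat multiset \<Rightarrow> 'a"
  assumes infinite_field: "infinite (carrier R)"
    and d_pos: "0 < d" and d_less: "d < D" and s_pos: "0 < s"
    and g_mpoly: "g \<in> indexed_pset {..<d} (carrier R)"
    and g_size: "\<And>m. g m \<noteq> \<zero> \<Longrightarrow> size m < s"
begin

abbreviation "F \<equiv> add_top_power s g"
abbreviation "V \<equiv> graph_variety d D F"
abbreviation "W \<equiv> proj_closure R D V"
abbreviation "S \<equiv> mpoly_ring R (Suc D)"
abbreviation "J \<equiv> proj_vanishing_ideal R D W"
abbreviation "H \<equiv> homogeneous_part R (Suc D)"
abbreviation "polys \<equiv> mpolys {..<Suc D}"
abbreviation "params \<equiv> {..<d} \<rightarrow> carrier R"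

definition hpoint :: "(nat \<Rightarrow> 'a) \<Rightarrow> nat \<Rightarrow> 'a" where
  "hpoint u = homogenize_point R D (graph_point d D F u)"

lemmas F_mpoly = add_top_power_closed[OF d_pos g_mpoly]
  and F_eval = mpoly_eval_add_top_power[OF d_pos _ g_mpoly]

lemma hpoint_simps:
  "hpoint u 0 = \<one>" "i < d \<Longrightarrow> hpoint u (Suc i) = u i" "hpoint u (Suc d) = peval F u"
  "Suc d < j \<Longrightarrow> j < Suc D \<Longrightarrow> hpoint u j = \<zero>"
  using d_less by (auto simp: hpoint_def homogenize_point_def graph_point_def split: nat.split)

lemma hpoint_closed:
  assumes "u \<in> params"
  shows "hpoint u \<in> affine_space (carrier R) (Suc D)"
  using assms mpoly_eval_closed[OF assms F_mpoly]
  by (auto simp: hpoint_def homogenize_point_def graph_point_def split: nat.split)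

lemma hpoint_closed': "u \<in> params \<Longrightarrow> hpoint u \<in> {..<Suc D} \<rightarrow> carrier R"
  using hpoint_closed by (auto simp: PiE_def)

lemma homogenize_V: "homogenize_point R D ` V = hpoint ` params"
proof -
  have "V = graph_point d D F ` params"
  proof (intro subset_antisym subsetI)
    fix x assume x: "x \<in> V"
    then have "x \<in> params" using d_less by (force simp: graph_variety_def PiE_def)
    then show "x \<in> graph_point d D F ` params"
      using graph_variety_eq_graph_point[OF F_mpoly d_less x] by blast
  next
    fix x assume "x \<in> graph_point d D F ` params"
    then show "x \<in> V" using graph_point_in[OF F_mpoly d_less] by blast
  qed
  then show ?thesis by (simp add: image_image hpoint_def)
qed

lemma W_subset: "W \<subseteq> affine_space (carrier R) (Suc D)"
proof -
  let ?P = "{x \<in> affine_space (carrier R) (Suc D). \<exists>i<Suc D. x i \<noteq> \<zero>}"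
  have "proj_algebraic_set R D ?P" unfolding proj_algebraic_set_def by (intro exI[of _ "{}"]) simp
  moreover have "homogenize_point R D ` V \<subseteq> ?P"
    unfolding homogenize_V using hpoint_closed hpoint_simps(1) by (force intro: exI[of _ 0])
  ultimately show ?thesis unfolding proj_closure_def by blast
qed

lemma hpoint_in_W: "u \<in> params \<Longrightarrow> hpoint u \<in> W"
  unfolding proj_closure_def using homogenize_V by blast

lemma W_closed: "x \<in> W \<Longrightarrow> x \<in> {..<Suc D} \<rightarrow> carrier R"
  using W_subset by (force simp: PiE_def)

lemma homogeneous_part_iff:
  "f \<in> H t \<longleftrightarrow> f \<in> polys \<and> (\<forall>m. f m \<noteq> \<zero> \<longrightarrow> size m = t)"
  by (simp add: homogeneous_part_def mpoly_ring_simps)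

lemma J_iff: "f \<in> J \<longleftrightarrow> f \<in> polys \<and> (\<forall>x\<in>W. peval f x = \<zero>)"
  by (simp add: proj_vanishing_ideal_def mpoly_ring_simps)

lemma homogeneous_in_J_iff:
  assumes f: "f \<in> H t"
  shows "f \<in> J \<longleftrightarrow> (\<forall>u\<in>params. peval f (hpoint u) = \<zero>)"
proof
  assume "f \<in> J"
  then show "\<forall>u\<in>params. peval f (hpoint u) = \<zero>"
    using hpoint_in_W unfolding J_iff by blast
next
  assume zero: "\<forall>u\<in>params. peval f (hpoint u) = \<zero>"
  let ?P = "{x \<in> affine_space (carrier R) (Suc D).
    (\<exists>i<Suc D. x i \<noteq> \<zero>) \<and> (\<forall>f\<in>{f}. peval f x = \<zero>)}"
  have "proj_algebraic_set R D ?P"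
    unfolding proj_algebraic_set_def using f by (intro exI[of _ "{f}"]) blast
  moreover have "homogenize_point R D ` V \<subseteq> ?P"
    unfolding homogenize_V using hpoint_closed hpoint_simps(1) zero by (force intro: exI[of _ 0])
  ultimately have "W \<subseteq> ?P" unfolding proj_closure_def by blast
  then show "f \<in> J" using f unfolding J_iff homogeneous_part_iff by blast
qed

lemma S_cring: "cring S"
  by (rule mpoly_ring_cring)

lemma J_ideal: "ideal J S"
proof -
  interpret S: cring S by (rule S_cring)
  have eval_minus: "peval (\<ominus>\<^bsub>S\<^esub> f) x = \<ominus> peval f x"
    if x: "x \<in> {..<Suc D} \<rightarrow> carrier R" and f: "f \<in> polys" for f x
  proof -
    have fS: "f \<in> carrier S" "\<ominus>\<^bsub>S\<^esub> f \<in> polys"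
      using f S.a_inv_closed[of f] by (simp_all add: mpoly_ring_simps)
    have "peval (\<ominus>\<^bsub>S\<^esub> f) x \<oplus> peval f x = peval (\<ominus>\<^bsub>S\<^esub> f \<oplus>\<^bsub>S\<^esub> f) x"
      unfolding mpoly_ring_simps using mpoly_eval_padd[OF x fS(2) f] by simp
    also have "\<dots> = \<zero>" using S.l_neg[OF fS(1)] by (simp add: mpoly_ring_simps mpoly_eval_const)
    finally show ?thesis
      using minus_equality[of "peval (\<ominus>\<^bsub>S\<^esub> f) x" "peval f x"]
        mpoly_eval_closed[OF x] f fS(2) by simp
  qed
  show ?thesis
  proof (rule idealI[OF S.ring_axioms])
    show "subgroup J (add_monoid S)"
    proof (rule S.add.subgroupI)
      show "J \<subseteq> carrier S" by (auto simp: J_iff mpoly_ring_simps)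
      show "J \<noteq> {}"
      proof -
        have "\<zero>\<^bsub>S\<^esub> \<in> J"
          using S.zero_closed by (simp add: J_iff mpoly_ring_simps mpoly_eval_const)
        then show ?thesis by blast
      qed
      show "\<ominus>\<^bsub>S\<^esub> f \<in> J" if "f \<in> J" for f
        using that eval_minus[OF W_closed] S.a_inv_closed[of f]
        by (simp add: J_iff mpoly_ring_simps)
      show "f \<oplus>\<^bsub>S\<^esub> h \<in> J" if "f \<in> J" "h \<in> J" for f h
        using that mpoly_eval_padd[OF W_closed] S.a_closed[of f h]
        by (simp add: J_iff mpoly_ring_simps)
    qed
    show "h \<otimes>\<^bsub>S\<^esub> f \<in> J" "f \<otimes>\<^bsub>S\<^esub> h \<in> J" if "f \<in> J" "h \<in> carrier S" for f h
    proof -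
      have m: "f \<in> polys" "h \<in> polys"
        using that by (simp_all add: J_iff mpoly_ring_simps)
      show "h \<otimes>\<^bsub>S\<^esub> f \<in> J" "f \<otimes>\<^bsub>S\<^esub> h \<in> J"
        using that(1) mpoly_mult_closed[OF m] mpoly_mult_closed[OF m(2,1)]
          mpoly_eval_mult[OF W_closed m] mpoly_eval_mult[OF W_closed m(2,1)]
          mpoly_eval_closed[OF W_closed m(2)]
        by (simp_all add: J_iff mpoly_ring_simps)
    qed
  qed
qed

end

lemma sum_mset_eq_sum_count:
  fixes e :: "'c \<Rightarrow> nat"
  assumes "finite A" "set_mset m \<subseteq> A"
  shows "(\<Sum>i\<in>#m. e i) = (\<Sum>j\<in>A. count m j * e j)"
  using assms(2)
proof (induction m)
  case (add i m)
  have "(\<Sum>j\<in>A. count (add_mset i m) j * e j) = (\<Sum>j\<in>A. (if j = i then e j else 0) + count m j * e j)"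
    by (intro sum.cong) auto
  also have "\<dots> = e i + (\<Sum>j\<in>A. count m j * e j)"
    unfolding sum.distrib using assms(1) add.prems by (simp add: sum.delta)
  finally show ?case using add by simp
qed simp

lemma sum_mset_le_size_mult:
  fixes e :: "'c \<Rightarrow> nat"
  assumes "\<And>i. i \<in># m \<Longrightarrow> e i \<le> b"
  shows "(\<Sum>i\<in>#m. e i) \<le> size m * b"
  using assms by (induction m) (auto simp: add_mono)

context graph_of_monic
begin

text \<open>The monomials that survive modulo the relation expressing \<open>X\<^sub>1\<^sup>s\<close> through lower powers
  of \<open>X\<^sub>1\<close>. Index 0 is the homogenizing variable and index \<open>d + 1\<close> is the value of \<open>F\<close>.\<close>

definition normal_monoms :: "nat \<Rightarrow> nat multiset set" where
  "normal_monoms t = {m. set_mset m \<subseteq> {..Suc d} \<and> size m = t \<and> count m 1 < s}"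

lemma normal_monoms_vars: "m \<in> normal_monoms t \<Longrightarrow> set_mset m \<subseteq> {..<Suc D}"
  using d_less by (auto simp: normal_monoms_def)

lemma finite_normal_monoms: "finite (normal_monoms t)"
proof (rule finite_subset)
  show "normal_monoms t \<subseteq> multisets_of_size {..Suc d} t"
    by (auto simp: normal_monoms_def multisets_of_size_def)
qed auto

text \<open>The Kronecker substitution \<open>x\<^sub>i = z^kron t i\<close>. The exponents are powers of \<open>t + 1\<close>, so the
  degree in \<open>z\<close> of a normal monomial determines its exponents as digits.\<close>

definition kron :: "nat \<Rightarrow> nat \<Rightarrow> nat" where
  "kron t i = (if i = 0 then Suc t ^ (d - 1) else Suc t ^ (i - 1))"

definition kron_degree :: "nat \<Rightarrow> nat \<Rightarrow> nat" where
  "kron_degree t j = (if j = 0 then 0 else if j = Suc d then kron t 0 * s else kron t (j - 1))"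

lemma kron_degree_inj: "inj_on (\<lambda>m. \<Sum>j\<in>#m. kron_degree t j) (normal_monoms t)"
proof (rule inj_onI)
  let ?\<delta> = "\<lambda>m. \<Sum>j\<in>#m. kron_degree t j"
  fix m m' assume m: "m \<in> normal_monoms t" and m': "m' \<in> normal_monoms t"
    and eq: "?\<delta> m = ?\<delta> m'"
  obtain d' where d': "d = Suc d'" using d_pos gr0_implies_Suc by blast
  let ?b = "Suc t"
  let ?low = "\<lambda>m. \<Sum>i<d'. count m (Suc (Suc i)) * ?b ^ i"
  let ?top = "\<lambda>m. s * count m (Suc d) + count m 1"
  have expand: "?\<delta> m = ?b ^ d' * ?top m + ?low m"
    if "m \<in> normal_monoms t" for m
  proof -
    have "?\<delta> m = (\<Sum>j\<in>{..Suc d}. count m j * kron_degree t j)"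
      by (rule sum_mset_eq_sum_count) (use that in \<open>auto simp: normal_monoms_def\<close>)
    also have "\<dots> = (\<Sum>j\<in>{..<d}. count m (Suc j) * kron_degree t (Suc j)) + count m (Suc d) * kron_degree t (Suc d)"
      unfolding sum.atMost_Suc sum.atMost_shift by (simp add: kron_degree_def)
    also have "(\<Sum>j\<in>{..<d}. count m (Suc j) * kron_degree t (Suc j))
        = (\<Sum>j\<in>{..<Suc d'}. count m (Suc j) * kron_degree t (Suc j))"
      by (simp only: d'[symmetric])
    also have "\<dots> = count m 1 * ?b ^ d' + ?low m"
      unfolding sum.lessThan_Suc_shift kron_degree_def kron_def using d' by simp
    finally show ?thesis unfolding kron_degree_def kron_def using d' by (simp add: algebra_simps)
  qed
  have size: "size m = (\<Sum>j\<in>{..Suc d}. count m j)" if "m \<in> normal_monoms t" for m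
    using sum_mset_eq_sum_count[of "{..Suc d}" m "\<lambda>_. 1"] that
    by (simp add: normal_monoms_def size_multiset_overloaded_eq)
  have count_less: "count m j < ?b" if "m \<in> normal_monoms t" for m j
    using count_le_size[of m j] that by (simp add: normal_monoms_def)
  have low_less: "?low m < ?b ^ d'" if "m \<in> normal_monoms t" for m
    by (rule digit_sum_less) (rule count_less[OF that])
  have "?top m = ?top m' \<and> ?low m = ?low m'"
    using eq mult_add_eq_iff[OF low_less[OF m] low_less[OF m']] unfolding expand[OF m] expand[OF m']
    by blast
  then have top: "?top m = ?top m'" and low: "?low m = ?low m'" by blast+
  have "count m 1 < s" "count m' 1 < s" using m m' by (auto simp: normal_monoms_def)
  then have c1: "count m 1 = count m' 1" and cd: "count m (Suc d) = count m' (Suc d)"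
    using mult_add_eq_iff top by blast+
  have cl: "count m (Suc (Suc i)) = count m' (Suc (Suc i))" if "i < d'" for i
    by (rule digit_sum_inj[where n = d' and b = ?b
          and f = "\<lambda>i. count m (Suc (Suc i))" and g = "\<lambda>i. count m' (Suc (Suc i))"])
      (use count_less m m' low that in auto)
  have pos: "count m j = count m' j" if j: "0 < j" for j
  proof -
    consider "j = 1" | i where "j = Suc (Suc i)" "i < d'" | "j = Suc d" | "Suc d < j"
      using j d' by (metis One_nat_def Suc_lessI gr0_implies_Suc linorder_neqE_nat not_less_eq)
    then show ?thesis
    proof cases
      case 4
      then have "j \<notin># m" "j \<notin># m'" using m m' by (auto simp: normal_monoms_def)
      then show ?thesis by (simp add: not_in_iff)
    qed (use c1 cd cl in auto)
  qed
  have "count m 0 + (\<Sum>j\<le>d. count m (Suc j)) = count m' 0 + (\<Sum>j\<le>d. count m' (Suc j))"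
    using size[OF m] size[OF m'] m m' unfolding sum.atMost_Suc_shift by (simp add: normal_monoms_def)
  then have "count m 0 = count m' 0" using pos by simp
  then have "count m j = count m' j" for j using pos by (cases "j = 0") auto
  then show "m = m'" by (rule multiset_eqI)
qed

lemma kron_weight_less:
  assumes "set_mset m \<subseteq> {..<d}" "size m < s"
  shows "(\<Sum>i\<in>#m. kron t i) < kron t 0 * s"
proof -
  have "kron t i \<le> kron t 0" if "i < d" for i
    unfolding kron_def using that by (auto intro!: power_increasing)
  then have "(\<Sum>i\<in>#m. kron t i) \<le> size m * kron t 0"
    using assms by (intro sum_mset_le_size_mult) auto
  also have "\<dots> < s * kron t 0" using assms by (simp add: kron_def)
  finally show ?thesis by (simp add: mult.commute)
qed

lemma hpoint_kron_degree:
  assumes j: "j \<le> Suc d"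
  shows "poly_fun_degree (\<lambda>z. hpoint (\<lambda>i. z [^] kron t i) j) (kron_degree t j)"
proof -
  have mon: "poly_fun_degree (\<lambda>z. z [^] (n::nat)) n" for n
    by (rule poly_fun_degree_cong[OF poly_fun_degree_monom[of \<one> n]]) auto
  consider "j = 0" | i where "j = Suc i" "i < d" | "j = Suc d"
    using j by (metis Suc_less_eq le_neq_implies_less less_Suc_eq_0_disj less_Suc_eq_le)
  then show ?thesis
  proof cases
    case 1
    then show ?thesis using mon[of 0] by (simp add: hpoint_simps kron_degree_def)
  next
    case (2 i)
    then show ?thesis using mon by (simp add: hpoint_simps kron_degree_def)
  next
    case 3
    have "poly_fun_degree (\<lambda>z. z [^] (kron t 0 * s) \<oplus> peval g (\<lambda>i. z [^] kron t i)) (kron t 0 * s)"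
    proof (rule poly_fun_degree_add_below[OF mon])
      show "poly_fun_below (\<lambda>z. peval g (\<lambda>i. z [^] kron t i)) (kron t 0 * s)"
        by (rule poly_fun_below_mpoly_eval[OF mon _ g_mpoly])
          (use kron_weight_less mpolys_support[OF g_mpoly] g_size in auto)
    qed
    then have "poly_fun_degree (\<lambda>z. peval F (\<lambda>i. z [^] kron t i)) (kron t 0 * s)"
      by (rule poly_fun_degree_cong) (simp add: F_eval nat_pow_pow)
    then show ?thesis using 3 by (simp add: hpoint_simps kron_degree_def)
  qed
qed

lemma normal_form_eq_zero:
  assumes f: "f \<in> polys" and supp: "\<And>m. f m \<noteq> \<zero> \<Longrightarrow> m \<in> normal_monoms t"
    and zero: "\<And>u. u \<in> params \<Longrightarrow> peval f (hpoint u) = \<zero>"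
  shows "f m = \<zero>"
proof (rule ccontr)
  assume nz: "f m \<noteq> \<zero>"
  let ?M = "{m. f m \<noteq> \<zero>}"
  let ?X = "\<lambda>j z. hpoint (\<lambda>i. z [^] kron t i) j"
  have u: "(\<lambda>i. z [^] kron t i) \<in> params" if "z \<in> carrier R" for z using that by auto
  have Xc: "?X j z \<in> carrier R" if "j \<in> {..Suc d}" "z \<in> carrier R" for j z
    using hpoint_closed'[OF u[OF that(2)]] that(1) d_less by (auto simp: Pi_iff)
  have vars: "set_mset m \<subseteq> {..Suc d}" if "m \<in> ?M" for m
    using supp that by (auto simp: normal_monoms_def)
  have "\<forall>m\<in>?M. f m = \<zero>"
  proof (rule poly_fun_degrees_independent[OF infinite_field mpolys_finite_support[OF f]])
    show "inj_on (\<lambda>m. \<Sum>j\<in>#m. kron_degree t j) ?M"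
      by (rule inj_on_subset[OF kron_degree_inj]) (use supp in auto)
    show "poly_fun_degree (\<lambda>z. monom_val (\<lambda>j. ?X j z) m) (\<Sum>j\<in>#m. kron_degree t j)" if "m \<in> ?M" for m
      by (rule poly_fun_degree_monom_val[OF hpoint_kron_degree Xc vars[OF that]]) auto
    show "monom_val (\<lambda>j. ?X j z) m \<in> carrier R" if "m \<in> ?M" "z \<in> carrier R" for m z
      by (rule monom_val_closed[OF _ vars[OF that(1)]]) (use Xc that(2) in blast)
    show "f \<in> ?M \<rightarrow> carrier R" using mpolys_coeff[OF f] by blast
    show "(\<Oplus>m\<in>?M. f m \<otimes> monom_val (\<lambda>j. ?X j z) m) = \<zero>" if "z \<in> carrier R" for z
      using zero[OF u[OF that]] by (simp add: mpoly_eval_def monom_val_def)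
  qed
  then show False using nz by blast
qed

end

context graph_of_monic
begin

abbreviation "Q \<equiv> S Quot J"

definition residue :: "(nat multiset \<Rightarrow> 'a) \<Rightarrow> (nat multiset \<Rightarrow> 'a) set" where
  "residue f = J +>\<^bsub>S\<^esub> f"

abbreviation "scalars \<equiv> residue ` indexed_const ` carrier R"

lemma Q_ring: "ring Q"
  by (rule ideal.quotient_is_ring[OF J_ideal])

lemma residue_hom: "ring_hom_ring S Q residue"
  using ideal.rcos_ring_hom_ring[OF J_ideal] by (simp add: residue_def[abs_def])

lemma residue_eq_zero_iff:
  assumes "f \<in> polys"
  shows "residue f = \<zero>\<^bsub>Q\<^esub> \<longleftrightarrow> f \<in> J"
proof -
  interpret J: ideal J S by (rule J_ideal)
  have "\<zero>\<^bsub>Q\<^esub> = J" by (simp add: FactRing_def)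
  then show ?thesis
    using J.rcos_const_imp_mem[of f] J.a_rcos_const[of f] assms
    by (auto simp: residue_def mpoly_ring_simps)
qed

lemma residue_zero: "residue (indexed_const \<zero>) = \<zero>\<^bsub>Q\<^esub>"
  using residue_eq_zero_iff[OF zero_mpolys] by (simp add: J_iff mpoly_eval_const zero_mpolys)

lemma residue_add:
  assumes "f \<in> polys" "h \<in> polys"
  shows "residue (indexed_padd f h) = residue f \<oplus>\<^bsub>Q\<^esub> residue h"
  using ring_hom_ring.homh[OF residue_hom, THEN ring_hom_add, of f h] assms
  by (simp add: mpoly_ring_simps)

lemma residue_smult:
  assumes "c \<in> carrier R" "f \<in> polys"
  shows "residue (\<lambda>m. c \<otimes> f m) = residue (indexed_const c) \<otimes>\<^bsub>Q\<^esub> residue f"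
proof -
  have "indexed_const c \<in> polys" using assms(1) by (rule indexed_pset.indexed_const)
  then have "residue (mpoly_mult (indexed_const c) f) = residue (indexed_const c) \<otimes>\<^bsub>Q\<^esub> residue f"
    using ring_hom_ring.homh[OF residue_hom, THEN ring_hom_mult, of "indexed_const c" f] assms
    by (simp add: mpoly_ring_simps)
  moreover have "mpoly_mult (indexed_const c) f = (\<lambda>m. c \<otimes> f m)"
    by (rule mpoly_mult_const[OF assms(1)]) (rule mpolys_coeff[OF assms(2)])
  ultimately show ?thesis by simp
qed

lemma residue_closed: "f \<in> polys \<Longrightarrow> residue f \<in> carrier Q"
  using ring_hom_closed[OF ring_hom_ring.homh[OF residue_hom], of f] by (simp add: mpoly_ring_simps)

lemma one_notin_J: "indexed_const \<one> \<notin> J"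
proof
  assume "indexed_const \<one> \<in> J"
  then have "peval (indexed_const \<one>) (hpoint (\<lambda>_. \<zero>)) = \<zero>"
    using hpoint_in_W[of "\<lambda>_. \<zero>"] by (simp add: J_iff)
  then show False by (simp add: mpoly_eval_const)
qed

lemma scalars_subfield: "subfield scalars Q"
proof -
  interpret Q: ring Q by (rule Q_ring)
  interpret res: ring_hom_ring S Q residue by (rule residue_hom)
  have S_ops: "indexed_const (a \<otimes> b) = indexed_const a \<otimes>\<^bsub>S\<^esub> indexed_const b"
    "indexed_const (a \<oplus> b) = indexed_const a \<oplus>\<^bsub>S\<^esub> indexed_const b"
    if a: "a \<in> carrier R" and b: "b \<in> carrier R" for a b
  proof -
    have "mpoly_mult (indexed_const a) (indexed_const b :: nat multiset \<Rightarrow> 'a) = (\<lambda>m. a \<otimes> indexed_const b m)"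
      by (rule mpoly_mult_const[OF a]) (use b in \<open>simp add: indexed_const_def\<close>)
    then show "indexed_const (a \<otimes> b) = indexed_const a \<otimes>\<^bsub>S\<^esub> indexed_const b"
      unfolding mpoly_ring_simps using a by (auto simp: indexed_const_def)
    show "indexed_const (a \<oplus> b) = indexed_const a \<oplus>\<^bsub>S\<^esub> indexed_const b"
      unfolding mpoly_ring_simps by (rule indexed_padd_const[symmetric])
  qed
  have hom: "(\<lambda>c. residue (indexed_const c)) \<in> ring_hom R Q"
  proof (rule ring_hom_memI)
    have c: "indexed_const a \<in> carrier S" if "a \<in> carrier R" for a
      unfolding mpoly_ring_simps using that by (rule indexed_pset.indexed_const)
    fix a b assume a: "a \<in> carrier R" and b: "b \<in> carrier R"
    show "residue (indexed_const a) \<in> carrier Q" using c[OF a] by simp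
    show "residue (indexed_const (a \<otimes> b)) = residue (indexed_const a) \<otimes>\<^bsub>Q\<^esub> residue (indexed_const b)"
      using S_ops[OF a b] c[OF a] c[OF b] by simp
    show "residue (indexed_const (a \<oplus> b)) = residue (indexed_const a) \<oplus>\<^bsub>Q\<^esub> residue (indexed_const b)"
      using S_ops[OF a b] c[OF a] c[OF b] by simp
  next
    show "residue (indexed_const \<one>) = \<one>\<^bsub>Q\<^esub>"
      using res.hom_one by (simp only: mpoly_ring_simps)
  qed
  interpret con: ring_hom_ring R Q "\<lambda>c. residue (indexed_const c)"
    by (rule ring_hom_ringI2[OF ring_axioms Q_ring hom])
  have "\<one>\<^bsub>Q\<^esub> \<noteq> \<zero>\<^bsub>Q\<^esub>"
  proof
    assume "\<one>\<^bsub>Q\<^esub> = \<zero>\<^bsub>Q\<^esub>"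
    then have "residue (indexed_const \<one>) = \<zero>\<^bsub>Q\<^esub>" using con.hom_one by simp
    moreover have "indexed_const \<one> \<in> polys" by (rule indexed_pset.indexed_const) simp
    ultimately show False using residue_eq_zero_iff one_notin_J by blast
  qed
  then have "subfield ((\<lambda>c. residue (indexed_const c)) ` carrier R) Q"
    using con.img_is_subfield(2)[OF carrier_is_subfield] by simp
  then show ?thesis by (simp add: image_image)
qed

lemma monom_closed: "set_mset m \<subseteq> {..<Suc D} \<Longrightarrow> mpoly_monom \<one> m \<in> polys"
  by (intro mpoly_monom_closed) auto

abbreviation "monom_residues \<equiv> map (\<lambda>m. residue (mpoly_monom \<one> m))"

lemma Span_monom_residues_imp:
  assumes ms: "\<And>m. m \<in> set ms \<Longrightarrow> set_mset m \<subseteq> {..<Suc D}"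
    and x: "x \<in> ring.Span Q scalars (monom_residues ms)"
  shows "\<exists>f\<in>polys. (\<forall>m. f m \<noteq> \<zero> \<longrightarrow> m \<in> set ms) \<and> x = residue f"
  using assms
proof (induction ms arbitrary: x)
  case Nil
  interpret Q: ring Q by (rule Q_ring)
  show ?case
    using Nil(2) residue_zero by (intro bexI[OF _ zero_mpolys]) (auto simp: indexed_const_def)
next
  case (Cons m ms)
  interpret Q: ring Q by (rule Q_ring)
  obtain c v where c: "c \<in> carrier R" and v: "v \<in> Q.Span scalars (monom_residues ms)"
    and xv: "x = residue (indexed_const c) \<otimes>\<^bsub>Q\<^esub> residue (mpoly_monom \<one> m) \<oplus>\<^bsub>Q\<^esub> v"
    using Cons.prems(2) by (auto simp: Q.line_extension_mem_iff)
  obtain f where f: "f \<in> polys" "\<forall>m. f m \<noteq> \<zero> \<longrightarrow> m \<in> set ms" "v = residue f"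
    using Cons.IH[OF _ v] Cons.prems(1) by auto
  have m: "mpoly_monom \<one> m \<in> polys" using Cons.prems(1) by (intro monom_closed) simp
  let ?h = "indexed_padd (\<lambda>n. c \<otimes> mpoly_monom \<one> m n) f"
  have "?h \<in> polys" "x = residue ?h"
    using indexed_pset.indexed_padd[OF smult_mpolys[OF c m] f(1)]
      residue_add[OF smult_mpolys[OF c m] f(1)] residue_smult[OF c m] xv f(3) by simp_all
  moreover have "\<forall>n. ?h n \<noteq> \<zero> \<longrightarrow> n \<in> set (m # ms)"
    using f(2) c mpolys_coeff[OF f(1)]
    by (auto simp: indexed_padd_def mpoly_monom_def split: if_splits)
  ultimately show ?case by blast
qed

lemma monom_residues_independent:
  assumes "distinct ms" "set ms \<subseteq> normal_monoms t"
  shows "ring.independent Q scalars (monom_residues ms)"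
  using assms
proof (induction ms)
  case Nil
  interpret Q: ring Q by (rule Q_ring)
  show ?case by simp
next
  case (Cons m ms)
  interpret Q: ring Q by (rule Q_ring)
  have vars: "set_mset n \<subseteq> {..<Suc D}" if "n \<in> set (m # ms)" for n
    using that Cons.prems normal_monoms_vars by blast
  have m: "mpoly_monom \<one> m \<in> polys" using vars by (intro monom_closed) simp
  have "residue (mpoly_monom \<one> m) \<notin> Q.Span scalars (monom_residues ms)"
  proof
    assume "residue (mpoly_monom \<one> m) \<in> Q.Span scalars (monom_residues ms)"
    then obtain f where f: "f \<in> polys" "\<forall>m. f m \<noteq> \<zero> \<longrightarrow> m \<in> set ms"
      "residue (mpoly_monom \<one> m) = residue f"
      using Span_monom_residues_imp[of ms "residue (mpoly_monom \<one> m)"] vars by auto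
    let ?n = "\<lambda>m. \<ominus> \<one> \<otimes> f m"
    have n: "?n \<in> polys" by (rule smult_mpolys[OF _ f(1)]) simp
    let ?h = "indexed_padd (mpoly_monom \<one> m) ?n"
    have h: "?h \<in> polys" using indexed_pset.indexed_padd[OF m n] .
    have supp: "k \<in> normal_monoms t" if "?h k \<noteq> \<zero>" for k
    proof -
      have "k = m \<or> f k \<noteq> \<zero>" using that by (auto simp: indexed_padd_def mpoly_monom_def)
      then show ?thesis using f(2) Cons.prems(2) by auto
    qed
    have hH: "?h \<in> H t" unfolding homogeneous_part_iff using h supp by (auto simp: normal_monoms_def)
    have "residue ?h = residue (indexed_padd f ?n)"
      using residue_add[OF m n] residue_add[OF f(1) n] f(3) by simp
    also have "indexed_padd f ?n = indexed_const \<zero>"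
      using mpolys_coeff[OF f(1)] by (auto simp: indexed_padd_def indexed_const_def l_minus r_neg)
    also note residue_zero
    finally have "?h \<in> J" using residue_eq_zero_iff[OF h] by simp
    then have "\<forall>u\<in>params. peval ?h (hpoint u) = \<zero>"
      using homogeneous_in_J_iff[OF hH] by simp
    then have "?h m = \<zero>" using normal_form_eq_zero[OF h supp] by blast
    moreover have "f m = \<zero>" using f(2) Cons.prems(1) by auto
    ultimately show False by (simp add: indexed_padd_def mpoly_monom_def)
  qed
  then show ?case
    using Q.li_Cons[OF residue_closed[OF m]] Cons by simp
qed

lemma homogenize_reduction:
  assumes m: "set_mset m \<subseteq> {..<Suc D}" and q: "q \<in> mpolys {..<d}"
    and size: "\<And>a. q a \<noteq> \<zero> \<Longrightarrow> size a < s"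
  shows "\<exists>h\<in>H (size m + s). (\<forall>n. h n \<noteq> \<zero> \<longrightarrow> count n 1 < count m 1 + s) \<and>
           (\<forall>u\<in>params. peval h (hpoint u) = monom_val (hpoint u) m \<otimes> peval q u)"
  using q
proof (induction rule: mpolys_monom_induct)
  case zero
  have "indexed_const \<zero> \<in> H (size m + s)"
    unfolding homogeneous_part_iff by (intro conjI zero_mpolys) (simp add: indexed_const_def)
  moreover have "monom_val (hpoint u) m \<in> carrier R" if "u \<in> params" for u
    by (rule monom_val_closed[OF hpoint_closed'[OF that] m])
  ultimately show ?case
    by (intro bexI[of _ "indexed_const \<zero>"]) (auto simp: mpoly_eval_const, simp add: indexed_const_def)
next
  case (add q' a)
  obtain h where h: "h \<in> H (size m + s)" "\<forall>n. h n \<noteq> \<zero> \<longrightarrow> count n 1 < count m 1 + s"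
    and ev: "\<And>u. u \<in> params \<Longrightarrow>
      peval h (hpoint u) = monom_val (hpoint u) m \<otimes> peval q' u"
    using add(3) by blast
  have c: "q a \<in> carrier R" and a: "set_mset a \<subseteq> {..<d}" and sa: "size a < s"
    using mpolys_coeff[OF q] mpolys_support[OF q add(2)] size[OF add(2)] by auto
  let ?a = "image_mset Suc a + replicate_mset (s - size a) 0"
  let ?h = "indexed_padd (mpoly_monom (q a) (m + ?a)) h"
  have vars: "set_mset (image_mset Suc a) \<subseteq> {..<Suc D}" "set_mset ?a \<subseteq> {..<Suc D}"
    "set_mset (m + ?a) \<subseteq> {..<Suc D}"
    using a m d_less by (auto split: if_splits)
  have hm: "h \<in> polys" using h(1) by (simp add: homogeneous_part_iff)
  have mm: "mpoly_monom (q a) (m + ?a) \<in> polys" by (rule mpoly_monom_closed[OF c vars(3)])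
  have size_eq: "size (m + ?a) = size m + s" using sa by simp
  have "?h \<in> H (size m + s)"
    unfolding homogeneous_part_iff
  proof (intro conjI allI impI)
    show "?h \<in> polys" by (rule indexed_pset.indexed_padd[OF mm hm])
    fix n assume "?h n \<noteq> \<zero>"
    then have "n = m + ?a \<or> h n \<noteq> \<zero>"
      using c by (auto simp: indexed_padd_def mpoly_monom_def split: if_splits)
    then show "size n = size m + s" using h(1) size_eq unfolding homogeneous_part_iff by blast
  qed
  moreover have "\<forall>n. ?h n \<noteq> \<zero> \<longrightarrow> count n 1 < count m 1 + s"
  proof (intro allI impI)
    fix n assume "?h n \<noteq> \<zero>"
    then have n: "n = m + ?a \<or> h n \<noteq> \<zero>"
      using c by (auto simp: indexed_padd_def mpoly_monom_def split: if_splits)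
    have "count (image_mset Suc a) 1 \<le> size (image_mset Suc a)" by (rule count_le_size)
    then have "count (m + ?a) 1 < count m 1 + s" using sa by simp
    then show "count n 1 < count m 1 + s" using n h(2) by blast
  qed
  moreover have "peval ?h (hpoint u)
      = monom_val (hpoint u) m \<otimes> peval (indexed_padd (mpoly_monom (q a) a) q') u"
    if u: "u \<in> params" for u
  proof -
    note hu = hpoint_closed'[OF u]
    have shift: "monom_val (hpoint u) (image_mset Suc a) = monom_val u a"
      using a
    proof (induction a)
      case (add i a)
      have "monom_val (hpoint u) (add_mset (Suc i) (image_mset Suc a))
          = hpoint u (Suc i) \<otimes> monom_val (hpoint u) (image_mset Suc a)"
        by (rule monom_val_add_mset[OF hu]) (use add.prems d_less in auto)
      then show ?case
        using add monom_val_add_mset[OF u, of a i] hpoint_simps(2)[of i u] by simp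
    qed simp
    have one: "monom_val (hpoint u) (replicate_mset (s - size a) 0) = \<one>"
      using monom_val_replicate[of "hpoint u" 0] by (simp add: hpoint_simps)
    have cl: "monom_val (hpoint u) m \<in> carrier R" "monom_val u a \<in> carrier R"
      "peval q' u \<in> carrier R"
      using monom_val_closed[OF hu m] monom_val_closed[OF u a] mpoly_eval_closed[OF u add(1)] by auto
    have "set_mset (replicate_mset (s - size a) 0) \<subseteq> {..<Suc D}" by auto
    then have "monom_val (hpoint u) ?a = monom_val u a"
      using monom_val_add[OF hu vars(1)] shift one cl by simp
    then have "monom_val (hpoint u) (m + ?a) = monom_val (hpoint u) m \<otimes> monom_val u a"
      using monom_val_add[OF hu m vars(2)] by simp
    then have "peval ?h (hpoint u)
        = q a \<otimes> (monom_val (hpoint u) m \<otimes> monom_val u a) \<oplus> monom_val (hpoint u) m \<otimes> peval q' u"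
      using mpoly_eval_padd[OF hu mm hm] mpoly_eval_monom[OF hu c vars(3)] ev[OF u] by simp
    also have "\<dots> = monom_val (hpoint u) m \<otimes> (q a \<otimes> monom_val u a \<oplus> peval q' u)"
      using cl c by (simp add: r_distr m_lcomm)
    finally show ?thesis
      using mpoly_eval_padd[OF u mpoly_monom_closed[OF c a] add(1)] mpoly_eval_monom[OF u c a] by simp
  qed
  ultimately show ?case by blast
qed

end

lemma
  fixes a :: "nat \<Rightarrow> 'a :: field"
  shows degree_prod_monic_linear: "Polynomial.degree (\<Prod>i<n. [:a i, 1:]) = n"
    and coeff_prod_monic_linear: "Polynomial.coeff (\<Prod>i<n. [:a i, 1:]) n = 1"
proof -
  have "Polynomial.degree (\<Prod>i<n. [:a i, 1:]) = (\<Sum>i<n. Polynomial.degree [:a i, 1:])"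
    by (rule degree_prod_eq_sum_degree) auto
  then show deg: "Polynomial.degree (\<Prod>i<n. [:a i, 1:]) = n" by simp
  have "Polynomial.lead_coeff (\<Prod>i<n. [:a i, 1:]) = 1"
    by (simp add: lead_coeff_prod)
  then show "Polynomial.coeff (\<Prod>i<n. [:a i, 1:]) n = 1" unfolding deg .
qed

lemma eventually_eq_imp_poly_eq:
  fixes p q :: "rat poly"
  assumes "\<forall>\<^sub>F t in sequentially. poly p (of_nat t) = poly q (of_nat t)"
  shows "p = q"
proof (rule ccontr)
  assume "p \<noteq> q"
  then have fin: "finite {x. poly (p - q) x = 0}" by (intro poly_roots_finite) simp
  obtain N where N: "\<And>t. N \<le> t \<Longrightarrow> poly p (of_nat t) = poly q (of_nat t)"
    using assms by (auto simp: eventually_sequentially)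
  have "of_nat ` {N..} \<subseteq> {x. poly (p - q) x = 0}" using N by auto
  then have "finite ((of_nat :: nat \<Rightarrow> rat) ` {N..})" using fin finite_subset by blast
  then have "finite {N..}" by (rule finite_imageD) (simp add: inj_on_def)
  then show False by (simp add: infinite_Ici)
qed

context graph_of_monic
begin

lemma residue_in_Span:
  assumes f: "f \<in> polys"
    and Us: "set Us \<subseteq> carrier Q"
    and monoms: "\<And>m. f m \<noteq> \<zero> \<Longrightarrow> residue (mpoly_monom \<one> m) \<in> ring.Span Q scalars Us"
  shows "residue f \<in> ring.Span Q scalars Us"
  using f
proof (induction rule: mpolys_monom_induct)
  case zero
  interpret Q: ring Q by (rule Q_ring)
  show ?case using Q.Span_subgroup_props(2)[OF scalars_subfield Us] residue_zero by simp
next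
  case (add h m)
  interpret Q: ring Q by (rule Q_ring)
  have c: "f m \<in> carrier R" using mpolys_coeff[OF f] .
  have m: "mpoly_monom \<one> m \<in> polys" by (rule monom_closed[OF mpolys_support[OF f add(2)]])
  have eq: "mpoly_monom (f m) m = (\<lambda>n. f m \<otimes> mpoly_monom \<one> m n)"
    using c by (auto simp: mpoly_monom_def)
  have "residue (mpoly_monom (f m) m) = residue (indexed_const (f m)) \<otimes>\<^bsub>Q\<^esub> residue (mpoly_monom \<one> m)"
    unfolding eq by (rule residue_smult[OF c m])
  also have "\<dots> \<in> Q.Span scalars Us"
    by (rule Q.Span_smult_closed[OF scalars_subfield Us _ monoms[OF add(2)]]) (use c in blast)
  finally have "residue (mpoly_monom (f m) m) \<in> Q.Span scalars Us" .
  moreover have "mpoly_monom (f m) m \<in> polys"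
    by (rule mpoly_monom_closed[OF c mpolys_support[OF f add(2)]])
  ultimately show ?case
    using residue_add[OF _ add(1)] Q.Span_subgroup_props(3)[OF scalars_subfield Us] add(3) by simp
qed

lemma monom_in_Span:
  assumes ms: "set ms = normal_monoms t"
    and m: "set_mset m \<subseteq> {..<Suc D}" "size m = t"
  shows "residue (mpoly_monom \<one> m) \<in> ring.Span Q scalars (monom_residues ms)"
  using m
proof (induction "count m 1" arbitrary: m rule: less_induct)
  case less
  interpret Q: ring Q by (rule Q_ring)
  let ?Us = "monom_residues ms"
  let ?X = "mpoly_monom \<one>"
  note m = less.prems
  have Us: "set ?Us \<subseteq> carrier Q"
    using residue_closed monom_closed normal_monoms_vars ms by auto
  have X: "?X m \<in> polys" by (rule monom_closed[OF m(1)])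
  have XH: "?X m \<in> H t" using X m(2) by (auto simp: homogeneous_part_iff mpoly_monom_def)
  have evX: "peval (?X n) (hpoint u) = monom_val (hpoint u) n"
    if "set_mset n \<subseteq> {..<Suc D}" "u \<in> params" for n u
    using mpoly_eval_monom[OF hpoint_closed'[OF that(2)] one_closed that(1)]
      monom_val_closed[OF hpoint_closed'[OF that(2)] that(1)] by simp
  consider "m \<in> normal_monoms t" | j where "j \<in># m" "Suc d < j" | "s \<le> count m 1"
    using m by (force simp: normal_monoms_def not_le not_less)
  then show ?case
  proof cases
    case 1
    then have "residue (?X m) \<in> set ?Us" using ms by auto
    then show ?thesis using Q.Span_base_incl[OF scalars_subfield Us] by blast
  next
    case (2 j)
    define m' where "m' = m - {#j#}"
    have mj: "m = add_mset j m'" using 2 by (simp add: m'_def)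
    have "peval (?X m) (hpoint u) = \<zero>" if u: "u \<in> params" for u
    proof -
      have vars: "set_mset m' \<subseteq> {..<Suc D}" "j \<in> {..<Suc D}" using m mj by auto
      have "peval (?X m) (hpoint u) = hpoint u j \<otimes> monom_val (hpoint u) m'"
        using evX[OF m(1) u] monom_val_add_mset[OF hpoint_closed'[OF u] vars] mj by simp
      then show ?thesis
        using hpoint_simps(4)[of j u] 2 vars monom_val_closed[OF hpoint_closed'[OF u] vars(1)] by simp
    qed
    then have "residue (?X m) = \<zero>\<^bsub>Q\<^esub>"
      using residue_eq_zero_iff[OF X] homogeneous_in_J_iff[OF XH] by simp
    then show ?thesis using Q.Span_subgroup_props(2)[OF scalars_subfield Us] by simp
  next
    case 3
    define m' where "m' = m - replicate_mset s 1"
    have mm': "m = m' + replicate_mset s 1"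
      using 3 by (simp add: m'_def count_le_replicate_mset_subset_eq)
    have vars': "set_mset m' \<subseteq> {..<Suc D}" using m(1) mm' by auto
    define n where "n = add_mset (Suc d) (m' + replicate_mset (s - 1) 0)"
    have n: "set_mset n \<subseteq> {..<Suc D}" "size n = t" "count n 1 < count m 1"
      using vars' d_less d_pos m(2) mm' s_pos by (auto simp: n_def)
    obtain h where h: "h \<in> H (size m' + s)" "\<forall>k. h k \<noteq> \<zero> \<longrightarrow> count k 1 < count m' 1 + s"
      and ev: "\<And>u. u \<in> params \<Longrightarrow>
        peval h (hpoint u) = monom_val (hpoint u) m' \<otimes> peval g u"
      using homogenize_reduction[OF vars' g_mpoly g_size] by blast
    have ht: "size m' + s = t" using m(2) mm' by simp
    have hm: "h \<in> polys" using h(1) by (simp add: homogeneous_part_iff)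
    have Xn: "?X n \<in> polys" by (rule monom_closed[OF n(1)])
    let ?k = "indexed_padd (?X m) h"
    let ?f = "indexed_padd ?k (\<lambda>i. \<ominus> \<one> \<otimes> ?X n i)"
    have nXn: "(\<lambda>i. \<ominus> \<one> \<otimes> ?X n i) \<in> polys" by (rule smult_mpolys[OF _ Xn]) simp
    have k: "?k \<in> polys" by (rule indexed_pset.indexed_padd[OF X hm])
    have f: "?f \<in> polys" by (rule indexed_pset.indexed_padd[OF k nXn])
    have "?f \<in> H t"
      unfolding homogeneous_part_iff
    proof (intro conjI allI impI f)
      fix i assume "?f i \<noteq> \<zero>"
      then have "i = m \<or> i = n \<or> h i \<noteq> \<zero>"
        by (auto simp: indexed_padd_def mpoly_monom_def split: if_splits)
      then show "size i = t" using m(2) n(2) h(1) ht by (auto simp: homogeneous_part_iff)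
    qed
    moreover have "peval ?f (hpoint u) = \<zero>" if u: "u \<in> params" for u
    proof -
      note hu = hpoint_closed'[OF u]
      let ?a = "monom_val (hpoint u) m'"
      have u0: "u 0 \<in> carrier R" and gu: "peval g u \<in> carrier R"
        using u d_pos mpoly_eval_closed[OF u g_mpoly] by auto
      have a: "?a \<in> carrier R" by (rule monom_val_closed[OF hu vars'])
      have "set_mset (replicate_mset s 1) \<subseteq> {..<Suc D}" "set_mset (replicate_mset (s - 1) 0) \<subseteq> {..<Suc D}"
        using d_less by auto
      note add = monom_val_add[OF hu vars' this(1)] monom_val_add[OF hu vars' this(2)]
      have "monom_val (hpoint u) m = ?a \<otimes> u 0 [^] s"
        unfolding mm' add(1) using monom_val_replicate[of "hpoint u" 1 s] hpoint_simps(2)[of 0 u] d_pos u0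
        by simp
      moreover have "monom_val (hpoint u) n = (u 0 [^] s \<oplus> peval g u) \<otimes> ?a"
      proof -
        have "monom_val (hpoint u) n
            = hpoint u (Suc d) \<otimes> monom_val (hpoint u) (m' + replicate_mset (s - 1) 0)"
          unfolding n_def by (rule monom_val_add_mset[OF hu]) (use vars' d_less in auto)
        then show ?thesis
          unfolding add(2) using monom_val_replicate[of "hpoint u" 0 "s - 1"] hpoint_simps(1)[of u]
            hpoint_simps(3)[of u] F_eval[OF u] a by simp
      qed
      ultimately have "peval ?f (hpoint u) = ?a \<otimes> u 0 [^] s \<oplus> ?a \<otimes> peval g u
          \<oplus> \<ominus> \<one> \<otimes> ((u 0 [^] s \<oplus> peval g u) \<otimes> ?a)"
        using mpoly_eval_padd[OF hu k nXn] mpoly_eval_padd[OF hu X hm] ev[OF u] evX[OF m(1) u]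
          evX[OF n(1) u] mpoly_eval_smult[OF hu _ Xn, of "\<ominus> \<one>"] by simp
      also have "\<dots> = \<zero>"
      proof -
        have "?a \<otimes> u 0 [^] s \<oplus> ?a \<otimes> peval g u = ?a \<otimes> (u 0 [^] s \<oplus> peval g u)"
          using a u0 gu by (simp add: r_distr)
        moreover have "\<ominus> \<one> \<otimes> ((u 0 [^] s \<oplus> peval g u) \<otimes> ?a)
            = \<ominus> (?a \<otimes> (u 0 [^] s \<oplus> peval g u))"
          using a u0 gu m_comm[of ?a "u 0 [^] s \<oplus> peval g u"] by (simp add: l_minus)
        ultimately show ?thesis using a u0 gu by (simp only: r_neg m_closed a_closed nat_pow_closed)
      qed
      finally show ?thesis .
    qed
    ultimately have "residue ?f = \<zero>\<^bsub>Q\<^esub>"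
      using residue_eq_zero_iff[OF f] homogeneous_in_J_iff by simp
    then have "residue (?X m) \<oplus>\<^bsub>Q\<^esub> (residue h \<oplus>\<^bsub>Q\<^esub> residue (\<lambda>i. \<ominus> \<one> \<otimes> ?X n i)) = \<zero>\<^bsub>Q\<^esub>"
      using residue_add[OF k nXn] residue_add[OF X hm] residue_closed[OF X] residue_closed[OF hm]
        residue_closed[OF nXn] by (simp add: Q.a_assoc)
    then have eq: "residue (?X m) = \<ominus>\<^bsub>Q\<^esub> (residue h \<oplus>\<^bsub>Q\<^esub> residue (\<lambda>i. \<ominus> \<one> \<otimes> ?X n i))"
      using Q.minus_equality residue_closed[OF X] residue_closed[OF hm] residue_closed[OF nXn]
      by simp
    have "residue h \<in> Q.Span scalars ?Us"
    proof (rule residue_in_Span[OF hm Us])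
      fix k assume "h k \<noteq> \<zero>"
      then show "residue (?X k) \<in> Q.Span scalars ?Us"
        using less.hyps[of k] h ht mm' mpolys_support[OF hm] by (simp add: homogeneous_part_iff)
    qed
    moreover have "residue (\<lambda>i. \<ominus> \<one> \<otimes> ?X n i) \<in> Q.Span scalars ?Us"
      unfolding residue_smult[OF a_inv_closed[OF one_closed] Xn]
      by (rule Q.Span_smult_closed[OF scalars_subfield Us _ less.hyps[OF n(3,1,2)]]) simp
    ultimately show ?thesis
      unfolding eq using Q.Span_subgroup_props(3,4)[OF scalars_subfield Us] by simp
  qed
qed

lemma hilbert_function_eq_card: "hilbert_function R (Suc D) J t = card (normal_monoms t)"
proof -
  interpret Q: ring Q by (rule Q_ring)
  obtain ms where ms: "set ms = normal_monoms t" "distinct ms"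
    using finite_distinct_list[OF finite_normal_monoms] by blast
  let ?Us = "monom_residues ms"
  have Us: "set ?Us \<subseteq> carrier Q"
    using residue_closed monom_closed normal_monoms_vars ms(1) by auto
  have "residue ` H t = Q.Span scalars ?Us"
  proof (intro subset_antisym subsetI)
    fix x assume "x \<in> residue ` H t"
    then obtain f where f: "f \<in> H t" "x = residue f" by blast
    then show "x \<in> Q.Span scalars ?Us"
      using residue_in_Span[OF _ Us, of f] monom_in_Span[OF ms(1)] mpolys_support[of f]
      by (simp add: homogeneous_part_iff)
  next
    fix x assume "x \<in> Q.Span scalars ?Us"
    then obtain f where f: "f \<in> polys" "\<forall>m. f m \<noteq> \<zero> \<longrightarrow> m \<in> set ms" "x = residue f"
      using Span_monom_residues_imp[of ms x] normal_monoms_vars ms(1) by blast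
    then have "f \<in> H t" using ms(1) by (auto simp: homogeneous_part_iff normal_monoms_def)
    then show "x \<in> residue ` H t" using f(3) by blast
  qed
  moreover have "Q.dimension (length ?Us) scalars (Q.Span scalars ?Us)"
    by (rule Q.dimension_independent[OF monom_residues_independent]) (use ms in auto)
  ultimately have "Q.dim scalars (residue ` H t) = length ?Us"
    using Q.dimI[OF scalars_subfield] by (simp add: over_def)
  also have "length ?Us = card (normal_monoms t)" using distinct_card[OF ms(2)] ms(1) by simp
  finally show ?thesis by (simp add: hilbert_function_def residue_def[abs_def] Let_def)
qed

lemma card_normal_monoms:
  assumes t: "s \<le> t"
  shows "card (normal_monoms t) = (\<Sum>j<s. (d + (t - j)) choose d)"
proof -
  let ?A = "{..Suc d} - {1}"
  let ?N = "\<lambda>j. (\<lambda>m. m + replicate_mset j 1) ` multisets_of_size ?A (t - j)"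
  have "normal_monoms t = (\<Union>j<s. ?N j)"
  proof (intro subset_antisym subsetI)
    fix m assume m: "m \<in> normal_monoms t"
    let ?j = "count m 1"
    have sub: "replicate_mset ?j 1 \<subseteq># m" by (simp add: count_le_replicate_mset_subset_eq[symmetric])
    have "1 \<notin># m - replicate_mset ?j 1" by (simp add: not_in_iff)
    then have "m - replicate_mset ?j 1 \<in> multisets_of_size ?A (t - ?j)"
      using m sub in_diffD[of _ m "replicate_mset ?j 1"]
      by (auto simp: normal_monoms_def multisets_of_size_def size_Diff_submset)
    then have "m \<in> ?N ?j" using sub by (intro image_eqI[of _ _ "m - replicate_mset ?j 1"]) simp_all
    then show "m \<in> (\<Union>j<s. ?N j)" using m by (auto simp: normal_monoms_def)
  next
    fix m assume "m \<in> (\<Union>j<s. ?N j)"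
    then obtain j m' where "j < s" "m' \<in> multisets_of_size ?A (t - j)" "m = m' + replicate_mset j 1"
      by blast
    moreover from this have "count m' 1 = 0" by (auto simp: multisets_of_size_def count_eq_zero_iff)
    ultimately show "m \<in> normal_monoms t"
      using t d_pos by (auto simp: normal_monoms_def multisets_of_size_def split: if_splits)
  qed
  moreover have "card (\<Union>j<s. ?N j) = (\<Sum>j<s. card (?N j))"
  proof (rule card_UN_disjoint)
    have c: "count m 1 = j" if N: "m \<in> ?N j" for m j
    proof -
      obtain m' where m': "m' \<in> multisets_of_size ?A (t - j)" "m = m' + replicate_mset j 1"
        using N by blast
      then have "count m' 1 = 0" by (auto simp: multisets_of_size_def count_eq_zero_iff)
      then show ?thesis using m'(2) by simp
    qed
    show "\<forall>i\<in>{..<s}. \<forall>j\<in>{..<s}. i \<noteq> j \<longrightarrow> ?N i \<inter> ?N j = {}"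
    proof (intro ballI impI equals0I)
      fix i j m assume "i \<noteq> j" "m \<in> ?N i \<inter> ?N j"
      then show False using c[of m i] c[of m j] by simp
    qed
  qed auto
  moreover have "card (?N j) = (d + (t - j)) choose d" for j
  proof -
    have "card (?N j) = card (multisets_of_size ?A (t - j))" by (rule card_image) (simp add: inj_on_def)
    also have "\<dots> = (card ?A + (t - j) - 1) choose (t - j)" by (rule card_multisets_of_size) simp
    also have "card ?A = Suc d" using d_pos by simp
    finally show ?thesis using binomial_symmetric[of d "d + (t - j)"] by simp
  qed
  ultimately show ?thesis by simp
qed

lemma variety_hilbert_polynomial_graph:
  "Polynomial.degree (variety_hilbert_polynomial R D V) = d"
  "Polynomial.coeff (variety_hilbert_polynomial R D V) d = of_nat s / fact d"
proof -
  let ?p = "\<lambda>j. \<Prod>i<d. [:of_nat d - of_nat j - of_nat i, 1 :: rat:]"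
  define h where "h = Polynomial.smult (1 / fact d) (\<Sum>j<s. ?p j)"
  have h: "poly h (of_nat t) = of_nat (hilbert_function R (Suc D) J t)" if t: "s \<le> t" for t
  proof -
    have "poly (?p j) (of_nat t) = fact d * of_nat ((d + (t - j)) choose d)" if "j < s" for j
    proof -
      have "of_nat (d + (t - j)) = of_nat d - of_nat j + (of_nat t :: rat)"
        using that t by (simp add: of_nat_diff)
      then have "poly (?p j) (of_nat t) = (\<Prod>i=0..<d. of_nat (d + (t - j)) - of_nat i)"
        unfolding poly_prod lessThan_atLeast0 by (intro prod.cong) auto
      also have "\<dots> = fact d * (of_nat (d + (t - j)) gchoose d)" by (simp add: gbinomial_prod_rev)
      finally show ?thesis by (simp add: binomial_gbinomial)
    qed
    then show ?thesis
      unfolding h_def hilbert_function_eq_card card_normal_monoms[OF t]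
      by (simp add: poly_sum sum_distrib_left)
  qed
  have p: "Polynomial.degree (?p j) = d" "Polynomial.coeff (?p j) d = 1" for j
    by (rule degree_prod_monic_linear, rule coeff_prod_monic_linear)
  have "variety_hilbert_polynomial R D V = h"
    unfolding variety_hilbert_polynomial_def hilbert_polynomial_def
  proof (rule the_equality)
    show ev: "\<forall>\<^sub>F t in sequentially. poly h (of_nat t) = of_nat (hilbert_function R (Suc D) J t)"
      using h by (auto simp: eventually_sequentially)
    fix h' :: "rat poly" assume "\<forall>\<^sub>F t in sequentially. poly h' (of_nat t) = of_nat (hilbert_function R (Suc D) J t)"
    with ev have "\<forall>\<^sub>F t in sequentially. poly h' (of_nat t) = poly h (of_nat t)"
      by eventually_elim simp
    then show "h' = h" by (rule eventually_eq_imp_poly_eq)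
  qed
  moreover have "Polynomial.coeff h d = of_nat s / fact d"
    unfolding h_def by (simp add: coeff_sum p(2))
  moreover have "Polynomial.degree h = d"
  proof (rule antisym)
    show "Polynomial.degree h \<le> d"
      unfolding h_def by (intro order_trans[OF degree_smult_le] degree_sum_le) (simp_all add: p(1))
    show "d \<le> Polynomial.degree h" using calculation(2) s_pos by (intro le_degree) simp
  qed
  ultimately show "Polynomial.degree (variety_hilbert_polynomial R D V) = d"
    "Polynomial.coeff (variety_hilbert_polynomial R D V) d = of_nat s / fact d" by simp_all
qed

lemma variety_dim_graph: "variety_dim R D V = d"
  by (simp add: variety_dim_def variety_hilbert_polynomial_graph)

lemma variety_degree_graph: "variety_degree R D V = of_nat s"
  by (simp add: variety_degree_def variety_dim_def variety_hilbert_polynomial_graph)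

lemma variety_graph: "variety R D V"
  by (rule variety_graph_variety[OF infinite_field F_mpoly d_less])

end

subsection \<open>Polynomials with coefficients in a finite subfield\<close>

context field
begin

definition subfield_polys :: "'a set \<Rightarrow> nat \<Rightarrow> nat \<Rightarrow> (nat multiset \<Rightarrow> 'a) set" where
  "subfield_polys k d s =
     {g \<in> mpolys {..<d}. (\<forall>m. g m \<in> k) \<and> (\<forall>m. g m \<noteq> \<zero> \<longrightarrow> size m < s)}"

lemma subfield_polysD:
  assumes "g \<in> subfield_polys k d s"
  shows "g \<in> mpolys {..<d}" "g m \<in> k" "g m \<noteq> \<zero> \<Longrightarrow> size m < s"
  using assms by (auto simp: subfield_polys_def)

lemma finite_subfield_polys:
  assumes "finite k"
  shows "finite (subfield_polys k d s)"
proof -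
  let ?M = "\<Union>t<s. multisets_of_size {..<d} t"
  have "finite ?M" by auto
  then have fin: "finite (?M \<rightarrow>\<^sub>E k)" using assms by (intro finite_PiE)
  have "inj_on (\<lambda>g. restrict g ?M) (subfield_polys k d s)"
  proof (rule inj_onI)
    fix g h assume g: "g \<in> subfield_polys k d s" and h: "h \<in> subfield_polys k d s"
      and eq: "restrict g ?M = restrict h ?M"
    show "g = h"
    proof
      fix m
      show "g m = h m"
      proof (cases "m \<in> ?M")
        case True
        then show ?thesis using fun_cong[OF eq, of m] by simp
      next
        case False
        have "f m = \<zero>" if "f \<in> subfield_polys k d s" for f
          using False mpolys_support[OF subfield_polysD(1)[OF that]] subfield_polysD(3)[OF that]
          by (auto simp: multisets_of_size_def)
        from this[OF g] this[OF h] show ?thesis by simp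
      qed
    qed
  qed
  moreover have "(\<lambda>g. restrict g ?M) ` subfield_polys k d s \<subseteq> ?M \<rightarrow>\<^sub>E k"
    by (auto simp: subfield_polys_def)
  ultimately show ?thesis by (rule inj_on_finite) (rule fin)
qed

context
  fixes k :: "'a set"
  assumes k: "subfield k R"
begin

lemmas subfield_ringE = subringE[OF subfieldE(1)[OF k]]

lemma subfield_polys_zero: "indexed_const \<zero> \<in> subfield_polys k d s"
  using subfield_ringE(2) zero_mpolys[of "{..<d}"]
  by (auto simp: subfield_polys_def indexed_const_def)

lemma subfield_polys_one: "0 < s \<Longrightarrow> indexed_const \<one> \<in> subfield_polys k d s"
proof -
  assume "0 < s"
  moreover have "indexed_const \<one> \<in> mpolys {..<d}" by (rule indexed_pset.indexed_const) simp
  ultimately show ?thesis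
    using subfield_ringE(2,3) by (auto simp: subfield_polys_def indexed_const_def)
qed

lemma subfield_polys_padd:
  assumes "g \<in> subfield_polys k d s" "h \<in> subfield_polys k d s"
  shows "indexed_padd g h \<in> subfield_polys k d s"
proof -
  have "indexed_padd g h \<in> mpolys {..<d}"
    by (rule indexed_pset.indexed_padd) (use assms subfield_polysD in blast)+
  moreover have "size m < s" if "g m \<oplus> h m \<noteq> \<zero>" for m
    using that subfield_polysD(3)[OF assms(1), of m] subfield_polysD(3)[OF assms(2), of m]
    by (cases "g m = \<zero>"; cases "h m = \<zero>") auto
  ultimately show ?thesis
    using subfield_ringE(7) assms
    by (auto simp: subfield_polys_def indexed_padd_def)
qed

lemma subfield_polys_smult:
  assumes "c \<in> k" "g \<in> subfield_polys k d s"
  shows "(\<lambda>m. c \<otimes> g m) \<in> subfield_polys k d s"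
proof -
  have c: "c \<in> carrier R" using assms(1) subfieldE(3)[OF k] by blast
  have "(\<lambda>m. c \<otimes> g m) \<in> mpolys {..<d}"
    by (rule smult_mpolys[OF c subfield_polysD(1)[OF assms(2)]])
  moreover have "size m < s" if "c \<otimes> g m \<noteq> \<zero>" for m
    using that c subfield_polysD(3)[OF assms(2), of m] by (cases "g m = \<zero>") auto
  ultimately show ?thesis
    using subfield_ringE(6) assms by (auto simp: subfield_polys_def)
qed

lemma subfield_polys_pmult:
  assumes "i < d" "g \<in> subfield_polys k d s"
  shows "indexed_pmult g i \<in> subfield_polys k d (Suc s)"
proof -
  have "indexed_pmult g i \<in> mpolys {..<d}"
    by (rule indexed_pset.indexed_pmult[OF subfield_polysD(1)[OF assms(2)]]) (use assms(1) in simp)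
  moreover have "size m < Suc s" if "indexed_pmult g i m \<noteq> \<zero>" for m
  proof -
    have "i \<in># m" "g (m - {#i#}) \<noteq> \<zero>" using that by (auto simp: indexed_pmult_def split: if_splits)
    then show ?thesis using subfield_polysD(3)[OF assms(2), of "m - {#i#}"] by (simp add: size_Diff_singleton)
  qed
  ultimately show ?thesis
    using subfield_ringE(2) assms
    by (auto simp: subfield_polys_def indexed_pmult_def)
qed

lemma subfield_polys_mono:
  "g \<in> subfield_polys k d s \<Longrightarrow> s \<le> s' \<Longrightarrow> g \<in> subfield_polys k d s'"
  by (force simp: subfield_polys_def)

lemma subfield_funcset: "u \<in> I \<rightarrow> k \<Longrightarrow> u \<in> I \<rightarrow> carrier R"
  using subfieldE(3)[OF k] by blast

lemma monom_val_subfield: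
  assumes u: "u \<in> I \<rightarrow> k" and m: "set_mset m \<subseteq> I"
  shows "monom_val u m \<in> k"
  using m
proof (induction m)
  case empty
  then show ?case using subfield_ringE(3) by simp
next
  case (add i m)
  then show ?case
    using monom_val_add_mset[OF subfield_funcset[OF u], of m i] u
      subfield_ringE(6) by auto
qed

lemma mpoly_eval_subfield:
  assumes u: "u \<in> I \<rightarrow> k" and g: "g \<in> mpolys I" and gk: "\<And>m. g m \<in> k"
  shows "peval g u \<in> k"
  using g
proof (induction rule: mpolys_monom_induct)
  case zero
  then show ?case using subfield_ringE(2) by (simp add: mpoly_eval_const)
next
  case (add h m)
  have m: "set_mset m \<subseteq> I" and c: "g m \<in> carrier R"
    using mpolys_support[OF g add(2)] mpolys_coeff[OF g] by auto
  note uc = subfield_funcset[OF u]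
  show ?case
    using mpoly_eval_padd[OF uc mpoly_monom_closed[OF c m] add(1)] mpoly_eval_monom[OF uc c m]
      subfield_ringE(6,7) gk monom_val_subfield[OF u m] add(3) by simp
qed

text \<open>A product of linear factors \<open>x\<^sub>i - b\<^sub>i\<close>, one for each \<open>b \<in> B\<close>, with \<open>i\<close> a coordinate
  separating \<open>a\<close> from \<open>b\<close>.\<close>

lemma ex_separating_poly:
  assumes "finite B" and a: "a \<in> {..<d} \<rightarrow> k"
    and B: "\<And>b. b \<in> B \<Longrightarrow> b \<in> {..<d} \<rightarrow> k" "\<And>b. b \<in> B \<Longrightarrow> \<exists>i<d. b i \<noteq> a i"
  shows "\<exists>g\<in>subfield_polys k d (Suc (card B)).
           peval g a \<noteq> \<zero> \<and> (\<forall>b\<in>B. peval g b = \<zero>)"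
  using assms(1,3,4)
proof (induction B)
  case empty
  then show ?case
    using subfield_polys_one[of 1 d] by (intro bexI[of _ "indexed_const \<one>"]) (auto simp: mpoly_eval_const)
next
  case (insert b B)
  obtain g where g: "g \<in> subfield_polys k d (Suc (card B))" and ga: "peval g a \<noteq> \<zero>"
    and gB: "\<forall>b\<in>B. peval g b = \<zero>"
    using insert.IH insert.prems by blast
  obtain i where i: "i < d" "b i \<noteq> a i" using insert.prems(2) by blast
  have bk: "b \<in> {..<d} \<rightarrow> k" using insert.prems(1) by blast
  have nb: "\<ominus> b i \<in> k" using bk i subfield_ringE(5) by auto
  let ?h = "indexed_padd (indexed_pmult g i) (\<lambda>m. \<ominus> b i \<otimes> g m)"
  have gm: "g \<in> mpolys {..<d}" by (rule subfield_polysD(1)[OF g])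
  have sm: "(\<lambda>m. \<ominus> b i \<otimes> g m) \<in> subfield_polys k d (Suc (card B))"
    by (rule subfield_polys_smult[OF nb g])
  have h: "?h \<in> subfield_polys k d (Suc (Suc (card B)))"
    by (intro subfield_polys_padd subfield_polys_pmult[OF i(1) g] subfield_polys_mono[OF sm]) simp
  have ev: "peval ?h x = (x i \<ominus> b i) \<otimes> peval g x" if x: "x \<in> {..<d} \<rightarrow> k" for x
  proof -
    note xc = subfield_funcset[OF x]
    have c: "x i \<in> carrier R" "b i \<in> carrier R" "peval g x \<in> carrier R"
      using xc subfield_funcset[OF bk] i mpoly_eval_closed[OF xc gm] by auto
    have iI: "i \<in> {..<d}" using i by simp
    have "peval ?h x = x i \<otimes> peval g x \<oplus> \<ominus> b i \<otimes> peval g x"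
      using mpoly_eval_padd[OF xc indexed_pset.indexed_pmult[OF gm iI] subfield_polysD(1)[OF sm]]
        mpoly_eval_pmult[OF xc gm iI] mpoly_eval_smult[OF xc _ gm, of "\<ominus> b i"] c by simp
    also have "\<dots> = (x i \<ominus> b i) \<otimes> peval g x"
      unfolding a_minus_def by (rule l_distr[symmetric]) (use c in auto)
    finally show ?thesis .
  qed
  have cl: "x i \<in> carrier R" "peval g x \<in> carrier R" if "x \<in> {..<d} \<rightarrow> k" for x
    using subfield_funcset[OF that] i mpoly_eval_closed[OF _ gm] by auto
  have "a i \<ominus> b i \<noteq> \<zero>" using i cl(1)[OF a] cl(1)[OF bk] by simp
  then have "peval ?h a \<noteq> \<zero>"
    unfolding ev[OF a] using ga cl[OF a] cl(1)[OF bk] by (simp add: integral_iff)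
  moreover have "peval ?h x = \<zero>" if x: "x \<in> insert b B" for x
  proof -
    have xk: "x \<in> {..<d} \<rightarrow> k" using insert.prems(1) x by blast
    show ?thesis
    proof (cases "x = b")
      case True
      then show ?thesis unfolding ev[OF xk] using cl[OF bk] by (simp add: a_minus_def r_neg)
    next
      case False
      then show ?thesis unfolding ev[OF xk] using x gB cl(1)[OF xk] cl(1)[OF bk] by simp
    qed
  qed
  ultimately show ?case using h insert.hyps by (intro bexI[of _ ?h]) auto
qed

lemma ex_interpolating_poly:
  assumes "finite A" "card A \<le> s" and A: "A \<subseteq> {..<d} \<rightarrow> k"
    and sep: "\<And>a b. a \<in> A \<Longrightarrow> b \<in> A \<Longrightarrow> a \<noteq> b \<Longrightarrow> \<exists>i<d. a i \<noteq> b i"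
    and y: "y \<in> A \<rightarrow> k"
  shows "\<exists>g\<in>subfield_polys k d s. \<forall>a\<in>A. peval g a = y a"
proof -
  have yc: "y \<in> A \<rightarrow> carrier R" by (rule subfield_funcset[OF y])
  have delta: "\<exists>g\<in>subfield_polys k d s. peval g a = y a \<and> (\<forall>b\<in>A - {a}. peval g b = \<zero>)"
    if a: "a \<in> A" for a
  proof -
    have ak: "a \<in> {..<d} \<rightarrow> k" using A a by blast
    have "\<exists>g\<in>subfield_polys k d (Suc (card (A - {a}))).
        peval g a \<noteq> \<zero> \<and> (\<forall>b\<in>A - {a}. peval g b = \<zero>)"
      by (rule ex_separating_poly[OF _ ak]) (use assms(1) A sep a in auto)
    moreover have "Suc (card (A - {a})) = card A" using card_Suc_Diff1[OF assms(1) a] .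
    ultimately obtain g where g: "g \<in> subfield_polys k d (card A)" "peval g a \<noteq> \<zero>"
      "\<forall>b\<in>A - {a}. peval g b = \<zero>" by auto
    have gs: "g \<in> subfield_polys k d s" by (rule subfield_polys_mono[OF g(1) assms(2)])
    note gm = subfield_polysD(1)[OF gs]
    have ek: "peval g a \<in> k - {\<zero>}"
      using mpoly_eval_subfield[OF ak gm] subfield_polysD(2)[OF gs] g(2) by blast
    have inv: "inv (peval g a) \<in> k" "peval g a \<otimes> inv (peval g a) = \<one>"
      using subfield_m_inv[OF k ek] by auto
    let ?c = "y a \<otimes> inv (peval g a)"
    have ck: "?c \<in> k" using y a inv(1) subfield_ringE(6) by auto
    have cc: "?c \<in> carrier R" "inv (peval g a) \<in> carrier R" "y a \<in> carrier R"
      "peval g a \<in> carrier R"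
      using ck inv(1) ek subfieldE(3)[OF k] yc a by auto
    have ev: "peval (\<lambda>m. ?c \<otimes> g m) b = ?c \<otimes> peval g b" if "b \<in> A" for b
      by (rule mpoly_eval_smult[OF subfield_funcset cc(1) gm]) (use that A in blast)
    have "peval (\<lambda>m. ?c \<otimes> g m) a = y a"
      unfolding ev[OF a] using cc inv(2) m_comm[OF cc(2,4)] by (simp add: m_assoc)
    moreover have "peval (\<lambda>m. ?c \<otimes> g m) b = \<zero>" if "b \<in> A - {a}" for b
      using ev[of b] that g(3) cc(1) by simp
    ultimately show ?thesis using subfield_polys_smult[OF ck gs] by blast
  qed
  have "\<exists>g\<in>subfield_polys k d s. \<forall>a\<in>A. peval g a = (if a \<in> C then y a else \<zero>)"
    if "finite C" "C \<subseteq> A" for C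
    using that
  proof (induction C)
    case empty
    show ?case using subfield_polys_zero by (intro bexI[of _ "indexed_const \<zero>"]) (auto simp: mpoly_eval_const)
  next
    case (insert c C)
    obtain g where g: "g \<in> subfield_polys k d s"
      "\<forall>a\<in>A. peval g a = (if a \<in> C then y a else \<zero>)"
      using insert by auto
    obtain h where h: "h \<in> subfield_polys k d s" "peval h c = y c"
      "\<forall>b\<in>A - {c}. peval h b = \<zero>"
      using delta[of c] insert by auto
    have "peval (indexed_padd g h) a = (if a \<in> insert c C then y a else \<zero>)" if a: "a \<in> A" for a
    proof -
      have "a \<in> {..<d} \<rightarrow> carrier R" using subfield_funcset A a by blast
      from mpoly_eval_padd[OF this subfield_polysD(1)[OF g(1)] subfield_polysD(1)[OF h(1)]]
      show ?thesis using g(2) h(2,3) a yc insert.hyps(2) by (cases "a = c") (auto simp: Pi_iff)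
    qed
    then show ?case using subfield_polys_padd[OF g(1) h(1)] by blast
  qed
  from this[OF assms(1) subset_refl] show ?thesis by simp
qed

end

end

subsection \<open>The family of graphs over a finite subfield\<close>

context field
begin

lemma graph_variety_eq_iff:
  assumes F: "F \<in> mpolys {..<d}" and G: "G \<in> mpolys {..<d}" and d: "d < D"
  shows "graph_variety d D F = graph_variety d D G
     \<longleftrightarrow> (\<forall>u\<in>{..<d} \<rightarrow> carrier R. peval F u = peval G u)"
proof
  assume eq: "graph_variety d D F = graph_variety d D G"
  show "\<forall>u\<in>{..<d} \<rightarrow> carrier R. peval F u = peval G u"
  proof
    fix u assume u: "u \<in> {..<d} \<rightarrow> carrier R"
    let ?x = "graph_point d D F u"
    have "?x \<in> graph_variety d D G" using graph_point_in[OF F d u] eq by simp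
    then have "?x d = peval G ?x" by (simp add: graph_variety_def)
    moreover have "peval G u = peval G ?x"
      by (rule mpoly_eval_cong[OF u _ G]) (use d in \<open>auto simp: graph_point_def\<close>)
    ultimately show "peval F u = peval G u" using d by (simp add: graph_point_def)
  qed
next
  assume eq: "\<forall>u\<in>{..<d} \<rightarrow> carrier R. peval F u = peval G u"
  have "peval F x = peval G x" if "x \<in> affine_space (carrier R) D" for x
  proof -
    have "x \<in> {..<d} \<rightarrow> carrier R" using that d by (force simp: PiE_def)
    then show ?thesis using eq by simp
  qed
  then show "graph_variety d D F = graph_variety d D G"
    unfolding graph_variety_def by (intro Collect_cong) auto
qed

definition graph_family :: "'a set \<Rightarrow> nat \<Rightarrow> nat \<Rightarrow> nat \<Rightarrow> (nat \<Rightarrow> 'a) set set" where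
  "graph_family k d D s = (\<lambda>g. graph_variety d D (add_top_power s g)) ` subfield_polys k d s"

definition flat_points :: "'a set \<Rightarrow> nat \<Rightarrow> nat \<Rightarrow> (nat \<Rightarrow> 'a) set" where
  "flat_points k d D = {x \<in> affine_space k D. \<forall>j\<in>{d<..<D}. x j = \<zero>}"

context
  fixes k :: "'a set" and d D s :: nat
  assumes k: "subfield k R" and fk: "finite k" and d: "0 < d" "d < D" and s: "0 < s"
begin

abbreviation "graphs \<equiv> graph_family k d D s"
abbreviation "flat \<equiv> flat_points k d D"
abbreviation "coeff_polys \<equiv> subfield_polys k d s"

lemma subfield_zero: "\<zero> \<in> k"
  using subfield_ringE(2)[OF k] .

lemma flat_points_eq:
  "flat = (\<lambda>u. \<lambda>i\<in>{..<D}. if i \<le> d then u i else \<zero>) ` ({..d} \<rightarrow>\<^sub>E k)"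
proof (intro subset_antisym subsetI)
  fix x assume x: "x \<in> flat"
  then have xk: "x \<in> {..<D} \<rightarrow>\<^sub>E k" and x0: "\<And>j. d < j \<Longrightarrow> j < D \<Longrightarrow> x j = \<zero>"
    by (auto simp: flat_points_def)
  have "x = (\<lambda>i\<in>{..<D}. if i \<le> d then restrict x {..d} i else \<zero>)"
    using x0 PiE_arb[OF xk] by (auto simp: fun_eq_iff)
  moreover have "restrict x {..d} \<in> {..d} \<rightarrow>\<^sub>E k" using xk d by (force simp: PiE_def)
  ultimately show "x \<in> (\<lambda>u. \<lambda>i\<in>{..<D}. if i \<le> d then u i else \<zero>) ` ({..d} \<rightarrow>\<^sub>E k)" by blast
next
  fix x assume "x \<in> (\<lambda>u. \<lambda>i\<in>{..<D}. if i \<le> d then u i else \<zero>) ` ({..d} \<rightarrow>\<^sub>E k)"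
  then show "x \<in> flat" using subfield_zero by (auto simp: flat_points_def PiE_def extensional_def)
qed

lemma card_flat_points: "card (flat) = card k ^ Suc d"
proof -
  have "inj_on (\<lambda>u. \<lambda>i\<in>{..<D}. if i \<le> d then u i else \<zero>) ({..d} \<rightarrow>\<^sub>E k)"
  proof (rule inj_onI)
    fix u v assume u: "u \<in> {..d} \<rightarrow>\<^sub>E k" and v: "v \<in> {..d} \<rightarrow>\<^sub>E k"
      and eq: "(\<lambda>i\<in>{..<D}. if i \<le> d then u i else \<zero>) = (\<lambda>i\<in>{..<D}. if i \<le> d then v i else \<zero>)"
    show "u = v"
    proof (rule PiE_ext[OF u v])
      fix i assume "i \<in> {..d}"
      then show "u i = v i" using fun_cong[OF eq, of i] d by simp
    qed
  qed
  then show ?thesis unfolding flat_points_eq by (simp add: card_image card_PiE)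
qed

lemma finite_flat_points: "finite (flat)"
  unfolding flat_points_eq using fk by (intro finite_imageI finite_PiE) auto

lemma finite_graph_family: "finite (graphs)"
  unfolding graph_family_def by (intro finite_imageI finite_subfield_polys fk)

lemma graph_family_mem:
  assumes "V \<in> graphs"
  obtains g where "g \<in> coeff_polys" "V = graph_variety d D (add_top_power s g)"
  using assms by (auto simp: graph_family_def)

lemma top_power_eval:
  assumes g: "g \<in> coeff_polys" and u: "u \<in> {..<d} \<rightarrow> carrier R"
  shows "peval (add_top_power s g) u = u 0 [^] s \<oplus> peval g u"
  by (rule mpoly_eval_add_top_power[OF d(1) u subfield_polysD(1)[OF g]])

lemma graph_eq_iff:
  assumes g: "g \<in> coeff_polys" and h: "h \<in> coeff_polys"
  shows "graph_variety d D (add_top_power s g) = graph_variety d D (add_top_power s h)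
    \<longleftrightarrow> (\<forall>u\<in>{..<d} \<rightarrow> carrier R. peval g u = peval h u)"
proof -
  have "peval (add_top_power s g) u = peval (add_top_power s h) u
      \<longleftrightarrow> peval g u = peval h u" if u: "u \<in> {..<d} \<rightarrow> carrier R" for u
  proof -
    have "u 0 \<in> carrier R" using u d by auto
    then show ?thesis
      unfolding top_power_eval[OF g u] top_power_eval[OF h u]
      using mpoly_eval_closed[OF u subfield_polysD(1)[OF g]] mpoly_eval_closed[OF u subfield_polysD(1)[OF h]]
      by simp
  qed
  then show ?thesis
    unfolding graph_variety_eq_iff[OF add_top_power_closed[OF d(1) subfield_polysD(1)[OF g]]
        add_top_power_closed[OF d(1) subfield_polysD(1)[OF h]] d(2)]
    by blast
qed

lemma flat_points_base: "x \<in> flat \<Longrightarrow> x \<in> {..<d} \<rightarrow> k"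
  using d by (auto simp: flat_points_def PiE_def Pi_def)

lemma mem_graph_iff:
  assumes x: "x \<in> flat"
  shows "x \<in> graph_variety d D F \<longleftrightarrow> x d = peval F x"
proof -
  have "x \<in> affine_space (carrier R) D"
    using x subfieldE(3)[OF k] by (force simp: flat_points_def PiE_def)
  then show ?thesis using x by (auto simp: flat_points_def graph_variety_def)
qed

lemma card_flat_points_graph:
  assumes V: "V \<in> graphs"
  shows "card (flat \<inter> V) = card k ^ d"
proof -
  obtain g where g: "g \<in> coeff_polys" and Vg: "V = graph_variety d D (add_top_power s g)"
    using graph_family_mem[OF V] by blast
  let ?F = "add_top_power s g"
  note F = add_top_power_closed[OF d(1) subfield_polysD(1)[OF g], of s]
  have ek: "peval ?F u \<in> k" if u: "u \<in> {..<d} \<rightarrow> k" for u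
  proof -
    have "monom_val u (replicate_mset s 0) \<in> k" by (rule monom_val_subfield[OF k u]) (use d in auto)
    moreover have "u 0 \<in> carrier R" using subfield_funcset[OF k u] d by auto
    ultimately have "u 0 [^] s \<in> k" using monom_val_replicate[of u 0 s] by simp
    then have "u 0 [^] s \<oplus> peval g u \<in> k" if "peval g u \<in> k"
      using that by (rule subfield_ringE(7)[OF k])
    moreover have "peval g u \<in> k"
      by (rule mpoly_eval_subfield[OF k u]) (use subfield_polysD[OF g] in auto)
    ultimately show ?thesis unfolding top_power_eval[OF g subfield_funcset[OF k u]] by blast
  qed
  have "flat \<inter> V = graph_point d D ?F ` ({..<d} \<rightarrow>\<^sub>E k)"
  proof (intro subset_antisym subsetI)
    fix x assume x: "x \<in> flat \<inter> V"
    then have base: "x \<in> {..<d} \<rightarrow> k" using flat_points_base by blast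
    have "x = graph_point d D ?F x" using graph_variety_eq_graph_point[OF F d(2)] x Vg by blast
    also have "\<dots> = graph_point d D ?F (restrict x {..<d})"
      using mpoly_eval_cong[OF subfield_funcset[OF k base] _ F, of "restrict x {..<d}"]
      by (auto simp: graph_point_def)
    finally show "x \<in> graph_point d D ?F ` ({..<d} \<rightarrow>\<^sub>E k)" using base by auto
  next
    fix x assume "x \<in> graph_point d D ?F ` ({..<d} \<rightarrow>\<^sub>E k)"
    then obtain u where u: "u \<in> {..<d} \<rightarrow> k" "x = graph_point d D ?F u" by (auto simp: PiE_def)
    then show "x \<in> flat \<inter> V"
      using graph_point_in[OF F d(2) subfield_funcset[OF k u(1)]] ek[OF u(1)] Vg subfield_zero
      by (auto simp: flat_points_def graph_point_def)
  qed
  moreover have "inj_on (graph_point d D ?F) ({..<d} \<rightarrow>\<^sub>E k)"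
  proof (rule inj_onI)
    fix u v assume u: "u \<in> {..<d} \<rightarrow>\<^sub>E k" and v: "v \<in> {..<d} \<rightarrow>\<^sub>E k"
      and eq: "graph_point d D ?F u = graph_point d D ?F v"
    show "u = v"
    proof (rule PiE_ext[OF u v])
      fix i assume "i \<in> {..<d}"
      then show "u i = v i" using fun_cong[OF eq, of i] d by (simp add: graph_point_def)
    qed
  qed
  ultimately show ?thesis by (simp add: card_image card_PiE)
qed

text \<open>Adding to \<open>g\<close> an interpolating polynomial with prescribed values on \<open>A\<close> embeds the product of
  the members through \<open>A\<close> and the value vectors \<open>A \<rightarrow> k\<close> into the family.\<close>

lemma card_graphs_through_le:
  assumes A: "A \<subseteq> flat" "card A = s"
  shows "card {V \<in> graphs. A \<subseteq> V} * card k ^ s \<le> card (graphs)"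
proof (cases "\<forall>a\<in>A. \<forall>b\<in>A. a \<noteq> b \<longrightarrow> (\<exists>i<d. a i \<noteq> b i)")
  case False
  then obtain a b where ab: "a \<in> A" "b \<in> A" "a \<noteq> b" and base: "\<And>i. i < d \<Longrightarrow> a i = b i" by blast
  have "\<not> A \<subseteq> V" if V: "V \<in> graphs" for V
  proof
    assume AV: "A \<subseteq> V"
    obtain g where g: "g \<in> coeff_polys" and Vg: "V = graph_variety d D (add_top_power s g)"
      using graph_family_mem[OF V] by blast
    note F = add_top_power_closed[OF d(1) subfield_polysD(1)[OF g], of s]
    have "a \<in> {..<d} \<rightarrow> carrier R" using subfield_funcset[OF k flat_points_base] A ab by blast
    then have ev: "peval (add_top_power s g) a = peval (add_top_power s g) b"
      by (rule mpoly_eval_cong[OF _ _ F]) (use base in auto)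
    have "a = graph_point d D (add_top_power s g) a" "b = graph_point d D (add_top_power s g) b"
      using graph_variety_eq_graph_point[OF F d(2)] ab AV Vg by blast+
    moreover have "graph_point d D (add_top_power s g) a = graph_point d D (add_top_power s g) b"
      using ev base by (auto simp: graph_point_def)
    ultimately show False using ab(3) by simp
  qed
  then have none: "{V \<in> graphs. A \<subseteq> V} = {}" by blast
  show ?thesis unfolding none by simp
next
  case sep: True
  let ?X = "{V \<in> graphs. A \<subseteq> V}"
  let ?gr = "\<lambda>g. graph_variety d D (add_top_power s g)"
  have finA: "finite A" using A s by (intro card_ge_0_finite) simp
  have Ak: "A \<subseteq> {..<d} \<rightarrow> k" using A(1) flat_points_base by blast
  have Ac: "a \<in> {..<d} \<rightarrow> carrier R" if "a \<in> A" for a using subfield_funcset[OF k] Ak that by blast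
  define poly where "poly V = (SOME g. g \<in> coeff_polys \<and> V = ?gr g)" for V
  have poly: "poly V \<in> coeff_polys" "V = ?gr (poly V)" if "V \<in> graphs" for V
    using someI_ex[of "\<lambda>g. g \<in> coeff_polys \<and> V = ?gr g"] that
    unfolding poly_def graph_family_def by blast+
  define interp where "interp y = (SOME g. g \<in> coeff_polys \<and> (\<forall>a\<in>A. peval g a = y a))" for y
  have interp: "interp y \<in> coeff_polys" "\<forall>a\<in>A. peval (interp y) a = y a"
    if "y \<in> A \<rightarrow>\<^sub>E k" for y
  proof -
    have "\<exists>g. g \<in> coeff_polys \<and> (\<forall>a\<in>A. peval g a = y a)"
      using ex_interpolating_poly[OF k finA _ Ak, of s y] sep A(2) that by (auto simp: PiE_def)
    from someI_ex[OF this] show "interp y \<in> coeff_polys" "\<forall>a\<in>A. peval (interp y) a = y a"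
      unfolding interp_def by blast+
  qed
  define \<Phi> where "\<Phi> = (\<lambda>(V, y). ?gr (indexed_padd (poly V) (interp y)))"
  have padd: "indexed_padd (poly V) (interp y) \<in> coeff_polys"
    if "V \<in> graphs" "y \<in> A \<rightarrow>\<^sub>E k" for V y
    by (rule subfield_polys_padd[OF k poly(1)[OF that(1)] interp(1)[OF that(2)]])
  have padd_eval: "peval (indexed_padd (poly V) (interp y)) u
      = peval (poly V) u \<oplus> peval (interp y) u"
    if "V \<in> graphs" "y \<in> A \<rightarrow>\<^sub>E k" "u \<in> {..<d} \<rightarrow> carrier R" for V y u
    by (rule mpoly_eval_padd[OF that(3)])
      (use subfield_polysD(1)[OF poly(1)[OF that(1)]] subfield_polysD(1)[OF interp(1)[OF that(2)]] in auto)
  have closed: "peval (poly V) u \<in> carrier R" "peval (interp y) u \<in> carrier R"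
    if "V \<in> graphs" "y \<in> A \<rightarrow>\<^sub>E k" "u \<in> {..<d} \<rightarrow> carrier R" for V y u
    using mpoly_eval_closed[OF that(3) subfield_polysD(1)[OF poly(1)[OF that(1)]]]
      mpoly_eval_closed[OF that(3) subfield_polysD(1)[OF interp(1)[OF that(2)]]] .
  have on_A: "peval (poly V) a = peval (poly V') a"
    if V: "V \<in> ?X" and V': "V' \<in> ?X" and a: "a \<in> A" for V V' a
  proof -
    have ad: "a d = a 0 [^] s \<oplus> peval (poly V) a" if "V \<in> ?X" for V
    proof -
      have Vf: "V \<in> graphs" and aV: "a \<in> ?gr (poly V)"
        using that a poly(2)[of V] by auto
      then show ?thesis
        using mem_graph_iff A(1) a top_power_eval[OF poly(1)[OF Vf] Ac[OF a]] by auto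
    qed
    from ad[OF V] ad[OF V'] have "a 0 [^] s \<oplus> peval (poly V) a = a 0 [^] s \<oplus> peval (poly V') a"
      by (rule trans[OF sym])
    moreover have "a 0 \<in> carrier R" using Ac[OF a] d by auto
    moreover have "peval (poly V) a \<in> carrier R" "peval (poly V') a \<in> carrier R"
      using mpoly_eval_closed[OF Ac[OF a] subfield_polysD(1)[OF poly(1)]] V V' by auto
    ultimately show ?thesis by simp
  qed
  have "inj_on \<Phi> (?X \<times> (A \<rightarrow>\<^sub>E k))"
  proof (rule inj_onI, clarify)
    fix V y V' y' assume V: "V \<in> graphs" "A \<subseteq> V" and V': "V' \<in> graphs" "A \<subseteq> V'"
      and y: "y \<in> A \<rightarrow>\<^sub>E k" and y': "y' \<in> A \<rightarrow>\<^sub>E k" and eq: "\<Phi> (V, y) = \<Phi> (V', y')"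
    have ev: "peval (poly V) u \<oplus> peval (interp y) u
        = peval (poly V') u \<oplus> peval (interp y') u"
      if u: "u \<in> {..<d} \<rightarrow> carrier R" for u
      using eq u graph_eq_iff[OF padd[OF V(1) y] padd[OF V'(1) y']]
        padd_eval[OF V(1) y u] padd_eval[OF V'(1) y' u] by (simp add: \<Phi>_def)
    have yy: "y = y'"
    proof (rule PiE_ext[OF y y'])
      fix a assume a: "a \<in> A"
      note c = closed[OF V(1) y Ac[OF a]] closed[OF V'(1) y' Ac[OF a]]
      have "peval (interp y) a = peval (interp y') a"
        using ev[OF Ac[OF a]] on_A[of V V' a] V V' a c by simp
      then show "y a = y' a" using interp(2)[OF y] interp(2)[OF y'] a by simp
    qed
    have "peval (poly V) u = peval (poly V') u" if u: "u \<in> {..<d} \<rightarrow> carrier R" for u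
      using ev[OF u] closed[OF V(1) y u] closed[OF V'(1) y' u] yy by simp
    then have "?gr (poly V) = ?gr (poly V')"
      unfolding graph_eq_iff[OF poly(1)[OF V(1)] poly(1)[OF V'(1)]] by blast
    then show "V = V' \<and> y = y'" using poly(2)[OF V(1)] poly(2)[OF V'(1)] yy by simp
  qed
  moreover have "\<Phi> ` (?X \<times> (A \<rightarrow>\<^sub>E k)) \<subseteq> graphs"
    using padd by (auto simp: \<Phi>_def graph_family_def)
  ultimately have "card (?X \<times> (A \<rightarrow>\<^sub>E k)) \<le> card (graphs)"
    by (rule card_inj_on_le) (rule finite_graph_family)
  then show ?thesis using finA A(2) by (simp add: card_cartesian_product card_PiE)
qed

lemma card_graph_family_ge:
  assumes ds: "s \<le> card k ^ d"
  shows "card k ^ s \<le> card (graphs)"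
proof -
  let ?V = "graph_variety d D (add_top_power s (indexed_const \<zero>))"
  have V: "?V \<in> graphs"
    using subfield_polys_zero[OF k] by (auto simp: graph_family_def)
  have "s \<le> card (flat \<inter> ?V)" unfolding card_flat_points_graph[OF V] by (rule ds)
  then obtain A where A: "A \<subseteq> flat \<inter> ?V" "card A = s"
    by (rule obtain_subset_with_card_n)
  then have "?V \<in> {V \<in> graphs. A \<subseteq> V}" using V by blast
  then have "1 \<le> card {V \<in> graphs. A \<subseteq> V}"
    using finite_graph_family by (auto simp: Suc_le_eq card_gt_0_iff)
  then have "1 * card k ^ s \<le> card {V \<in> graphs. A \<subseteq> V} * card k ^ s"
    by (rule mult_right_mono) simp
  also have "\<dots> \<le> card (graphs)" by (rule card_graphs_through_le) (use A in auto)
  finally show ?thesis by simp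
qed

end

end

subsection \<open>Primes in dyadic ranges\<close>

lemma multiplicity_eq_card:
  fixes p m L :: nat
  assumes p: "Factorial_Ring.prime p" and m: "0 < m" "m < p ^ Suc L"
  shows "multiplicity p m = card {i\<in>{1..L}. p ^ i dvd m}"
proof -
  have nu: "\<not> is_unit p" using p by auto
  have iff: "p ^ i dvd m \<longleftrightarrow> i \<le> multiplicity p m" for i
    using m(1) nu by (simp add: power_dvd_iff_le_multiplicity)
  have "p ^ multiplicity p m \<le> m" using m(1) by (intro dvd_imp_le multiplicity_dvd)
  then have "p ^ multiplicity p m < p ^ Suc L" using m(2) by linarith
  then have "multiplicity p m < Suc L" using prime_gt_1_nat[OF p] power_less_imp_less_exp by blast
  then have "{i\<in>{1..L}. p ^ i dvd m} = {1..multiplicity p m}" unfolding iff by auto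
  then show ?thesis by simp
qed

lemma Suc_div_eq:
  fixes q n :: nat
  shows "Suc n div q = n div q + (if q dvd Suc n then 1 else 0)"
  by (simp add: div_Suc mod_eq_0_iff_dvd)

lemma multiplicity_fact:
  fixes p n L :: nat
  assumes p: "Factorial_Ring.prime p" and n: "n < p ^ Suc L"
  shows "multiplicity p (fact n) = (\<Sum>i\<in>{1..L}. n div p ^ i)"
  using n
proof (induction n)
  case (Suc n)
  have "multiplicity p (fact (Suc n) :: nat) = multiplicity p (Suc n) + multiplicity p (fact n :: nat)"
    unfolding fact_Suc of_nat_id using p by (intro prime_elem_multiplicity_mult_distrib) auto
  also have "multiplicity p (fact n :: nat) = (\<Sum>i\<in>{1..L}. n div p ^ i)" using Suc by simp
  also have "multiplicity p (Suc n) = (\<Sum>i\<in>{1..L}. if p ^ i dvd Suc n then 1 else 0)"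
    using multiplicity_eq_card[OF p _ Suc.prems] by (simp add: sum.If_cases Int_def)
  also have "\<dots> + (\<Sum>i\<in>{1..L}. n div p ^ i) = (\<Sum>i\<in>{1..L}. Suc n div p ^ i)"
    unfolding sum.distrib[symmetric] by (intro sum.cong refl) (simp only: Suc_div_eq add.commute)
  finally show ?case .
qed auto

lemma prime_power_central_binomial_le:
  fixes p n :: nat
  assumes p: "Factorial_Ring.prime p" and n: "0 < n"
  shows "p ^ multiplicity p (2 * n choose n) \<le> 2 * n"
proof -
  have p1: "1 < p" using prime_gt_1_nat[OF p] .
  obtain L where L: "p ^ L \<le> 2 * n" "2 * n < p ^ Suc L"
    using ex_power_ivl1[of p "2 * n"] p1 n by auto
  have "multiplicity p (fact (2 * n) :: nat)
      = multiplicity p (fact n * (fact n * (2 * n choose n)) :: nat)"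
    using binomial_fact_lemma[of n "2 * n"] by (simp add: ac_simps)
  also have "\<dots> = 2 * multiplicity p (fact n :: nat) + multiplicity p (2 * n choose n)"
    using p by (simp add: prime_elem_multiplicity_mult_distrib)
  finally have "multiplicity p (2 * n choose n)
      = (\<Sum>i\<in>{1..L}. 2 * n div p ^ i) - 2 * (\<Sum>i\<in>{1..L}. n div p ^ i)"
    using multiplicity_fact[OF p L(2)] multiplicity_fact[OF p, of n L] L(2) by simp
  moreover have "(\<Sum>i\<in>{1..L}. 2 * n div p ^ i) \<le> (\<Sum>i\<in>{1..L}. 2 * (n div p ^ i) + 1)"
  proof (rule sum_mono)
    fix i
    have q: "0 < p ^ i" using p1 by simp
    have "n < (n div p ^ i + 1) * p ^ i" using q by (simp add: dividend_less_div_times)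
    then have "2 * n < (2 * (n div p ^ i) + 2) * p ^ i" by (simp add: algebra_simps)
    then have "2 * n div p ^ i < 2 * (n div p ^ i) + 2" using q by (simp add: div_less_iff_less_mult)
    then show "2 * n div p ^ i \<le> 2 * (n div p ^ i) + 1" by simp
  qed
  moreover have "(\<Sum>i\<in>{1..L}. 2 * (n div p ^ i) + 1) = 2 * (\<Sum>i\<in>{1..L}. n div p ^ i) + L"
    by (subst sum.distrib) (simp add: sum_distrib_left)
  ultimately have "multiplicity p (2 * n choose n) \<le> L" by linarith
  then have "p ^ multiplicity p (2 * n choose n) \<le> p ^ L" using p1 by (intro power_increasing) auto
  then show ?thesis using L by simp
qed

lemma prod_mono_subset_nat:
  fixes f :: "'a \<Rightarrow> nat"
  assumes "finite B" "A \<subseteq> B" "\<And>b. b \<in> B \<Longrightarrow> 1 \<le> f b"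
  shows "prod f A \<le> prod f B"
proof -
  have "1 \<le> prod f (B - A)" by (intro prod_ge_1) (use assms in auto)
  then show ?thesis using prod.subset_diff[OF assms(2,1), of f] by simp
qed

lemma prod_le_of_prime_dvd:
  fixes S :: "nat set" and c :: nat
  assumes c: "0 < c" and S: "\<And>p. p \<in> S \<Longrightarrow> Factorial_Ring.prime p \<and> p dvd c"
  shows "\<Prod>S \<le> c"
proof -
  have sub: "S \<subseteq> prime_factors c" using S c by (auto simp: in_prime_factors_iff)
  have "\<Prod>S \<le> \<Prod>(prime_factors c)"
    by (rule prod_mono_subset_nat[OF _ sub]) (auto simp: in_prime_factors_iff dest!: prime_ge_1_nat)
  also have "\<dots> \<le> (\<Prod>p\<in>prime_factors c. p ^ multiplicity p c)"
  proof (rule prod_mono, safe)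
    fix p assume p: "p \<in> prime_factors c"
    then have "0 < multiplicity p c" using c by (simp add: prime_factors_multiplicity)
    then show "p \<le> p ^ multiplicity p c"
      using p by (intro self_le_power) (auto simp: in_prime_factors_iff dest!: prime_ge_1_nat)
  qed
  also have "\<dots> = c" using prime_factorization_nat[of c] c by simp
  finally show ?thesis .
qed

lemma prod_primes_doubling_le: "\<Prod>{p::nat. Factorial_Ring.prime p \<and> n < p \<and> p \<le> 2 * n} \<le> 2 ^ (2 * n)"
proof -
  have "\<Prod>{p::nat. Factorial_Ring.prime p \<and> n < p \<and> p \<le> 2 * n} \<le> (2 * n choose n)"
  proof (rule prod_le_of_prime_dvd)
    fix p assume p: "p \<in> {p::nat. Factorial_Ring.prime p \<and> n < p \<and> p \<le> 2 * n}"
    then have pr: "Factorial_Ring.prime p" and ndvd: "\<not> p dvd fact n" by (auto simp: prime_dvd_fact_iff)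
    have "p dvd fact (2 * n)" using p by (simp add: prime_dvd_fact_iff)
    also have "fact (2 * n) = fact n * fact n * (2 * n choose n)"
      using binomial_fact_lemma[of n "2 * n"] by simp
    finally show "Factorial_Ring.prime p \<and> p dvd (2 * n choose n)"
      using pr ndvd by (simp add: prime_dvd_mult_iff)
  qed simp
  also have "\<dots> \<le> 2 ^ (2 * n)" by (rule binomial_le_pow2)
  finally show ?thesis .
qed

lemma primorial_dyadic_le: "\<Prod>{p::nat. Factorial_Ring.prime p \<and> p \<le> 2 ^ k} \<le> 2 ^ 2 ^ Suc k"
proof (induction k)
  case 0
  have eq: "{p::nat. Factorial_Ring.prime p \<and> p \<le> 2 ^ 0} = {}" by (auto dest: prime_gt_1_nat)
  show ?case unfolding eq by simp
next
  case (Suc k)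
  let ?n = "2 ^ k :: nat"
  let ?A = "{p::nat. Factorial_Ring.prime p \<and> p \<le> ?n}" and ?B = "{p::nat. Factorial_Ring.prime p \<and> ?n < p \<and> p \<le> 2 * ?n}"
  have "?n < 2 * ?n" by simp
  then have eq: "{p::nat. Factorial_Ring.prime p \<and> p \<le> 2 ^ Suc k} = ?A \<union> ?B" by auto
  have "\<Prod>(?A \<union> ?B) = \<Prod>?A * \<Prod>?B"
    by (rule prod.union_disjoint) auto
  also have "\<dots> \<le> 2 ^ 2 ^ Suc k * 2 ^ (2 * ?n)"
    by (intro mult_mono Suc prod_primes_doubling_le) auto
  also have "\<dots> = 2 ^ 2 ^ Suc (Suc k)" by (simp flip: power_add)
  finally show ?case unfolding eq .
qed

lemma mult_16_less_power2:
  fixes i :: nat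
  assumes "7 \<le> i"
  shows "16 * i < 2 ^ i"
  using assms by (induction i rule: dec_induct) auto

lemma ex_prime_dyadic:
  fixes k :: nat
  assumes k: "10 \<le> k"
  obtains p :: nat where "Factorial_Ring.prime p" "2 ^ k < p" "p \<le> 2 ^ (k + 4)"
proof (rule ccontr)
  assume "\<not> thesis"
  then have none: "\<And>p::nat. Factorial_Ring.prime p \<Longrightarrow> p \<le> 2 ^ (k + 4) \<Longrightarrow> p \<le> 2 ^ k"
    using that by (meson not_le)
  define n :: nat where "n = 2 ^ (k + 3)"
  define c where "c = 2 * n choose n"
  define j where "j = (k + 5) div 2"
  define A where "A = {p \<in> prime_factors c. p\<^sup>2 \<le> 2 * n}"
  have n0: "0 < n" and N: "2 * n = 2 ^ (k + 4)" by (simp_all add: n_def eval_nat_numeral)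
  have c0: "0 < c" by (simp add: c_def)
  have le: "p ^ multiplicity p c \<le> 2 * n" if "p \<in> prime_factors c" for p
    using that prime_power_central_binomial_le[OF _ n0] by (auto simp: c_def in_prime_factors_iff)
  have mpos: "0 < multiplicity p c" if "p \<in> prime_factors c" for p
    using that by (simp add: prime_factors_multiplicity)
  have sm: "p \<le> 2 ^ k" "Factorial_Ring.prime p" if p: "p \<in> prime_factors c" for p
  proof -
    show pr: "Factorial_Ring.prime p" using p by (auto simp: in_prime_factors_iff)
    have "p \<le> p ^ multiplicity p c"
      using prime_ge_1_nat[OF pr] mpos[OF p] by (intro self_le_power) auto
    then show "p \<le> 2 ^ k" using le[OF p] N pr by (intro none) auto
  qed
  have cA: "card A \<le> 2 ^ j"
  proof -
    have "p \<in> {1..2 ^ j}" if "p \<in> A" for p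
    proof -
      have "p\<^sup>2 \<le> 2 ^ (k + 4)" using that N by (simp add: A_def)
      also have "\<dots> \<le> 2 ^ (j * 2)" unfolding j_def by (intro power_increasing) auto
      finally have "p\<^sup>2 \<le> (2 ^ j)\<^sup>2" by (simp add: power_mult)
      then have "p \<le> 2 ^ j" by (simp add: power2_nat_le_eq_le)
      then show ?thesis using that prime_ge_1_nat[OF sm(2)] by (auto simp: A_def)
    qed
    then have "A \<subseteq> {1..2 ^ j}" by blast
    then have "card A \<le> card {1..2 ^ j :: nat}" by (intro card_mono) auto
    then show ?thesis by simp
  qed
  have "c = (\<Prod>p\<in>prime_factors c. p ^ multiplicity p c)"
    using prime_factorization_nat c0 by blast
  also have "\<dots> = (\<Prod>p\<in>A. p ^ multiplicity p c) * (\<Prod>p\<in>prime_factors c - A. p ^ multiplicity p c)"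
    by (subst prod.subset_diff[of A]) (auto simp: A_def)
  also have "\<dots> \<le> (2 * n) ^ card A * \<Prod>(prime_factors c - A)"
  proof (intro mult_mono)
    have "(\<Prod>p\<in>A. p ^ multiplicity p c) \<le> (\<Prod>p\<in>A. 2 * n)"
      by (intro prod_mono) (use le in \<open>auto simp: A_def\<close>)
    then show "(\<Prod>p\<in>A. p ^ multiplicity p c) \<le> (2 * n) ^ card A" by simp
    show "(\<Prod>p\<in>prime_factors c - A. p ^ multiplicity p c) \<le> \<Prod>(prime_factors c - A)"
    proof (intro prod_mono conjI)
      fix p assume p: "p \<in> prime_factors c - A"
      then have "p ^ multiplicity p c < p\<^sup>2" using le[of p] by (auto simp: A_def)
      then have "multiplicity p c < 2"
        using p prime_gt_1_nat[OF sm(2)] power_less_imp_less_exp by blast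
      then have "multiplicity p c = 1" using mpos[of p] p by simp
      then show "p ^ multiplicity p c \<le> p" by simp
    qed simp
  qed auto
  also have "\<dots> \<le> (2 ^ (k + 4)) ^ 2 ^ j * 2 ^ 2 ^ Suc k"
  proof (intro mult_mono)
    show "(2 * n) ^ card A \<le> (2 ^ (k + 4)) ^ 2 ^ j"
      unfolding N using cA by (intro power_increasing) auto
    have "\<Prod>(prime_factors c - A) \<le> \<Prod>{p::nat. Factorial_Ring.prime p \<and> p \<le> 2 ^ k}"
      by (rule prod_mono_subset_nat) (use sm in \<open>auto dest: prime_ge_1_nat\<close>)
    also have "\<dots> \<le> 2 ^ 2 ^ Suc k" by (rule primorial_dyadic_le)
    finally show "\<Prod>(prime_factors c - A) \<le> 2 ^ 2 ^ Suc k" .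
  qed auto
  also have "\<dots> = 2 ^ ((k + 4) * 2 ^ j + 2 ^ Suc k)" by (simp add: power_mult power_add)
  finally have up: "c \<le> 2 ^ ((k + 4) * 2 ^ j + 2 ^ Suc k)" .
  have "(real (2 * n) / real n) ^ n \<le> real (2 * n choose n)"
    by (rule binomial_ge_n_over_k_pow_k) simp
  then have "real (2 ^ n) \<le> real c" using n0 by (simp add: c_def)
  then have "2 ^ n \<le> c" by linarith
  then have "(2::nat) ^ n \<le> 2 ^ ((k + 4) * 2 ^ j + 2 ^ Suc k)" using up by linarith
  then have main: "2 ^ (k + 3) \<le> (k + 4) * 2 ^ j + 2 ^ Suc k"
    unfolding n_def by (rule power_le_imp_le_exp[rotated]) simp
  define i where "i = k + 5 - j"
  have ij: "k + 5 = i + j" and i7: "7 \<le> i" and ki: "k + 4 \<le> 2 * i"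
    using k by (auto simp: i_def j_def)
  have "8 * ((k + 4) * 2 ^ j) \<le> 16 * i * 2 ^ j" using ki by simp
  also have "\<dots> < 2 ^ i * 2 ^ j" using mult_16_less_power2[OF i7] by simp
  also have "\<dots> = 2 ^ (k + 5)" by (simp add: ij power_add)
  also have "(2::nat) ^ (k + 5) = 8 * 2 ^ (k + 2)" by (simp add: power_add)
  finally have "(k + 4) * 2 ^ j < 2 ^ (k + 2)" by linarith
  moreover have "(2::nat) ^ (k + 3) = 2 ^ (k + 2) + 2 * 2 ^ Suc k" "(2::nat) ^ (k + 2) = 2 * 2 ^ Suc k"
    by (simp_all add: power_add)
  ultimately show False using main by linarith
qed

subsection \<open>A counting argument\<close>

lemma binomial_mult_power_le:
  fixes g r s :: nat
  assumes r: "0 < r"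
  shows "(g choose s) * r ^ s \<le> (g * r choose s)"
proof (induction s)
  case (Suc s)
  have rec: "Suc s * (a choose Suc s) = (a - s) * (a choose s)" for a :: nat
    by (metis binomial_absorb_comp binomial_absorption mult.commute)
  have "Suc s * ((g choose Suc s) * r ^ Suc s) = (Suc s * (g choose Suc s)) * (r * r ^ s)"
    by (simp only: power_Suc mult.assoc)
  also have "\<dots> = (g - s) * r * ((g choose s) * r ^ s)"
    unfolding rec by (simp only: mult_ac)
  finally have "Suc s * ((g choose Suc s) * r ^ Suc s) = (g - s) * r * ((g choose s) * r ^ s)" .
  also have "(g - s) * r * ((g choose s) * r ^ s) \<le> (g * r - s) * (g * r choose s)"
  proof (rule mult_mono[OF _ Suc])
    have "s \<le> s * r" using r by simp
    then show "(g - s) * r \<le> g * r - s" unfolding diff_mult_distrib by (rule diff_le_mono2)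
  qed auto
  also have "\<dots> = Suc s * (g * r choose Suc s)" using rec by simp
  finally show ?case unfolding Suc_mult_le_cancel1 .
qed simp

lemma card_supersets_le:
  assumes H: "finite H" and B: "B \<subseteq> H" "card B = s"
  shows "card {S. S \<subseteq> H \<and> card S = n \<and> B \<subseteq> S} \<le> (card H - s choose (n - s))"
proof -
  have fB: "finite B" using finite_subset B H by blast
  let ?X = "{S. S \<subseteq> H \<and> card S = n \<and> B \<subseteq> S}"
  have "inj_on (\<lambda>S. S - B) ?X" by (rule inj_onI) blast
  moreover have "(\<lambda>S. S - B) ` ?X \<subseteq> {S. S \<subseteq> H - B \<and> card S = n - s}"
    using B fB by (auto simp: card_Diff_subset)
  moreover have "finite {S. S \<subseteq> H - B \<and> card S = n - s}"
    by (rule finite_subset[of _ "Pow (H - B)"]) (use H in auto)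
  ultimately have "card ?X \<le> card {S. S \<subseteq> H - B \<and> card S = n - s}" by (rule card_inj_on_le)
  also have "\<dots> = (card H - s choose (n - s))"
    using n_subsets[of "H - B"] H B fB by (simp add: card_Diff_subset)
  finally show ?thesis .
qed

lemma card_UN_le_mult:
  assumes "finite I" "\<And>i. i \<in> I \<Longrightarrow> card (A i) \<le> c"
  shows "card (\<Union>i\<in>I. A i) \<le> card I * c"
proof -
  have "card (\<Union>i\<in>I. A i) \<le> (\<Sum>i\<in>I. card (A i))" by (rule card_UN_le[OF assms(1)])
  also have "\<dots> \<le> (\<Sum>i\<in>I. c)" by (rule sum_mono) (rule assms(2))
  finally show ?thesis by simp
qed

text \<open>The first moment method over all \<open>n\<close>-subsets of \<open>H\<close>: if each \<open>s\<close>-set of points lies on a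
  proportion at most \<open>1 / r\<close> of the members of \<open>H\<close>, then the expected number of copies
  of \<open>K\<^sub>s\<^sub>,\<^sub>s\<close> is at most \<open>(card Q * n / r)\<^sup>s / (s!)\<^sup>2\<close>.\<close>

lemma ex_subfamily_without_bipartite:
  fixes H :: "'h set" and Q :: "'q set" and inc :: "'h \<Rightarrow> 'q set" and n r s :: nat
  assumes H: "finite H" and Q: "finite Q" and nH: "n \<le> card H" and s: "2 \<le> s" and r: "0 < r"
    and unif: "\<And>A. A \<subseteq> Q \<Longrightarrow> card A = s \<Longrightarrow> card {h \<in> H. A \<subseteq> inc h} * r \<le> card H"
    and bound: "card Q ^ s * n ^ s \<le> r ^ s"
  shows "\<exists>S\<subseteq>H. card S = n \<and>
           \<not> (\<exists>A B. A \<subseteq> Q \<and> B \<subseteq> S \<and> card A = s \<and> card B = s \<and> (\<forall>b\<in>B. A \<subseteq> inc b))"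
proof (rule ccontr)
  assume no: "\<not> ?thesis"
  let ?H = "\<lambda>A. {h \<in> H. A \<subseteq> inc h}"
  let ?As = "{A. A \<subseteq> Q \<and> card A = s}"
  let ?Bs = "\<lambda>A. {B. B \<subseteq> ?H A \<and> card B = s}"
  let ?Ss = "\<lambda>B. {S. S \<subseteq> H \<and> card S = n \<and> B \<subseteq> S}"
  let ?c = "card H - s choose (n - s)"
  have finAs: "finite ?As" by (rule finite_subset[of _ "Pow Q"]) (use Q in auto)
  have finBs: "finite (?Bs A)" for A by (rule finite_subset[of _ "Pow H"]) (use H in auto)
  have finSs: "finite (?Ss B)" for B by (rule finite_subset[of _ "Pow H"]) (use H in auto)
  have cover: "{S. S \<subseteq> H \<and> card S = n} \<subseteq> (\<Union>A\<in>?As. \<Union>B\<in>?Bs A. ?Ss B)"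
  proof
    fix S assume S: "S \<in> {S. S \<subseteq> H \<and> card S = n}"
    then obtain A B where AB: "A \<subseteq> Q" "B \<subseteq> S" "card A = s" "card B = s" "\<forall>b\<in>B. A \<subseteq> inc b"
      using no by blast
    then have "B \<in> ?Bs A" "S \<in> ?Ss B" "A \<in> ?As" using S by auto
    then show "S \<in> (\<Union>A\<in>?As. \<Union>B\<in>?Bs A. ?Ss B)" by blast
  qed
  have sn: "s \<le> n"
  proof (rule ccontr)
    assume "\<not> s \<le> n"
    obtain S where S: "S \<subseteq> H" "card S = n" using obtain_subset_with_card_n[OF nH] by blast
    then obtain B where "B \<subseteq> S" "card B = s" using no by blast
    then show False using S H card_mono[of S B] finite_subset[of S H] \<open>\<not> s \<le> n\<close> by auto
  qed
  have inner: "card (\<Union>B\<in>?Bs A. ?Ss B) * r ^ s \<le> (card H choose s) * ?c" if A: "A \<in> ?As" for A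
  proof -
    have "card (\<Union>B\<in>?Bs A. ?Ss B) \<le> card (?Bs A) * ?c"
      by (rule card_UN_le_mult[OF finBs]) (rule card_supersets_le[OF H], auto)
    also have "card (?Bs A) = (card (?H A) choose s)" using n_subsets[of "?H A" s] H by simp
    finally have "card (\<Union>B\<in>?Bs A. ?Ss B) * r ^ s \<le> ((card (?H A) choose s) * r ^ s) * ?c"
      by (simp add: mult_ac)
    also have "\<dots> \<le> (card H choose s) * ?c"
    proof (rule mult_right_mono)
      have "(card (?H A) choose s) * r ^ s \<le> (card (?H A) * r choose s)"
        by (rule binomial_mult_power_le[OF r])
      also have "\<dots> \<le> (card H choose s)" using unif[of A] A by (intro binomial_right_mono) auto
      finally show "(card (?H A) choose s) * r ^ s \<le> (card H choose s)" .
    qed simp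
    finally show ?thesis .
  qed
  have "(card H choose n) = card {S. S \<subseteq> H \<and> card S = n}" using n_subsets[OF H] by simp
  also have "\<dots> \<le> card (\<Union>A\<in>?As. \<Union>B\<in>?Bs A. ?Ss B)"
    by (rule card_mono[OF _ cover]) (use finAs finBs finSs in blast)
  also have "\<dots> \<le> (\<Sum>A\<in>?As. card (\<Union>B\<in>?Bs A. ?Ss B))" by (rule card_UN_le[OF finAs])
  finally have "(card H choose n) * r ^ s \<le> (\<Sum>A\<in>?As. card (\<Union>B\<in>?Bs A. ?Ss B) * r ^ s)"
    unfolding sum_distrib_right[symmetric] by (rule mult_right_mono) simp
  also have "\<dots> \<le> (\<Sum>A\<in>?As. (card H choose s) * ?c)" by (rule sum_mono) (rule inner)
  also have "\<dots> = (card Q choose s) * ((card H choose n) * (n choose s))"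
    using n_subsets[OF Q, of s] choose_mult[OF sn nH] by simp
  finally have "(card H choose n) * r ^ s \<le> (card H choose n) * ((card Q choose s) * (n choose s))"
    by (simp add: mult_ac)
  then have le: "r ^ s \<le> (card Q choose s) * (n choose s)" using nH by simp
  have "2 * r ^ s \<le> fact s * (fact s * r ^ s)"
  proof -
    have f: "(2::nat) \<le> fact s" using fact_mono_nat[OF s] by simp
    then have "2 * r ^ s \<le> fact s * r ^ s" by simp
    also have "\<dots> \<le> fact s * (fact s * r ^ s)" by simp
    finally show ?thesis .
  qed
  also have "\<dots> \<le> fact s * (fact s * ((card Q choose s) * (n choose s)))" using le by simp
  also have "\<dots> = ((card Q choose s) * fact s) * ((n choose s) * fact s)" by (simp add: mult_ac)
  also have "\<dots> \<le> card Q ^ s * n ^ s" by (intro mult_mono binomial_fact_pow) auto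
  also have "\<dots> \<le> r ^ s" by (rule bound)
  finally show False using r by simp
qed

lemma ex_subset_sum_ge_average:
  fixes f :: "'q \<Rightarrow> nat"
  assumes "finite Q" "m \<le> card Q"
  shows "\<exists>P\<subseteq>Q. card P = m \<and> m * sum f Q \<le> card Q * sum f P"
  using assms
proof (induction "card Q - m" arbitrary: Q)
  case 0
  then show ?case by auto
next
  case (Suc k)
  then have ne: "Q \<noteq> {}" and pos: "0 < card Q" by auto
  obtain q where q: "q \<in> Q" "\<And>x. x \<in> Q \<Longrightarrow> f q \<le> f x"
    using arg_min_least[OF Suc(3) ne, of _ f] arg_min_if_finite(1)[OF Suc(3) ne, of f] by blast
  let ?Q = "Q - {q}"
  have c: "card ?Q = card Q - 1" using q(1) by simp
  have split: "sum f Q = f q + sum f ?Q" by (rule sum.remove[OF Suc(3) q(1)])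
  have "card ?Q * f q \<le> sum f ?Q"
    using sum_bounded_below[of ?Q "f q" f] q(2) by simp
  then have "card ?Q * sum f Q \<le> Suc (card ?Q) * sum f ?Q"
    unfolding split distrib_left mult_Suc by (rule add_right_mono)
  moreover have "Suc (card ?Q) = card Q" using c pos by simp
  ultimately have step: "card ?Q * sum f Q \<le> card Q * sum f ?Q" by (simp only:)
  show ?case
  proof (cases "card ?Q = 0")
    case True
    then have "m = 0" using Suc(2) c by simp
    then show ?thesis by (intro exI[of _ "{}"]) simp
  next
    case False
    have "\<exists>P\<subseteq>?Q. card P = m \<and> m * sum f ?Q \<le> card ?Q * sum f P"
      by (rule Suc(1)) (use Suc(2,3) c in auto)
    then obtain P where P: "P \<subseteq> ?Q" "card P = m" "m * sum f ?Q \<le> card ?Q * sum f P" by blast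
    have "card ?Q * (m * sum f Q) = m * (card ?Q * sum f Q)" by simp
    also have "\<dots> \<le> m * (card Q * sum f ?Q)" using step by simp
    also have "\<dots> = card Q * (m * sum f ?Q)" by simp
    also have "\<dots> \<le> card Q * (card ?Q * sum f P)" using P(3) by simp
    also have "\<dots> = card ?Q * (card Q * sum f P)" by simp
    finally have "m * sum f Q \<le> card Q * sum f P" using False by simp
    then show ?thesis using P by blast
  qed
qed

subsection \<open>Incidences\<close>

lemma incidences_eq_sum:
  assumes "finite P" "finite \<V>"
  shows "incidences P \<V> = (\<Sum>x\<in>P. card {V \<in> \<V>. x \<in> V})"
proof -
  let ?I = "SIGMA x:P. {V \<in> \<V>. x \<in> V}"
  have "snd (incidence_graph P \<V>) = (\<lambda>(x, V). {Inl x, Inr V}) ` ?I"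
    by (auto simp: incidence_graph_def image_def)
  moreover have "inj_on (\<lambda>(x, V). {Inl x, Inr V}) ?I"
    by (auto simp: inj_on_def doubleton_eq_iff)
  ultimately have "incidences P \<V> = card ?I" by (simp add: incidences_def card_image)
  also have "\<dots> = (\<Sum>x\<in>P. card {V \<in> \<V>. x \<in> V})" using assms by (intro card_SigmaI) auto
  finally show ?thesis .
qed

lemma incidence_graph_edge_iff:
  "{a, b} \<in> snd (incidence_graph P \<V>) \<longleftrightarrow>
     (\<exists>x V. x \<in> P \<and> V \<in> \<V> \<and> x \<in> V \<and> (a = Inl x \<and> b = Inr V \<or> a = Inr V \<and> b = Inl x))"
proof -
  have "{a, b} \<in> snd (incidence_graph P \<V>)
      \<longleftrightarrow> (\<exists>x V. {a, b} = {Inl x, Inr V} \<and> x \<in> P \<and> V \<in> \<V> \<and> x \<in> V)"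
    by (simp add: incidence_graph_def)
  then show ?thesis unfolding doubleton_eq_iff by blast
qed

lemma complete_bipartite_from_point:
  assumes A: "card A = s" "Inl x \<in> A" and B: "card B = s" "0 < s"
    and edges: "\<forall>a\<in>A. \<forall>b\<in>B. {a, b} \<in> snd (incidence_graph P \<V>)"
  shows "\<exists>A B. A \<subseteq> P \<and> B \<subseteq> \<V> \<and> card A = s \<and> card B = s \<and> (\<forall>V\<in>B. A \<subseteq> V)"
proof -
  let ?A = "Inl -` A" and ?B = "Inr -` B"
  have edge: "\<exists>y V. y \<in> P \<and> V \<in> \<V> \<and> y \<in> V \<and> (a = Inl y \<and> b = Inr V \<or> a = Inr V \<and> b = Inl y)"
    if "a \<in> A" "b \<in> B" for a b
    using edges that unfolding incidence_graph_edge_iff by simp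
  have b: "\<exists>V. b = Inr V" if "b \<in> B" for b
    using edge[OF A(2) that] by auto
  have "B \<noteq> {}" using B by auto
  then obtain V0 where V0: "Inr V0 \<in> B" using b by blast
  have a: "\<exists>y. a = Inl y" if "a \<in> A" for a
    using edge[OF that V0] by auto
  have "A \<subseteq> range Inl" "B \<subseteq> range Inr" using a b by blast+
  then have "card ?A = s" "card ?B = s" using A(1) B(1) by (simp_all add: card_vimage_inj)
  moreover have inc: "y \<in> P \<and> V \<in> \<V> \<and> y \<in> V" if "y \<in> ?A" "V \<in> ?B" for y V
    using edge[of "Inl y" "Inr V"] that by simp
  moreover have "x \<in> ?A" "V0 \<in> ?B" using A(2) V0 by auto
  ultimately show ?thesis by (intro exI[of _ ?A] exI[of _ ?B]) blast
qed

lemma complete_bipartite_incidence_graph: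
  assumes "contains_complete_bipartite (incidence_graph P \<V>) s s" "0 < s"
  shows "\<exists>A B. A \<subseteq> P \<and> B \<subseteq> \<V> \<and> card A = s \<and> card B = s \<and> (\<forall>V\<in>B. A \<subseteq> V)"
proof -
  obtain A B where AB: "card A = s" "card B = s"
    and edges: "\<forall>a\<in>A. \<forall>b\<in>B. {a, b} \<in> snd (incidence_graph P \<V>)"
    using assms(1) by (auto simp: contains_complete_bipartite_def)
  have "A \<noteq> {}" "B \<noteq> {}" using AB assms(2) by auto
  then obtain a b where ab: "a \<in> A" "b \<in> B" by blast
  show ?thesis
  proof (cases a)
    case (Inl x)
    then show ?thesis
      using complete_bipartite_from_point[OF AB(1) _ AB(2) assms(2) edges] ab(1) by simp
  next
    case (Inr V)
    have "{a, b} \<in> snd (incidence_graph P \<V>)" using edges ab by blast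
    then obtain x where x: "b = Inl x" unfolding incidence_graph_edge_iff using Inr by auto
    have "\<forall>b\<in>B. \<forall>a\<in>A. {b, a} \<in> snd (incidence_graph P \<V>)"
      using edges unfolding incidence_graph_edge_iff by blast
    then show ?thesis
      using complete_bipartite_from_point[OF AB(2) _ AB(1) assms(2)] ab(2) x by simp
  qed
qed

subsection \<open>Choice of the prime\<close>

lemma Fp_closure_props:
  assumes p: "Factorial_Ring.prime p"
  shows "field (Fp_closure p)" "infinite (carrier (Fp_closure p))" "subfield (Fp p) (Fp_closure p)"
    "card (Fp p) = p"
proof -
  interpret res: residues_prime p "residue_ring (int p)" by unfold_locales (use p in auto)
  interpret K: algebraic_closure "Fp_closure p" "Fp p"
    using field.alg_closureE(1)[OF res.is_field] by (simp add: Fp_closure_def Fp_def)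
  show "field (Fp_closure p)" by (rule K.field_axioms)
  show "infinite (carrier (Fp_closure p))" by (rule K.infinite_carrier)
  show "subfield (Fp p) (Fp_closure p)" by (rule K.subfield_axioms)
  show "card (Fp p) = p"
  proof -
    have "card (Fp p) = card (carrier (residue_ring (int p)))"
      unfolding Fp_def by (rule card_image[OF ring.indexed_const_inj_on[OF field.is_ring[OF res.is_field]]])
    then show ?thesis unfolding res.res_carrier_eq by simp
  qed
qed

lemma ex_prime_power_near:
  assumes m: "2 ^ (9 * n) < m" and n: "0 < n"
  obtains p :: nat where "Factorial_Ring.prime p" "m \<le> p ^ n" "p ^ n \<le> 32 ^ n * m"
proof -
  define k where "k = (LEAST k. m \<le> 2 ^ (k * n))"
  have "m < 2 ^ m" by (rule less_exp)
  also have "\<dots> \<le> 2 ^ (m * n)" using n by (intro power_increasing) auto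
  finally have "\<exists>k. m \<le> 2 ^ (k * n)" using less_imp_le by blast
  then have k: "m \<le> 2 ^ (k * n)" unfolding k_def by (rule LeastI_ex)
  have "(2::nat) ^ (9 * n) < 2 ^ (k * n)" using m k by linarith
  then have k10: "10 \<le> k" by simp
  have "\<not> m \<le> 2 ^ ((k - 1) * n)" using not_less_Least[of "k - 1" "\<lambda>k. m \<le> 2 ^ (k * n)"] k10 unfolding k_def by simp
  then have k': "2 ^ ((k - 1) * n) \<le> m" by simp
  obtain p :: nat where p: "Factorial_Ring.prime p" "2 ^ k < p" "p \<le> 2 ^ (k + 4)" using ex_prime_dyadic[OF k10] .
  have "m \<le> (2 ^ k) ^ n" using k by (simp add: power_mult)
  also have "\<dots> \<le> p ^ n" using p(2) by (intro power_mono) auto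
  finally have "m \<le> p ^ n" .
  moreover have "p ^ n \<le> 32 ^ n * m"
  proof -
    have e: "k + 4 = 5 + (k - 1)" using k10 by simp
    have "p \<le> 32 * 2 ^ (k - 1)" using p(3) unfolding e power_add by simp
    then have "p ^ n \<le> (32 * 2 ^ (k - 1)) ^ n" by (intro power_mono) auto
    also have "\<dots> = 32 ^ n * 2 ^ ((k - 1) * n)" by (simp add: power_mult_distrib power_mult)
    also have "\<dots> \<le> 32 ^ n * m" using k' by simp
    finally show ?thesis .
  qed
  ultimately show ?thesis using that p(1) by blast
qed

lemma powr_fraction_bound:
  fixes p m d :: nat
  assumes p: "0 < p" and m: "0 < m" and le: "p ^ Suc d \<le> 32 ^ Suc d * m"
  shows "1 / 32 * real m powr (real d / (real d + 1)) \<le> real m / real p"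
proof -
  let ?e = "1 / (real d + 1)"
  have root: "(x ^ Suc d) powr ?e = x" if "0 < x" for x :: real
  proof -
    have "(x ^ Suc d) powr ?e = (x powr real (Suc d)) powr ?e"
      using powr_realpow[OF that, of "Suc d"] by simp
    also have "\<dots> = x powr (real (Suc d) * ?e)" by (rule powr_powr)
    also have "real (Suc d) * ?e = 1" by (simp add: add.commute)
    finally show ?thesis using that by simp
  qed
  have "real p = (real p ^ Suc d) powr ?e" using root p by simp
  also have "\<dots> \<le> (32 ^ Suc d * real m) powr ?e"
  proof (rule powr_mono2)
    have "real (p ^ Suc d) \<le> real (32 ^ Suc d * m)" using le by (simp only: of_nat_le_iff)
    then show "real p ^ Suc d \<le> 32 ^ Suc d * real m" by simp
  qed auto
  also have "\<dots> = 32 * real m powr ?e" using root[of 32] by (simp add: powr_mult del: power_Suc)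
  finally have "real p \<le> 32 * real m powr ?e" .
  then have "real m powr (real d / (real d + 1)) * real p
      \<le> real m powr (real d / (real d + 1)) * (32 * real m powr ?e)" by (intro mult_left_mono) auto
  also have "\<dots> = 32 * real m powr (real d / (real d + 1) + ?e)" by (simp add: powr_add)
  also have "real d / (real d + 1) + ?e = 1" by (simp flip: add_divide_distrib)
  finally have "real m powr (real d / (real d + 1)) * real p \<le> 32 * real m" using m by simp
  then show ?thesis using p by (simp add: field_simps)
qed

lemma prime_power_bound:
  fixes p m n d s :: nat and \<alpha> :: real
  assumes p: "0 < p" and le: "m \<le> p ^ Suc d" and \<alpha>: "0 < \<alpha>"
    and n: "int n = \<lfloor>real m powr \<alpha>\<rfloor>" and s: "int s = \<lceil>(1 + \<alpha>) * (real d + 1)\<rceil>"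
  shows "p ^ Suc d * n \<le> p ^ s"
proof -
  have p1: "1 \<le> real p" using p by simp
  have pow: "real p ^ Suc d = real p powr (real d + 1)"
    using powr_realpow[of "real p" "Suc d"] p by (simp del: power_Suc add: add.commute)
  have "real n \<le> real m powr \<alpha>" using n by (metis of_int_floor_le of_int_of_nat_eq)
  also have "\<dots> \<le> (real p ^ Suc d) powr \<alpha>"
    using le \<alpha> by (intro powr_mono2) (simp_all flip: of_nat_power del: power_Suc)
  also have "\<dots> = real p powr ((real d + 1) * \<alpha>)" unfolding pow by (rule powr_powr)
  finally have "real p ^ Suc d * real n \<le> real p powr (real d + 1) * real p powr ((real d + 1) * \<alpha>)"
    unfolding pow by (intro mult_left_mono) auto
  also have "\<dots> = real p powr ((1 + \<alpha>) * (real d + 1))"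
    by (simp add: powr_add[symmetric] algebra_simps)
  also have "\<dots> \<le> real p powr real s"
  proof (rule powr_mono[OF _ p1])
    have "(1 + \<alpha>) * (real d + 1) \<le> real_of_int (int s)" unfolding s by (rule le_of_int_ceiling)
    then show "(1 + \<alpha>) * (real d + 1) \<le> real s" by simp
  qed
  also have "\<dots> = real p ^ s" using p by (simp add: powr_realpow)
  finally have "real (p ^ Suc d * n) \<le> real (p ^ s)" by simp
  then show ?thesis by (simp only: of_nat_le_iff)
qed

lemma ex_points_graphs_incidences:
  fixes d D m n s p :: nat
  assumes d: "0 < d" "d < D" and p: "Factorial_Ring.prime p" and s: "2 \<le> s" and m: "m \<le> p ^ Suc d"
    and n: "p ^ Suc d * n \<le> p ^ s" and sp: "s \<le> p ^ d"
  shows "\<exists>P \<V>. P \<subseteq> affine_space (Fp p) D \<and> finite P \<and> card P = m \<and> finite \<V> \<and> card \<V> = n \<and>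
          (\<forall>V\<in>\<V>. variety (Fp_closure p) D V \<and> variety_dim (Fp_closure p) D V = d \<and>
                  variety_degree (Fp_closure p) D V = of_nat s) \<and>
          \<not> contains_complete_bipartite (incidence_graph P \<V>) s s \<and> m * n \<le> p * incidences P \<V>"
proof -
  interpret K: field "Fp_closure p" by (rule Fp_closure_props(1)[OF p])
  note k = Fp_closure_props(3)[OF p] and ck = Fp_closure_props(4)[OF p]
  have p0: "0 < p" using prime_gt_0_nat[OF p] .
  have fk: "finite (Fp p)" using ck p0 by (intro card_ge_0_finite) simp
  have s0: "0 < s" using s by simp
  let ?Q = "K.flat_points (Fp p) d D" and ?H = "K.graph_family (Fp p) d D s"
  have Q: "finite ?Q" "card ?Q = p ^ Suc d"
    using K.finite_flat_points[OF k fk d s0] K.card_flat_points[OF k fk d s0] ck by simp_all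
  have H: "finite ?H" by (rule K.finite_graph_family[OF k fk d s0])
  have "n = 1 * n" by simp
  also have "\<dots> \<le> p ^ Suc d * n" using p0 by (intro mult_right_mono) (auto simp: Suc_le_eq)
  also have "\<dots> \<le> p ^ s" by (rule n)
  also have "\<dots> \<le> card ?H" using K.card_graph_family_ge[OF k fk d s0] sp ck by simp
  finally have nH: "n \<le> card ?H" .
  have "\<exists>S\<subseteq>?H. card S = n \<and>
      \<not> (\<exists>A B. A \<subseteq> ?Q \<and> B \<subseteq> S \<and> card A = s \<and> card B = s \<and> (\<forall>b\<in>B. A \<subseteq> id b))"
  proof (rule ex_subfamily_without_bipartite[OF H Q(1) nH s])
    show "0 < p ^ s" using p0 by simp
    show "card {h \<in> ?H. A \<subseteq> id h} * p ^ s \<le> card ?H" if "A \<subseteq> ?Q" "card A = s" for A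
      using K.card_graphs_through_le[OF k fk d s0 that] ck by simp
    show "card ?Q ^ s * n ^ s \<le> (p ^ s) ^ s"
      unfolding Q(2) power_mult_distrib[symmetric] by (rule power_mono[OF n]) simp
  qed
  then obtain S where S: "S \<subseteq> ?H" "card S = n"
    and free: "\<not> (\<exists>A B. A \<subseteq> ?Q \<and> B \<subseteq> S \<and> card A = s \<and> card B = s \<and> (\<forall>b\<in>B. A \<subseteq> b))"
    by auto
  have fS: "finite S" using S(1) H finite_subset by blast
  let ?f = "\<lambda>x. card {V \<in> S. x \<in> V}"
  obtain P where P: "P \<subseteq> ?Q" "card P = m" and avg: "m * sum ?f ?Q \<le> card ?Q * sum ?f P"
    using ex_subset_sum_ge_average[OF Q(1), of m ?f] m Q(2) by auto
  have fP: "finite P" using P(1) Q(1) finite_subset by blast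
  have "sum ?f ?Q = (\<Sum>V\<in>S. card (?Q \<inter> V))"
    using sum.swap_restrict[OF Q(1) fS, of "\<lambda>_ _. 1 :: nat" "\<lambda>x V. x \<in> V"]
    by (simp add: Int_def conj_commute)
  also have "\<dots> = n * p ^ d"
    using K.card_flat_points_graph[OF k fk d s0] S ck by (simp add: subset_iff)
  finally have "p ^ d * (m * n) \<le> p ^ d * (p * sum ?f P)"
    using avg unfolding Q(2) by (simp add: mult_ac)
  then have inc: "m * n \<le> p * incidences P S"
    using p0 incidences_eq_sum[OF fP fS] by simp
  have var: "variety (Fp_closure p) D V \<and> variety_dim (Fp_closure p) D V = d \<and>
      variety_degree (Fp_closure p) D V = of_nat s" if "V \<in> S" for V
  proof -
    obtain g where g: "g \<in> K.subfield_polys (Fp p) d s"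
      and V: "V = K.graph_variety d D (K.add_top_power s g)"
      using K.graph_family_mem[OF k fk d s0] S(1) \<open>V \<in> S\<close> by blast
    interpret G: graph_of_monic "Fp_closure p" d D s g
      by unfold_locales (rule Fp_closure_props(2)[OF p] d s0 K.subfield_polysD[OF g] | assumption)+
    show ?thesis unfolding V using G.variety_graph G.variety_dim_graph G.variety_degree_graph by simp
  qed
  have PF: "P \<subseteq> affine_space (Fp p) D" using P(1) by (auto simp: K.flat_points_def)
  have "\<not> contains_complete_bipartite (incidence_graph P S) s s"
    using complete_bipartite_incidence_graph[OF _ s0, of P S] free P(1) by blast
  then show ?thesis
    using PF fP P(2) fS S(2) var inc by (intro exI[of _ P] exI[of _ S]) blast
qed

theorem theorem1p5:
  shows "\<exists>(c :: nat \<Rightarrow> real \<Rightarrow> real) (N :: nat \<Rightarrow> real \<Rightarrow> nat).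
    (\<forall>d \<alpha>. 0 < d \<longrightarrow> 0 < \<alpha> \<longrightarrow> 0 < c d \<alpha>) \<and>
    (\<forall>(d::nat) (D::nat) (\<alpha>::real) (m::nat) (n::nat) (s::nat) (\<Delta>::nat).
       0 < d \<longrightarrow> d < D \<longrightarrow> 0 < \<alpha> \<longrightarrow> 0 < m \<longrightarrow> 0 < n \<longrightarrow>
       int n = \<lfloor>real m powr \<alpha>\<rfloor> \<longrightarrow> N D \<alpha> \<le> m \<longrightarrow> N D \<alpha> \<le> n \<longrightarrow>
       int s = \<lceil>(1 + \<alpha>) * (real d + 1)\<rceil> \<longrightarrow> \<Delta> = s\<^sup>2 \<longrightarrow>
       (\<exists>(p::nat) P \<V>. Factorial_Ring.prime p \<and>
          P \<subseteq> affine_space (Fp p) D \<and> finite P \<and> card P = m \<and>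
          finite \<V> \<and> card \<V> = n \<and>
          (\<forall>V\<in>\<V>. variety (Fp_closure p) D V \<and>
                  variety_dim (Fp_closure p) D V = d \<and>
                  variety_degree (Fp_closure p) D V \<le> of_nat \<Delta>) \<and>
          \<not> contains_complete_bipartite (incidence_graph P \<V>) s s \<and>
          real (incidences P \<V>) \<ge> c d \<alpha> * (real m powr (real d / (real d + 1)) * real n)))"
proof (intro exI[of _ "\<lambda>_ _. 1 / 32"]
    exI[of _ "\<lambda>D \<alpha>. max (Suc (2 ^ (9 * D))) ((nat \<lceil>(1 + \<alpha>) * real D\<rceil>)\<^sup>2)"] conjI allI impI)
  fix d D m n s \<Delta> :: nat and \<alpha> :: real
  assume d: "0 < d" "d < D" and \<alpha>: "0 < \<alpha>" and m0: "0 < m" and n: "int n = \<lfloor>real m powr \<alpha>\<rfloor>"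
    and N: "max (Suc (2 ^ (9 * D))) ((nat \<lceil>(1 + \<alpha>) * real D\<rceil>)\<^sup>2) \<le> m"
    and s: "int s = \<lceil>(1 + \<alpha>) * (real d + 1)\<rceil>" and \<Delta>: "\<Delta> = s\<^sup>2"
  have "(2::nat) ^ (9 * Suc d) \<le> 2 ^ (9 * D)" using d by (intro power_increasing) auto
  then have "2 ^ (9 * Suc d) < m" using N by linarith
  then obtain p where p: "Factorial_Ring.prime p" and mp: "m \<le> p ^ Suc d" and pm: "p ^ Suc d \<le> 32 ^ Suc d * m"
    using ex_prime_power_near[of "Suc d" m] by blast
  have p0: "0 < p" using prime_gt_0_nat[OF p] .
  have s2: "2 \<le> s"
  proof -
    have "1 * 2 \<le> (1 + \<alpha>) * (real d + 1)" using d \<alpha> by (intro mult_mono) auto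
    then have "2 \<le> \<lceil>(1 + \<alpha>) * (real d + 1)\<rceil>" by (simp add: le_ceiling_iff)
    then have "2 \<le> int s" unfolding s .
    then show ?thesis by simp
  qed
  have sp: "s \<le> p ^ d"
  proof -
    have "(1 + \<alpha>) * (real d + 1) \<le> (1 + \<alpha>) * real D" using d \<alpha> by (intro mult_left_mono) auto
    then have "int s \<le> \<lceil>(1 + \<alpha>) * real D\<rceil>" unfolding s by (rule ceiling_mono)
    then have "s\<^sup>2 \<le> (nat \<lceil>(1 + \<alpha>) * real D\<rceil>)\<^sup>2" by (intro power_mono) auto
    also have "\<dots> \<le> p ^ Suc d" using N mp by simp
    also have "\<dots> \<le> p ^ (d * 2)" using d p0 by (intro power_increasing) auto
    also have "\<dots> = (p ^ d)\<^sup>2" by (rule power_mult)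
    finally show ?thesis by (simp add: power2_nat_le_eq_le)
  qed
  obtain P \<V> where PV: "P \<subseteq> affine_space (Fp p) D" "finite P" "card P = m" "finite \<V>" "card \<V> = n"
    and var: "\<forall>V\<in>\<V>. variety (Fp_closure p) D V \<and> variety_dim (Fp_closure p) D V = d \<and>
                  variety_degree (Fp_closure p) D V = of_nat s"
    and free: "\<not> contains_complete_bipartite (incidence_graph P \<V>) s s"
    and inc: "m * n \<le> p * incidences P \<V>"
    using ex_points_graphs_incidences[OF d p s2 mp prime_power_bound[OF p0 mp \<alpha> n s] sp] by blast
  have "s \<le> \<Delta>" unfolding \<Delta> by (simp add: power2_eq_square)
  then have deg: "(of_nat s :: rat) \<le> of_nat \<Delta>" by simp
  have "1 / 32 * (real m powr (real d / (real d + 1)) * real n) \<le> real m / real p * real n"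
    using mult_right_mono[OF powr_fraction_bound[OF p0 m0 pm], of "real n"] by simp
  also have "\<dots> \<le> real (incidences P \<V>)"
  proof -
    have "real (m * n) \<le> real (p * incidences P \<V>)" using inc by (simp only: of_nat_le_iff)
    then show ?thesis using p0 by (simp add: field_simps)
  qed
  finally have "1 / 32 * (real m powr (real d / (real d + 1)) * real n) \<le> real (incidences P \<V>)" .
  then show "\<exists>(p::nat) P \<V>. Factorial_Ring.prime p \<and>
          P \<subseteq> affine_space (Fp p) D \<and> finite P \<and> card P = m \<and>
          finite \<V> \<and> card \<V> = n \<and>
          (\<forall>V\<in>\<V>. variety (Fp_closure p) D V \<and>
                  variety_dim (Fp_closure p) D V = d \<and>
                  variety_degree (Fp_closure p) D V \<le> of_nat \<Delta>) \<and>
          \<not> contains_complete_bipartite (incidence_graph P \<V>) s s \<and>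
          1 / 32 * (real m powr (real d / (real d + 1)) * real n) \<le> real (incidences P \<V>)"
    using p PV var free deg by (intro exI[of _ p] exI[of _ P] exI[of _ \<V>]) auto
qed simp

end
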